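(* Let $G$ be a $2$-connected graph which is not a cycle. If $G$ is $\{K_{1,3},Z_2\}$-$f_1$-heavy, then $G$ is pancyclic.
   Context: All graphs are finite and simple. Let $G$ be a graph on $n$ vertices, and $d(x)$ the degree of $x$ in $G$. For a subgraph $H$ and $x,y\in V(H)$, $d_H(x,y)$ is the length of a shortest $(x,y)$-path in $H$. An induced subgraph $H$ of $G$ is called $f_1$-heavy if for every pair of vertices $u,v\in V(H)$ with $d_H(u,v)=2$ we have $\max\{d(u),d(v)\}\geq (n+1)/2$ (degrees taken in $G$). For a graph $R$, $G$ is $R$-$f_1$-heavy if every induced subgraph of $G$ isomorphic to $R$ is $f_1$-heavy; for a family $\mathcal{R}$ of graphs, $G$ is $\mathcal{R}$-$f_1$-heavy if it is $R$-$f_1$-heavy for every $R\in\mathcal{R}$. $K_{1,3}$ is the claw. $Z_i$ denotes the graph obtained from the path $a_1a_2\cdots a_{i+3}$ by adding the edge $a_1a_3$ (a triangle with a pendant path of length $i$ attached at one vertex); so $Z_2$ has 5 vertices. A graph on $n$ vertices is pancyclic if it contains cycles of every length from $3$ to $n$. *)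

theory Defs
  imports Complex_Main
begin

definition simple_graph :: "'a set \<Rightarrow> ('a \<Rightarrow> 'a \<Rightarrow> bool) \<Rightarrow> bool" where
  "simple_graph V E \<longleftrightarrow> finite V \<and> (\<forall>x y. E x y \<longrightarrow> x \<in> V \<and> y \<in> V)
     \<and> (\<forall>x y. E x y \<longrightarrow> E y x) \<and> (\<forall>x. \<not> E x x)"

definition deg :: "'a set \<Rightarrow> ('a \<Rightarrow> 'a \<Rightarrow> bool) \<Rightarrow> 'a \<Rightarrow> nat" where
  "deg V E x = card {y \<in> V. E x y}"

definition is_path :: "'a set \<Rightarrow> ('a \<Rightarrow> 'a \<Rightarrow> bool) \<Rightarrow> 'a list \<Rightarrow> bool" where
  "is_path S E xs \<longleftrightarrow> xs \<noteq> [] \<and> distinct xs \<and> set xs \<subseteq> S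
     \<and> (\<forall>i. Suc i < length xs \<longrightarrow> E (xs ! i) (xs ! Suc i))"

definition path_between :: "'a set \<Rightarrow> ('a \<Rightarrow> 'a \<Rightarrow> bool) \<Rightarrow> 'a \<Rightarrow> 'a \<Rightarrow> 'a list \<Rightarrow> bool" where
  "path_between S E u v xs \<longleftrightarrow> is_path S E xs \<and> hd xs = u \<and> last xs = v"

definition has_dist :: "'a set \<Rightarrow> ('a \<Rightarrow> 'a \<Rightarrow> bool) \<Rightarrow> 'a \<Rightarrow> 'a \<Rightarrow> nat \<Rightarrow> bool" where
  "has_dist S E u v k \<longleftrightarrow>
     (\<exists>xs. path_between S E u v xs \<and> length xs = Suc k)
     \<and> (\<forall>xs. path_between S E u v xs \<longrightarrow> Suc k \<le> length xs)"

definition f1_heavy :: "'a set \<Rightarrow> ('a \<Rightarrow> 'a \<Rightarrow> bool) \<Rightarrow> 'a set \<Rightarrow> bool" where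
  "f1_heavy V E S \<longleftrightarrow> (\<forall>u\<in>S. \<forall>v\<in>S. has_dist S E u v 2 \<longrightarrow>
     real (max (deg V E u) (deg V E v)) \<ge> (real (card V) + 1) / 2)"

definition R_f1_heavy :: "'a set \<Rightarrow> ('a \<Rightarrow> 'a \<Rightarrow> bool) \<Rightarrow> 'b set \<Rightarrow> ('b \<Rightarrow> 'b \<Rightarrow> bool) \<Rightarrow> bool" where
  "R_f1_heavy V E RV RE \<longleftrightarrow> (\<forall>S f. S \<subseteq> V \<and> bij_betw f RV S
      \<and> (\<forall>a\<in>RV. \<forall>b\<in>RV. E (f a) (f b) \<longleftrightarrow> RE a b) \<longrightarrow> f1_heavy V E S)"

definition claw_V :: "nat set" where "claw_V = {0,1,2,3}"
definition claw_E :: "nat \<Rightarrow> nat \<Rightarrow> bool" where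
  "claw_E a b \<longleftrightarrow> (a = 0 \<and> b \<in> {1,2,3}) \<or> (b = 0 \<and> a \<in> {1,2,3})"

definition Z2_V :: "nat set" where "Z2_V = {0,1,2,3,4}"
definition Z2_E :: "nat \<Rightarrow> nat \<Rightarrow> bool" where
  "Z2_E a b \<longleftrightarrow> {a,b} \<in> {{0,1},{1,2},{2,3},{3,4},{0,2}}"

definition connected_on :: "'a set \<Rightarrow> ('a \<Rightarrow> 'a \<Rightarrow> bool) \<Rightarrow> bool" where
  "connected_on S E \<longleftrightarrow> (\<forall>u\<in>S. \<forall>v\<in>S. \<exists>xs. path_between S E u v xs)"

definition two_connected :: "'a set \<Rightarrow> ('a \<Rightarrow> 'a \<Rightarrow> bool) \<Rightarrow> bool" where
  "two_connected V E \<longleftrightarrow> card V \<ge> 3 \<and> connected_on V E \<and> (\<forall>x\<in>V. connected_on (V - {x}) E)"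

definition is_cycle_graph :: "'a set \<Rightarrow> ('a \<Rightarrow> 'a \<Rightarrow> bool) \<Rightarrow> bool" where
  "is_cycle_graph V E \<longleftrightarrow> (\<exists>xs. distinct xs \<and> set xs = V \<and> length xs \<ge> 3 \<and>
     (\<forall>u v. E u v \<longleftrightarrow> (\<exists>i<length xs. {u, v} = {xs ! i, xs ! ((i + 1) mod length xs)})))"

definition has_cycle :: "'a set \<Rightarrow> ('a \<Rightarrow> 'a \<Rightarrow> bool) \<Rightarrow> nat \<Rightarrow> bool" where
  "has_cycle V E k \<longleftrightarrow> k \<ge> 3 \<and> (\<exists>xs. distinct xs \<and> length xs = k \<and> set xs \<subseteq> V \<and>
     (\<forall>i<k. E (xs ! i) (xs ! ((i + 1) mod k))))"

definition pancyclic :: "'a set \<Rightarrow> ('a \<Rightarrow> 'a \<Rightarrow> bool) \<Rightarrow> bool" where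
  "pancyclic V E \<longleftrightarrow> (\<forall>k. 3 \<le> k \<and> k \<le> card V \<longrightarrow> has_cycle V E k)"

end

theory Submission
  imports Defs
begin

text \<open>Call a vertex heavy if its degree is at least \<open>(n + 1) / 2\<close>.

  If there are at most three heavy vertices, start from a short cycle through all of them and
  enlarge it one vertex at a time: all vertices off the cycle are then light, and light vertices
  force enough chords, via the claw and \<open>Z\<^sub>2\<close> conditions, to insert one of them. Two nonadjacent
  heavy vertices in the role of a chord are handled by a degree count as in Bondy and Chvatal.

  If there are at least four, the same argument applied to a longest cycle through all heavy
  vertices shows that it is Hamiltonian. If \<open>G\<close> were not pancyclic, then no Hamiltonian path would
  join two heavy vertices, and no heavy vertex could be skipped on a Hamiltonian cycle. From this
  every vertex has at most two heavy neighbours, so the heavy degrees sum up to at most \<open>2 n\<close>,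
  which is too small for four of them.\<close>

section \<open>Cycles as lists, and the two induced subgraphs\<close>

text \<open>The border between three and four heavy vertices is set from both sides: up to three,
  most local contradictions consist in finding a fourth one, while the final count needs
  \<open>4 * (card V + 1) > 4 * card V\<close>. The obstacle in the case of few heavy vertices is
  that a step may add only one vertex, for otherwise a cycle length is lost. A common neighbour off
  the cycle would close a path between nonadjacent heavy ends but add a second vertex, so such a
  pair acts as a chord only if it has no such neighbour. For a longest cycle this does not matter,
  and all heavy pairs act as chords. One configuration still resists: a triangle with two outside
  vertices placed across one of its edges. It yields a 4-cycle and a 5-cycle, and only the latter is
  sure to contain the triangle. As for the threshold, two heavy degrees sum to at least n + 1, one
  more than in Ore's condition; with sum n the balanced complete bipartite graph, which is not
  pancyclic, would satisfy it.\<close>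

definition cyc :: "('a \<Rightarrow> 'a \<Rightarrow> bool) \<Rightarrow> 'a list \<Rightarrow> bool" where
  "cyc E xs \<longleftrightarrow> 3 \<le> length xs \<and> distinct xs \<and> successively E xs \<and> E (last xs) (hd xs)"

lemma cyc_rotate_append: "cyc E (xs @ ys) \<Longrightarrow> cyc E (ys @ xs)"
  by (cases "xs = []"; cases "ys = []")
    (auto simp: cyc_def successively_append_iff)

lemma cyc_rev:
  assumes "cyc E xs" "\<And>x y. E x y \<Longrightarrow> E y x"
  shows "cyc E (rev xs)"
proof -
  have "successively (\<lambda>x y. E y x) xs"
    by (rule successively_mono[of E]) (use assms in \<open>auto simp: cyc_def\<close>)
  then show ?thesis
    using assms by (auto simp: cyc_def hd_rev last_rev)
qed

lemma cyc_at:
  assumes "cyc E xs" "c \<in> set xs"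
  obtains Z where "cyc E (c # Z)" "set (c # Z) = set xs" "length (c # Z) = length xs" "Z \<noteq> []"
proof -
  obtain as bs where "xs = as @ c # bs"
    using assms(2) by (meson split_list)
  then have "cyc E (c # bs @ as)"
    using assms(1) cyc_rotate_append[of E as "c # bs"] by simp
  moreover have "bs @ as \<noteq> []"
    using calculation by (auto simp: cyc_def)
  ultimately show ?thesis
    using that[of "bs @ as"] \<open>xs = as @ c # bs\<close> by auto
qed

lemma cyc_at2:
  assumes "cyc E xs" "c \<in> set xs" "d \<in> set xs" "c \<noteq> d"
  obtains W U where "cyc E (c # W @ d # U)" "set (c # W @ d # U) = set xs"
    "length (c # W @ d # U) = length xs"
proof -
  obtain Z where Z: "cyc E (c # Z)" "set (c # Z) = set xs" "length (c # Z) = length xs"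
    using cyc_at[OF assms(1,2)] by metis
  then obtain W U where "Z = W @ d # U"
    using assms(3,4) by (metis set_ConsD split_list)
  then show ?thesis using that Z by auto
qed

lemma cyc_nth:
  assumes "cyc E xs" "i < length xs"
  shows "E (xs ! i) (xs ! ((i + 1) mod length xs))"
proof (cases "Suc i = length xs")
  case True
  then have "(i + 1) mod length xs = 0" "i = length xs - 1" by auto
  moreover have "xs \<noteq> []" using assms by auto
  ultimately show ?thesis
    using assms by (simp add: cyc_def last_conv_nth hd_conv_nth)
next
  case False
  then show ?thesis
    using assms by (auto simp: cyc_def successively_conv_nth)
qed

lemma has_cycle_if_cyc:
  assumes "cyc E xs" "set xs \<subseteq> V" "length xs = k"
  shows "has_cycle V E k"
  unfolding has_cycle_def using assms cyc_nth[OF assms(1)]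
  by (auto simp: cyc_def intro!: exI[of _ xs])

lemma is_path_iff:
  "is_path S E xs \<longleftrightarrow> xs \<noteq> [] \<and> distinct xs \<and> set xs \<subseteq> S \<and> successively E xs"
  by (auto simp: is_path_def successively_conv_nth)

locale finite_graph =
  fixes V :: "'a set" and E :: "'a \<Rightarrow> 'a \<Rightarrow> bool"
  assumes finV: "finite V"
    and EV: "E x y \<Longrightarrow> x \<in> V"
    and Esym: "E x y \<Longrightarrow> E y x"
    and Eirr: "\<not> E x x"
begin

lemma EV2: "E x y \<Longrightarrow> y \<in> V"
  using EV Esym by blast

lemma Ecomm: "E x y \<longleftrightarrow> E y x"
  using Esym by blast

lemma Eneq: "E x y \<Longrightarrow> x \<noteq> y"
  using Eirr by auto

lemma successively_flip [simp]: "successively (\<lambda>x y. E y x) xs \<longleftrightarrow> successively E xs"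
  using successively_mono[of "\<lambda>x y. E y x" xs E] successively_mono[of E xs "\<lambda>x y. E y x"] Esym
  by blast

lemma cyc_rev': "cyc E xs \<Longrightarrow> cyc E (rev xs)"
  using cyc_rev Esym by blast

definition nb :: "'a \<Rightarrow> 'a set" where
  "nb x = {y. E x y}"

lemma in_nb [simp]: "y \<in> nb x \<longleftrightarrow> E x y"
  by (simp add: nb_def)

lemma nb_V: "nb x \<subseteq> V"
  using EV2 by auto

lemma fin_nb [simp]: "finite (nb x)"
  using nb_V finV finite_subset by blast

lemma deg_nb: "deg V E x = card (nb x)"
  unfolding deg_def by (rule arg_cong[of _ _ card]) (auto simp: EV2)

lemma cyc_subset_V: "cyc E xs \<Longrightarrow> set xs \<subseteq> V"
proof
  fix x assume "cyc E xs" "x \<in> set xs"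
  then obtain Z where "cyc E (x # Z)" "Z \<noteq> []" using cyc_at by metis
  then show "x \<in> V" by (auto simp: cyc_def successively_Cons EV)
qed

text \<open>The letter stands for heavy. Doubling the degree keeps the bound (n + 1) / 2 in the
  natural numbers, where all later counts take place.\<close>

definition H :: "'a set" where
  "H = {x. card V + 1 \<le> 2 * card (nb x)}"

lemma H_V: "H \<subseteq> V"
proof
  fix x assume "x \<in> H"
  then have "nb x \<noteq> {}" by (auto simp: H_def)
  then show "x \<in> V" using EV by auto
qed

lemma finH [simp]: "finite H"
  using H_V finV finite_subset by blast

lemma heavy_sum: "u \<in> H \<Longrightarrow> v \<in> H \<Longrightarrow> card V + 1 \<le> card (nb u) + card (nb v)"
  by (auto simp: H_def)

lemma has_dist_2I:
  assumes "u \<in> S" "v \<in> S" "w \<in> S" "E u w" "E w v" "\<not> E u v" "u \<noteq> v"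
  shows "has_dist S E u v 2"
  unfolding has_dist_def
proof (intro conjI allI impI exI)
  show "path_between S E u v [u, w, v]"
    using assms Eneq by (auto simp: path_between_def is_path_iff)
  fix xs assume xs: "path_between S E u v xs"
  show "Suc 2 \<le> length xs"
  proof (rule ccontr)
    assume "\<not> Suc 2 \<le> length xs"
    then have "length xs \<le> 2" by auto
    then consider "xs = []" | a where "xs = [a]" | a b where "xs = [a, b]"
      by (cases xs; cases "tl xs") auto
    then show False
      using xs assms by cases (auto simp: path_between_def is_path_iff)
  qed
qed auto

text \<open>The vertex \<open>w\<close> certifies distance two, so that distances do not appear in
  the later arguments.\<close>

lemma f1_heavyD:
  assumes "f1_heavy V E S" "u \<in> S" "v \<in> S" "w \<in> S" "E u w" "E w v" "\<not> E u v" "u \<noteq> v"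
  shows "u \<in> H \<or> v \<in> H"
proof -
  have "(real (card V) + 1) / 2 \<le> real (max (deg V E u) (deg V E v))"
    using assms has_dist_2I[of u S v w] by (auto simp: f1_heavy_def)
  then have "real (card V + 1) \<le> real (2 * max (deg V E u) (deg V E v))"
    by (simp add: field_simps)
  then have "card V + 1 \<le> 2 * max (deg V E u) (deg V E v)"
    by (simp only: of_nat_le_iff)
  then show ?thesis
    by (auto simp: H_def deg_nb max_def split: if_splits)
qed

end

locale claw_Z2_heavy_graph = finite_graph +
  assumes clawf: "R_f1_heavy V E claw_V claw_E"
    and Z2f: "R_f1_heavy V E Z2_V Z2_E"
begin

text \<open>Any two leaves of an induced claw are at distance two. One pair suffices in the
  conclusion: by permuting the leaves, at most one of the three is light.\<close>

lemma claw:
  assumes "E c x" "E c y" "E c z" "\<not> E x y" "\<not> E x z" "\<not> E y z" "x \<noteq> y" "x \<noteq> z" "y \<noteq> z"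
  shows "x \<in> H \<or> y \<in> H"
proof -
  define f where "f = (\<lambda>i::nat. if i = 0 then c else if i = 1 then x else if i = 2 then y else z)"
  have dist: "c \<noteq> x" "c \<noteq> y" "c \<noteq> z"
    using assms Eneq by blast+
  have sym: "E x c" "E y c" "E z c" "\<not> E y x" "\<not> E z x" "\<not> E z y"
    using assms Esym by blast+
  have in_V: "{c, x, y, z} \<subseteq> V"
    using assms EV EV2 by blast
  have "f1_heavy V E {c, x, y, z}"
  proof -
    have "bij_betw f claw_V {c, x, y, z}"
      using assms dist by (auto simp: bij_betw_def inj_on_def claw_V_def f_def)
    moreover have "\<forall>a\<in>claw_V. \<forall>b\<in>claw_V. E (f a) (f b) \<longleftrightarrow> claw_E a b"
      using assms sym Eirr by (simp add: claw_V_def claw_E_def f_def)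
    ultimately show ?thesis
      using clawf in_V unfolding R_f1_heavy_def by blast
  qed
  then show ?thesis
    by (rule f1_heavyD[where w = c]) (use assms sym in simp_all)
qed

text \<open>The triangle is \<open>a\<close>, \<open>b\<close>, \<open>c\<close> and the pendant
  path is \<open>c\<close>, \<open>d\<close>, \<open>e\<close>. The conclusions cover the three
  pairs at distance two; \<open>a\<close>, \<open>e\<close> and \<open>b\<close>, \<open>e\<close>
  are at distance three and give nothing.\<close>

lemma Z2:
  assumes "E a b" "E b c" "E a c" "E c d" "E d e"
    "\<not> E a d" "\<not> E b d" "\<not> E a e" "\<not> E b e" "\<not> E c e"
  shows "a \<in> H \<or> d \<in> H" "b \<in> H \<or> d \<in> H" "c \<in> H \<or> e \<in> H"
proof -
  define f where "f = (\<lambda>i::nat. if i = 0 then a else if i = 1 then b else if i = 2 then c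
    else if i = 3 then d else e)"
  have dist: "distinct [a, b, c, d, e]"
    using assms Eneq Esym by (metis distinct_length_2_or_more distinct_singleton)
  have sym: "E b a" "E c b" "E c a" "E d c" "E e d"
    "\<not> E d a" "\<not> E d b" "\<not> E e a" "\<not> E e b" "\<not> E e c"
    using assms Esym by blast+
  have in_V: "{a, b, c, d, e} \<subseteq> V"
    using assms EV EV2 by blast
  have "f1_heavy V E {a, b, c, d, e}"
  proof -
    have "bij_betw f Z2_V {a, b, c, d, e}"
      using dist by (auto simp: bij_betw_def inj_on_def Z2_V_def f_def)
    moreover have "\<forall>i\<in>Z2_V. \<forall>j\<in>Z2_V. E (f i) (f j) \<longleftrightarrow> Z2_E i j"
      using assms sym Eirr by (simp add: Z2_V_def Z2_E_def f_def doubleton_eq_iff)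
    ultimately show ?thesis
      using Z2f in_V unfolding R_f1_heavy_def by blast
  qed
  note h = f1_heavyD[OF this]
  show "a \<in> H \<or> d \<in> H" by (rule h[where w = c]) (use assms sym dist in simp_all)
  show "b \<in> H \<or> d \<in> H" by (rule h[where w = c]) (use assms sym dist in simp_all)
  show "c \<in> H \<or> e \<in> H" by (rule h[where w = d]) (use assms sym dist in simp_all)
qed

end

section \<open>Cycles from the ends of a path\<close>

lemma successively_take: "successively P xs \<Longrightarrow> successively P (take n xs)"
  by (metis append_take_drop_id successively_append_iff)

lemma successively_drop: "successively P xs \<Longrightarrow> successively P (drop n xs)"
  by (metis append_take_drop_id successively_append_iff)

definition slice :: "nat \<Rightarrow> nat \<Rightarrow> 'a list \<Rightarrow> 'a list" where
  "slice i j xs = take (Suc j - i) (drop i xs)"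

lemma slice_props:
  assumes "i \<le> j" "j < length xs"
  shows "length (slice i j xs) = Suc j - i" "slice i j xs \<noteq> []"
    "hd (slice i j xs) = xs ! i" "last (slice i j xs) = xs ! j"
    "set (slice i j xs) = {xs ! l | l. i \<le> l \<and> l \<le> j}"
proof -
  show len: "length (slice i j xs) = Suc j - i"
    using assms by (simp add: slice_def)
  then show ne: "slice i j xs \<noteq> []" using assms by auto
  show "hd (slice i j xs) = xs ! i"
    using assms by (simp add: slice_def hd_drop_conv_nth)
  show "last (slice i j xs) = xs ! j"
    using assms ne len by (simp add: last_conv_nth) (simp add: slice_def)
  show "set (slice i j xs) = {xs ! l | l. i \<le> l \<and> l \<le> j}" (is "?L = ?R")
  proof
    show "?L \<subseteq> ?R"
    proof
      fix x assume "x \<in> ?L"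
      then obtain l where "l < Suc j - i" "x = slice i j xs ! l"
        using len by (metis in_set_conv_nth)
      then show "x \<in> ?R"
        using assms by (intro CollectI exI[of _ "i + l"]) (auto simp: slice_def)
    qed
    show "?R \<subseteq> ?L"
    proof
      fix x assume "x \<in> ?R"
      then obtain l where l: "i \<le> l" "l \<le> j" "x = xs ! l" by auto
      then have "x = slice i j xs ! (l - i)" "l - i < length (slice i j xs)"
        using assms len by (auto simp: slice_def)
      then show "x \<in> ?L" by auto
    qed
  qed
qed

lemma slice_succ: "successively P xs \<Longrightarrow> successively P (slice i j xs)"
  by (simp add: slice_def successively_take successively_drop)

lemma slice_distinct: "distinct xs \<Longrightarrow> distinct (slice i j xs)"
  by (simp add: slice_def)

lemma nth_in_slice:
  assumes "distinct xs" "i \<le> j" "j < length xs" "l < length xs"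
  shows "xs ! l \<in> set (slice i j xs) \<longleftrightarrow> i \<le> l \<and> l \<le> j"
  using assms by (auto simp: slice_props nth_eq_iff_index_eq)

context finite_graph
begin

definition path :: "'a list \<Rightarrow> bool" where
  "path p \<longleftrightarrow> p \<noteq> [] \<and> distinct p \<and> successively E p"

lemma path_rev: "path p \<Longrightarrow> path (rev p)"
  by (auto simp: path_def)

lemma card_nb_idx:
  assumes "distinct p"
  shows "card (nb u \<inter> set p) = card {i. i < length p \<and> E u (p ! i)}"
proof -
  have "inj_on ((!) p) {i. i < length p \<and> E u (p ! i)}"
    using assms by (auto simp: inj_on_def nth_eq_iff_index_eq)
  moreover have "(!) p ` {i. i < length p \<and> E u (p ! i)} = nb u \<inter> set p"
    by (auto simp: in_set_conv_nth)
  ultimately show ?thesis by (metis card_image)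
qed

text \<open>From the first end run to position \<open>i\<close>, jump to the last end, run back to
  position \<open>j\<close> and return to the first end. Exactly the vertices strictly between
  \<open>i\<close> and \<open>j\<close> are skipped.\<close>

lemma cyc_crossing:
  assumes "path p" "i < j" "j < length p" "E (last p) (p ! i)" "E (hd p) (p ! j)"
    "3 \<le> Suc i + (length p - j)"
  shows "cyc E (take (Suc i) p @ rev (drop j p))"
    "length (take (Suc i) p @ rev (drop j p)) = Suc i + (length p - j)"
    "set (take (Suc i) p @ rev (drop j p)) \<subseteq> set p"
proof -
  have ne: "take (Suc i) p \<noteq> []" "drop j p \<noteq> []" using assms by auto
  have "last (take (Suc i) p) = p ! i"
    using assms ne by (auto simp: last_conv_nth)
  moreover have "hd (drop j p) = p ! j" "last (drop j p) = last p"
    using assms by (auto simp: hd_drop_conv_nth)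
  moreover have "hd (take (Suc i) p) = hd p" using assms by (auto simp: path_def)
  moreover have "set (take (Suc i) p) \<inter> set (drop j p) = {}"
    using assms by (auto simp: path_def intro!: set_take_disj_set_drop_if_distinct)
  ultimately show "cyc E (take (Suc i) p @ rev (drop j p))"
    using assms ne Ecomm
    by (auto simp: cyc_def path_def successively_append_iff successively_take successively_drop
        hd_rev last_rev)
  show "length (take (Suc i) p @ rev (drop j p)) = Suc i + (length p - j)"
    using assms by auto
  show "set (take (Suc i) p @ rev (drop j p)) \<subseteq> set p"
    by (auto dest: in_set_takeD in_set_dropD)
qed

text \<open>The lengths of crossing cycles and of cycles through an interval of the path are the
  two branches of one injective map on positions.\<close>

lemma cyc_all_if_adjacent_ends:
  assumes p: "path p" "m = length p" "3 \<le> k" "k \<le> m" and uv: "E (hd p) (last p)"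
    and sum: "m + 1 \<le> card (nb (hd p) \<inter> set p) + card (nb (last p) \<inter> set p)"
  shows "\<exists>xs. cyc E xs \<and> set xs \<subseteq> set p \<and> length xs = k"
proof (rule ccontr)
  assume no: "\<not> ?thesis"
  define u v where "u = hd p" and "v = last p"
  define A B where "A = {i. 1 \<le> i \<and> i < m - 1 \<and> E u (p ! i)}"
    and "B = {i. 1 \<le> i \<and> i < m - 1 \<and> E v (p ! i)}"
  have u0: "p ! 0 = u" and vm: "p ! (m - 1) = v"
    using p by (auto simp: u_def v_def path_def hd_conv_nth last_conv_nth)
  have dp: "distinct p" using p by (simp add: path_def)
  have "{i. i < length p \<and> E u (p ! i)} \<subseteq> insert (m - 1) A"
  proof
    fix i assume i: "i \<in> {i. i < length p \<and> E u (p ! i)}"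
    then have "i \<noteq> 0" using u0 Eirr by (metis mem_Collect_eq)
    then show "i \<in> insert (m - 1) A" using i p by (auto simp: A_def)
  qed
  then have "card (nb u \<inter> set p) \<le> card (insert (m - 1) A)"
    unfolding card_nb_idx[OF dp] by (intro card_mono) (auto simp: A_def)
  then have cA: "card (nb u \<inter> set p) \<le> card A + 1"
    by (simp add: card_insert_if A_def split: if_splits)
  have "{i. i < length p \<and> E v (p ! i)} \<subseteq> insert 0 B"
  proof
    fix i assume i: "i \<in> {i. i < length p \<and> E v (p ! i)}"
    then have "i \<noteq> m - 1" using vm Eirr by (metis mem_Collect_eq)
    then show "i \<in> insert 0 B" using i p by (auto simp: B_def)
  qed
  then have "card (nb v \<inter> set p) \<le> card (insert 0 B)"
    unfolding card_nb_idx[OF dp] by (intro card_mono) (auto simp: B_def)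
  then have cB: "card (nb v \<inter> set p) \<le> card B + 1"
    by (simp add: card_insert_if B_def split: if_splits)
  \<comment> \<open>A shift by \<open>m + 1 - k\<close> skips \<open>m - k\<close> vertices.\<close>
  have crossing: "\<not> (i \<in> B \<and> i + (m + 1 - k) \<in> A)" for i
  proof
    assume i: "i \<in> B \<and> i + (m + 1 - k) \<in> A"
    then have j: "i < i + (m + 1 - k)" "i + (m + 1 - k) < length p"
      "Suc i + (length p - (i + (m + 1 - k))) = k" using p by (auto simp: A_def)
    have "E (last p) (p ! i)" "E (hd p) (p ! (i + (m + 1 - k)))"
      using i by (auto simp: A_def B_def u_def v_def)
    note cr = cyc_crossing[OF p(1) j(1,2) this]
    have "3 \<le> Suc i + (length p - (i + (m + 1 - k)))" using j(3) p(3) by simp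
    from cr[OF this] show False
      using no j(3) by metis
  qed
  have interval: "\<not> (j \<in> A \<and> j + (k - 3) \<in> B)" for j
  proof
    assume j: "j \<in> A \<and> j + (k - 3) \<in> B"
    let ?s = "slice j (j + (k - 3)) p"
    have i: "j \<le> j + (k - 3)" "j + (k - 3) < length p" using j p by (auto simp: B_def)
    have "u \<notin> set ?s" "v \<notin> set ?s"
      using nth_in_slice[OF dp i, of 0] nth_in_slice[OF dp i, of "m - 1"] u0 vm p j
      by (auto simp: A_def B_def path_def)
    then have "cyc E (u # ?s @ [v])"
      using j i p slice_props[OF i] Ecomm uv Eneq[OF uv]
      by (auto simp: cyc_def successively_Cons successively_append_iff slice_succ slice_distinct
          path_def A_def B_def u_def v_def)
    moreover have "set (u # ?s @ [v]) \<subseteq> set p"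
      using p i by (auto simp: slice_props u_def v_def path_def)
    moreover have "length (u # ?s @ [v]) = k" using p i by (simp add: slice_props)
    ultimately show False using no by blast
  qed
  define e where "e = m + 1 - k"
  \<comment> \<open>Rotation by \<open>e\<close> on the \<open>m - 2\<close> inner positions. As
    long as it does not wrap around, \<open>i\<close> and \<open>f i\<close> are the feet of a
    crossing cycle; otherwise \<open>f i + (k - 3) = i\<close>, and the interval from
    \<open>f i\<close> to \<open>i\<close> is closed through both ends. Both cycles have length
    \<open>k\<close>.\<close>
  define f where "f = (\<lambda>i. if i + e < m - 1 then i + e else i + e + 2 - m)"
  have "f ` B \<subseteq> {1..<m - 1} - A"
  proof
    fix z assume "z \<in> f ` B"
    then obtain i where i: "i \<in> B" "z = f i" by auto
    show "z \<in> {1..<m - 1} - A"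
    proof (cases "i + e < m - 1")
      case True
      then show ?thesis using i crossing[of i] by (auto simp: f_def e_def B_def)
    next
      case False
      then have z: "z = i + e + 2 - m" "z + (k - 3) = i" "1 \<le> z" "z < m - 1"
        using i p by (auto simp: f_def e_def B_def)
      then show ?thesis using interval[of z] i by auto
    qed
  qed
  moreover have "inj_on f B"
    by (auto simp: inj_on_def f_def B_def split: if_splits)
  ultimately have "card B \<le> card ({1..<m - 1} - A)"
    by (metis card_image card_mono finite_Diff finite_atLeastLessThan)
  also have "\<dots> = m - 2 - card A"
    by (subst card_Diff_subset) (auto simp: A_def)
  moreover have "card A \<le> m - 2"
  proof -
    have "A \<subseteq> {1..<m - 1}" by (auto simp: A_def)
    from card_mono[OF _ this] show ?thesis by simp
  qed
  ultimately have "card A + card B \<le> m - 2" by linarith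
  \<comment> \<open>The edge between the ends adds one to the degree of each, so the sum inside the
    path is at most \<open>m\<close>.\<close>
  with sum cA cB \<open>3 \<le> k\<close> \<open>k \<le> m\<close> show False unfolding u_def v_def by linarith
qed


text \<open>Induction on the path: the initial part up to the second neighbour of the first end is
  removed. The count fails to survive this only if each end is adjacent to the neighbour of the
  other on the path, and then these two common neighbours replace the edge between the ends.\<close>

lemma cyc_all_if_nonadjacent_ends:
  assumes "path p" "4 \<le> k" "k \<le> length p" "\<not> E (hd p) (last p)"
    and "length p \<le> card (nb (hd p) \<inter> set p) + card (nb (last p) \<inter> set p)"
  shows "\<exists>xs. cyc E xs \<and> set xs \<subseteq> set p \<and> length xs = k"
  using assms
proof (induction "length p" arbitrary: p rule: less_induct)
  case less
  \<comment> \<open>\<open>p0\<close> is the path of the induction and \<open>p\<close> is that path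
    or its reverse, so the one-sided assumption \<open>no\<close> covers both directions.\<close>
  have shorten: "\<exists>xs. cyc E xs \<and> set xs \<subseteq> set p \<and> length xs = k"
    if p: "path p" "length p = m" "k \<le> m" "\<not> E (hd p) (last p)"
      and sum: "m \<le> card (nb (hd p) \<inter> set p) + card (nb (last p) \<inter> set p)"
      and m: "m = length p0" and IH: "\<And>q. length q < length p0 \<Longrightarrow> path q \<Longrightarrow> k \<le> length q \<Longrightarrow>
        \<not> E (hd q) (last q) \<Longrightarrow>
        length q \<le> card (nb (hd q) \<inter> set q) + card (nb (last q) \<inter> set q) \<Longrightarrow>
        \<exists>xs. cyc E xs \<and> set xs \<subseteq> set q \<and> length xs = k"
      and no: "\<not> E (last p) (p ! 1)" for p p0 :: "'a list" and m
  proof (rule ccontr)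
    assume nocyc: "\<not> ?thesis"
    define u v where "u = hd p" and "v = last p"
    define A B where "A = {i. i < length p \<and> E u (p ! i)}"
      and "B = {i. i < length p \<and> E v (p ! i)}"
    have dp: "distinct p" using p by (simp add: path_def)
    have u0: "p ! 0 = u" and vm: "p ! (m - 1) = v"
      using p by (auto simp: u_def v_def path_def hd_conv_nth last_conv_nth)
    have fin: "finite A" "finite B" by (auto simp: A_def B_def)
    have sum': "m \<le> card A + card B"
      using sum by (simp add: card_nb_idx[OF dp] A_def B_def u_def v_def)
    have uv: "\<not> E u v" "\<not> E v u" using p Ecomm by (auto simp: u_def v_def)
    have A1: "A \<subseteq> {1..m - 2}" and B1: "B \<subseteq> {2..m - 2}"
    proof -
      show "A \<subseteq> {1..m - 2}"
      proof
        fix i assume i: "i \<in> A"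
        then have "i \<noteq> 0" "i \<noteq> m - 1"
          using u0 vm Eirr uv by (metis (no_types, lifting) A_def mem_Collect_eq)+
        then show "i \<in> {1..m - 2}" using i p by (auto simp: A_def)
      qed
      show "B \<subseteq> {2..m - 2}"
      proof
        fix i assume i: "i \<in> B"
        then have "i \<noteq> 0" "i \<noteq> m - 1" "i \<noteq> 1"
          using u0 vm Eirr uv no by (metis (no_types, lifting) B_def v_def mem_Collect_eq)+
        then show "i \<in> {2..m - 2}" using i p by (auto simp: B_def)
      qed
    qed
    have "m \<ge> 4" using p \<open>4 \<le> k\<close> by simp
    have "card B \<le> m - 3" using card_mono[OF _ B1] by simp
    then have "card A \<ge> 3" using sum' \<open>m \<ge> 4\<close> by linarith
    have "A - {1} \<noteq> {}"
    proof
      assume "A - {1} = {}"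
      then have "card A \<le> card {1::nat}" by (intro card_mono) auto
      then show False using \<open>card A \<ge> 3\<close> by simp
    qed
    \<comment> \<open>Position 1 belongs to \<open>A\<close> as the successor of \<open>u\<close> on
      the path, so \<open>j\<close> is the second neighbour.\<close>
    define j where "j = Min (A - {1})"
    have j: "j \<in> A" "j \<noteq> 1"
      using Min_in[of "A - {1}"] \<open>A - {1} \<noteq> {}\<close> fin by (auto simp: j_def)
    have jmin: "i \<ge> j" if "i \<in> A" "i \<noteq> 1" for i
      using that fin by (auto simp: j_def)
    have j2: "2 \<le> j" "j \<le> m - 2" using j A1 by force+
    show False
    proof (cases "k \<le> m - j + 1")
      case True
      \<comment> \<open>Of the \<open>j - 1\<close> removed positions, \<open>u\<close> sees only 1
        and \<open>v\<close> at most 2 to \<open>j - 1\<close>. The degree sum drops by at most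
        \<open>j - 1\<close>, as does the length.\<close>
      define q where "q = u # drop j p"
      have "u \<notin> set (drop j p)"
      proof
        assume "u \<in> set (drop j p)"
        then obtain l where "l < length (drop j p)" "drop j p ! l = u" by (metis in_set_conv_nth)
        then have "p ! (j + l) = p ! 0" "j + l < length p" using u0 by auto
        then show False using nth_eq_iff_index_eq[OF dp, of "j + l" 0] j2 p(1) by (auto simp: path_def)
      qed
      then have q: "path q" "length q = m - j + 1" "hd q = u" "last q = v" "set q \<subseteq> set p"
        using p j j2 by (auto simp: q_def path_def successively_Cons successively_drop hd_drop_conv_nth
            A_def u_def v_def dest: in_set_dropD)
      have setq: "set q = insert u {p ! i |i. j \<le> i \<and> i < m}"
      proof -
        have "set (drop j p) = {p ! i |i. j \<le> i \<and> i < m}"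
          using p j2 by (auto simp: set_conv_nth) (metis add.commute le_add_diff_inverse less_diff_conv)+
        then show ?thesis by (simp add: q_def)
      qed
      have imA: "nb u \<inter> set q = (!) p ` (A - {1})"
        using jmin j2 p u0 Eirr by (auto simp: setq A_def image_iff)
      have imB: "nb v \<inter> set q = (!) p ` (B - {..<j})"
        using j2 p uv by (auto simp: setq B_def image_iff)
      have "inj_on ((!) p) (A - {1})" "inj_on ((!) p) (B - {..<j})"
        using dp by (auto intro!: inj_on_nth simp: A_def B_def)
      then have c: "card (nb u \<inter> set q) = card (A - {1})" "card (nb v \<inter> set q) = card (B - {..<j})"
        unfolding imA imB by (simp_all only: card_image)
      have "card (A - {1}) \<ge> card A - 1"
        by (simp add: card_Diff_singleton_if)
      moreover have "card B \<le> card (B - {..<j}) + card {2..<j}"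
      proof -
        have "B \<subseteq> (B - {..<j}) \<union> {2..<j}" using B1 by auto
        then have "card B \<le> card ((B - {..<j}) \<union> {2..<j})"
          using fin by (intro card_mono) auto
        also have "\<dots> \<le> card (B - {..<j}) + card {2..<j}" by (rule card_Un_le)
        finally show ?thesis .
      qed
      moreover have "card {2..<j} = j - 2" "length q = m - j + 1" using q by auto
      ultimately have "length q \<le> card (nb u \<inter> set q) + card (nb v \<inter> set q)"
        using sum' j2 c \<open>card A \<ge> 3\<close> by linarith
      then have "\<exists>xs. cyc E xs \<and> set xs \<subseteq> set q \<and> length xs = k"
        using IH[of q] q True m j2 uv by auto
      then show False using nocyc q by blast
    next
      case False
      \<comment> \<open>Now \<open>k\<close> is so large that \<open>e < j\<close>: all neighbour
        positions of \<open>u\<close> except 1 can be shifted down by \<open>e\<close> and stay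
        positive.\<close>
      define e where "e = m + 1 - k"
      have e: "1 \<le> e" "e < j" using False p j2 by (auto simp: e_def)
      have "(\<lambda>i. i - e) ` (A - {1}) \<subseteq> {1..m - 2} - B"
      proof
        fix z assume "z \<in> (\<lambda>i. i - e) ` (A - {1})"
        then obtain i where i: "i \<in> A" "i \<noteq> 1" "z = i - e" by auto
        then have z: "z < i" "z + e = i" "1 \<le> z" "i < length p" "z \<le> m - 2"
          using jmin[of i] e A1 by (force simp: A_def)+
        have "z \<notin> B"
        proof
          assume "z \<in> B"
          then have "E (last p) (p ! z)" "E (hd p) (p ! i)"
            using i by (auto simp: A_def B_def u_def v_def)
          note cr = cyc_crossing[OF p(1) z(1,4) this]
          have "Suc z + (length p - i) = k" using z p j2 by (auto simp: e_def)
          moreover from this have "3 \<le> Suc z + (length p - i)" using \<open>4 \<le> k\<close> by simp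
          note cr[OF this]
          ultimately show False using nocyc by metis
        qed
        then show "z \<in> {1..m - 2} - B" using z by auto
      qed
      moreover have "inj_on (\<lambda>i. i - e) (A - {1})"
      proof (rule inj_onI)
        fix x y assume "x \<in> A - {1}" "y \<in> A - {1}" "x - e = y - e"
        then show "x = y" using jmin[of x] jmin[of y] e by auto
      qed
      ultimately have "card (A - {1}) \<le> card ({1..m - 2} - B)"
        by (metis card_image card_mono finite_Diff finite_atLeastAtMost)
      also have "\<dots> = m - 2 - card B"
        using B1 fin by (subst card_Diff_subset) auto
      finally have "card A - 1 \<le> m - 2 - card B"
        by (simp add: card_Diff_singleton_if split: if_splits)
      then show False using sum' \<open>card B \<le> m - 3\<close> \<open>m \<ge> 4\<close> \<open>card A \<ge> 3\<close> by linarith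
    qed
  qed
  show ?case
  proof (cases "E (last p) (p ! 1) \<and> E (hd p) (rev p ! 1)")
    case False
    have IH: "\<exists>xs. cyc E xs \<and> set xs \<subseteq> set q \<and> length xs = k"
      if "length q < length p" "path q" "k \<le> length q" "\<not> E (hd q) (last q)"
        "length q \<le> card (nb (hd q) \<inter> set q) + card (nb (last q) \<inter> set q)" for q
      using less that by blast
    have ne: "p \<noteq> []" using less by (auto simp: path_def)
    show ?thesis
    proof (cases "E (last p) (p ! 1)")
      case True
      then have "\<not> E (last (rev p)) (rev p ! 1)" using False ne by (simp add: last_rev)
      then have "\<exists>xs. cyc E xs \<and> set xs \<subseteq> set (rev p) \<and> length xs = k"
        using shorten[of "rev p" "length p" p] IH less ne path_rev Ecomm
        by (auto simp: hd_rev last_rev add.commute)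
      then show ?thesis by simp
    next
      case False
      then show ?thesis using shorten[of p "length p" p] IH less by blast
    qed
  next
    case True
    show ?thesis
    proof (rule ccontr)
      assume no: "\<not> ?thesis"
      define m where "m = length p"
      define u v where "u = hd p" and "v = last p"
      define A B where "A = {i. i < m \<and> E u (p ! i)}"
        and "B = {i. i < m \<and> E v (p ! i)}"
      have p: "path p" "4 \<le> k" "k \<le> m" using less by (auto simp: m_def)
      have dp: "distinct p" using p by (simp add: path_def)
      have u0: "p ! 0 = u" and vm: "p ! (m - 1) = v"
        using p by (auto simp: u_def v_def m_def path_def hd_conv_nth last_conv_nth)
      have uv: "\<not> E u v" "\<not> E v u" using less Ecomm by (auto simp: u_def v_def)
      have ends: "E v (p ! 1)" "E u (p ! (m - 2))" "E u (p ! 1)" "E v (p ! (m - 2))"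
      proof -
        show "E v (p ! 1)" using True by (simp add: v_def)
        show "E u (p ! (m - 2))"
          using True p by (simp add: u_def m_def rev_nth numeral_2_eq_2)
        have "E (p ! i) (p ! Suc i)" if "Suc i < m" for i
          using p that by (auto simp: path_def m_def successively_conv_nth)
        from this[of 0] this[of "m - 2"] show "E u (p ! 1)" "E v (p ! (m - 2))"
          using p u0 vm Ecomm by (auto simp: Suc_diff_Suc numeral_2_eq_2)
      qed
      have A1: "A \<subseteq> {1..m - 2}" and B1: "B \<subseteq> {1..m - 2}"
      proof -
        show "A \<subseteq> {1..m - 2}"
        proof
          fix i assume i: "i \<in> A"
          then have "i \<noteq> 0" "i \<noteq> m - 1"
            using u0 vm Eirr uv by (metis (no_types, lifting) A_def mem_Collect_eq)+
          then show "i \<in> {1..m - 2}" using i p by (auto simp: A_def)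
        qed
        show "B \<subseteq> {1..m - 2}"
        proof
          fix i assume i: "i \<in> B"
          then have "i \<noteq> 0" "i \<noteq> m - 1"
            using u0 vm Eirr uv by (metis (no_types, lifting) B_def mem_Collect_eq)+
          then show "i \<in> {1..m - 2}" using i p by (auto simp: B_def)
        qed
      qed
      have fin: "finite A" "finite B" by (auto simp: A_def B_def)
      have in_ends: "1 \<in> A" "1 \<in> B" using ends p by (auto simp: A_def B_def)
      define e where "e = m + 1 - k"
      have crossing: "\<not> (i \<in> B \<and> i + e \<in> A)" for i
      proof
        assume i: "i \<in> B \<and> i + e \<in> A"
        then have j: "i < i + e" "i + e < length p" "Suc i + (length p - (i + e)) = k"
          using p by (auto simp: A_def m_def e_def)
        have "E (last p) (p ! i)" "E (hd p) (p ! (i + e))"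
          using i by (auto simp: A_def B_def u_def v_def)
        note cr = cyc_crossing[OF p(1) j(1,2) this]
        have "3 \<le> Suc i + (length p - (i + e))" using j(3) p by simp
        from cr[OF this] show False using no j(3) by metis
      qed
      have interval: "\<not> (j \<in> A \<and> j + (k - 4) \<in> B)" for j
      proof
        assume j: "j \<in> A \<and> j + (k - 4) \<in> B"
        let ?s = "slice j (j + (k - 4)) p"
        have i: "j \<le> j + (k - 4)" "j + (k - 4) < length p" using j by (auto simp: B_def m_def)
        have js: "1 \<le> j" "j + (k - 4) \<le> m - 2" using j A1 B1 by auto
        \<comment> \<open>An interval of \<open>k - 3\<close> vertices cannot contain both position
          1 and position \<open>m - 2\<close>, so one of these two common neighbours is free to
          close the cycle.\<close>
        obtain c where c: "c < m" "c \<notin> {j..j + (k - 4)}" "1 \<le> c" "c \<le> m - 2" "E u (p ! c)" "E v (p ! c)"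
        proof (cases "j = 1")
          case True
          then show ?thesis using that[of "m - 2"] ends p by auto
        next
          case False
          then show ?thesis using that[of 1] ends p js by auto
        qed
        note mem = nth_in_slice[OF dp i]
        have "u \<notin> set ?s" "v \<notin> set ?s" "p ! c \<notin> set ?s"
          using mem[of 0] mem[of "m - 1"] mem[of c] u0 vm p js c by (auto simp: m_def path_def)
        moreover have "u \<noteq> v" "p ! c \<noteq> u" "p ! c \<noteq> v"
          using nth_eq_iff_index_eq[OF dp, of 0 "m - 1"] u0 vm p c(5,6) Eirr
          by (auto simp: m_def path_def)
        ultimately have "cyc E (u # ?s @ [v, p ! c])"
          using j i p slice_props[OF i] Ecomm c
          by (auto simp: cyc_def successively_Cons successively_append_iff slice_succ slice_distinct
              path_def A_def B_def)
        moreover have "set (u # ?s @ [v, p ! c]) \<subseteq> set p"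
          using p i c by (auto simp: slice_props u_def v_def path_def m_def)
        moreover have "length (u # ?s @ [v, p ! c]) = k" using p i by (simp add: slice_props)
        ultimately show False using no by blast
      qed
      \<comment> \<open>Rotation by \<open>e\<close> on the positions 2 to \<open>m - 2\<close>.
        Position 1 lies in both sets and is taken out, so the modulus is
        \<open>m - 3\<close>.\<close>
      define f where "f = (\<lambda>i. if i + e \<le> m - 2 then i + e else i + e + 3 - m)"
      have "f ` (B - {1}) \<subseteq> {2..m - 2} - (A - {1})"
      proof
        fix z assume "z \<in> f ` (B - {1})"
        then obtain i where i: "i \<in> B" "i \<noteq> 1" "z = f i" by auto
        then have i2: "2 \<le> i" "i \<le> m - 2" using B1 by force+
        show "z \<in> {2..m - 2} - (A - {1})"
        proof (cases "i + e \<le> m - 2")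
          case True
          then show ?thesis using i i2 crossing[of i] by (auto simp: f_def)
        next
          case False
          then have z: "z = i + e + 3 - m" "z + (k - 4) = i" "2 \<le> z" "z \<le> m - 2"
            using i i2 p by (auto simp: f_def e_def)
          then show ?thesis using interval[of z] i by auto
        qed
      qed
      moreover have "inj_on f (B - {1})"
      proof (rule inj_onI)
        fix x y assume xy: "x \<in> B - {1}" "y \<in> B - {1}" "f x = f y"
        have "2 \<le> i \<and> i \<le> m - 2" if "i \<in> B - {1}" for i using that B1 by force
        note xb = this[OF xy(1)] and yb = this[OF xy(2)]
        have "1 \<le> e" "e + 3 \<le> m" using p by (auto simp: e_def)
        then show "x = y"
          using xb yb xy(3) unfolding f_def by (simp split: if_splits)
      qed
      ultimately have "card (B - {1}) \<le> card ({2..m - 2} - (A - {1}))"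
        by (metis card_image card_mono finite_Diff finite_atLeastAtMost)
      also have "\<dots> = m - 3 - card (A - {1})"
      proof -
        have "A - {1} \<subseteq> {2..m - 2}" using A1 by force
        then show ?thesis using fin by (subst card_Diff_subset) auto
      qed
      finally have *: "card (B - {1}) \<le> m - 3 - card (A - {1})" .
      have "card (A - {1}) \<le> m - 3"
        using card_mono[of "{2..m - 2}" "A - {1}"] A1 by force
      moreover have "card (A - {1}) = card A - 1" "card (B - {1}) = card B - 1"
        "card A \<ge> 1" "card B \<ge> 1"
        using in_ends fin by (auto simp: Suc_le_eq card_gt_0_iff)
      moreover have "m \<le> card A + card B"
        using less.prems(5) by (simp add: card_nb_idx[OF dp] A_def B_def u_def v_def m_def)
      ultimately show False using * p by linarith
    qed
  qed
qed

end

section \<open>Closing heavy pairs\<close>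

context finite_graph
begin

text \<open>The neighbours of \<open>x\<close> occupy more than half of the positions, so this set
  meets its own rotation by \<open>k - 2\<close>. Two neighbours that far apart bound an arc of
  \<open>k - 1\<close> vertices, which \<open>x\<close> closes.\<close>

lemma cyc_all_if_many_neighbours:
  assumes xs: "cyc E xs" "x \<notin> set xs" "length xs = m"
    and many: "m < 2 * card (nb x \<inter> set xs)" and k: "3 \<le> k" "k \<le> m + 1"
  shows "\<exists>ys. cyc E ys \<and> set ys \<subseteq> insert x (set xs) \<and> length ys = k"
proof -
  define T where "T = {i. i < m \<and> E x (xs ! i)}"
  define f where "f = (\<lambda>i. (i + (k - 2)) mod m)"
  have dx: "distinct xs" and m: "3 \<le> m" using xs by (auto simp: cyc_def)
  have cT: "m < 2 * card T"
    using many card_nb_idx[OF dx, of x] xs by (simp add: T_def)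
  have "inj_on f {..<m}"
  proof (rule inj_onI)
    have *: "a = b" if "a \<le> b" "b < m" "f a = f b" for a b
    proof -
      have "m dvd (b + (k - 2)) - (a + (k - 2))"
        using that mod_eq_dvd_iff_nat[of "a + (k - 2)" "b + (k - 2)" m] by (simp add: f_def)
      then have "m dvd b - a" by simp
      then show "a = b" using that by (auto dest: dvd_imp_le)
    qed
    fix a b assume "a \<in> {..<m}" "b \<in> {..<m}" "f a = f b"
    then show "a = b" using *[of a b] *[of b a] by (cases "a \<le> b") auto
  qed
  then have "card (f ` T) = card T"
    by (auto intro!: card_image inj_on_subset[of f "{..<m}"] simp: T_def)
  moreover have "f ` T \<union> T \<subseteq> {..<m}" using m by (auto simp: T_def f_def)
  then have "card (f ` T \<union> T) \<le> m"
    using card_mono[of "{..<m}"] by fastforce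
  ultimately have "f ` T \<inter> T \<noteq> {}"
    using cT card_Un_disjoint[of "f ` T" T] by (force simp: T_def)
  then obtain i where i: "i \<in> T" "f i \<in> T" by auto
  define ys where "ys = rotate i xs"
  have cy: "cyc E ys"
    using cyc_rotate_append[of E "take (i mod m) xs" "drop (i mod m) xs"] xs
    by (simp add: ys_def rotate_drop_take)
  have ys: "set ys = set xs" "length ys = m" using xs by (auto simp: ys_def)
  have h: "hd (take (k - 1) ys) = xs ! i"
    using k m i xs by (simp add: ys_def T_def hd_rotate_conv_nth flip: length_greater_0_conv)
  have "last (take (k - 1) ys) = ys ! (k - 2)"
    using k m ys by (subst last_conv_nth) (auto simp: numeral_2_eq_2)
  also have "\<dots> = xs ! f i"
    using k m xs by (simp add: ys_def f_def nth_rotate)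
  finally have l: "last (take (k - 1) ys) = xs ! f i" .
  have "take (k - 1) ys \<noteq> []" using k m ys by auto
  then have "cyc E (x # take (k - 1) ys)"
    using k m ys h l i xs cy Ecomm[of x]
    by (auto simp: cyc_def T_def successively_Cons successively_take dest: in_set_takeD)
  moreover have "length (x # take (k - 1) ys) = k" using k ys by auto
  moreover have "set (x # take (k - 1) ys) \<subseteq> insert x (set xs)"
    using ys by (auto dest: in_set_takeD)
  ultimately show ?thesis by blast
qed

text \<open>Outside \<open>S\<close> each vertex is seen by at most one of \<open>u\<close> and
  \<open>v\<close>, and each vertex of \<open>X\<close> by neither; so at most
  \<open>card V - card S - card X\<close> of the degree sum falls outside \<open>S\<close>.\<close>

lemma heavy_inside:
  assumes uv: "u \<in> H" "v \<in> H" and S: "S \<subseteq> V"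
    and no: "\<And>y. y \<in> V - S \<Longrightarrow> \<not> (E u y \<and> E v y)"
    and X: "X \<subseteq> V - S" "\<And>y. y \<in> X \<Longrightarrow> \<not> E u y \<and> \<not> E v y"
  shows "card S + card X + 1 \<le> card (nb u \<inter> S) + card (nb v \<inter> S)"
proof -
  have fin: "finite S" "finite X" using S X finV finite_subset by blast+
  have split: "card (nb z) = card (nb z \<inter> S) + card (nb z - S)" for z
    using card_Int_Diff[of "nb z" S] by simp
  have "(nb u - S) \<union> (nb v - S) \<subseteq> V - S - X"
    using X EV2 by auto
  then have "card ((nb u - S) \<union> (nb v - S)) \<le> card (V - S - X)"
    using finV by (intro card_mono) auto
  moreover have "card ((nb u - S) \<union> (nb v - S)) = card (nb u - S) + card (nb v - S)"
    using no EV2 by (intro card_Un_disjoint) auto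
  moreover have "card (V - S - X) = card V - card S - card X"
    using fin S X finV by (simp add: card_Diff_subset)
  moreover have "card S + card X \<le> card V"
  proof -
    have "card (S \<union> X) = card S + card X"
      using fin X by (intro card_Un_disjoint) auto
    moreover have "card (S \<union> X) \<le> card V"
      using S X finV by (intro card_mono) auto
    ultimately show ?thesis by simp
  qed
  ultimately show ?thesis
    using heavy_sum[OF uv] split[of u] split[of v] by linarith
qed

lemma common_neighbour:
  assumes "u \<in> H" "v \<in> H"
  obtains w where "E u w" "E v w"
proof -
  have "\<not> (\<forall>w. \<not> (E u w \<and> E v w))"
  proof
    assume no: "\<forall>w. \<not> (E u w \<and> E v w)"
    then have "card (nb u \<union> nb v) = card (nb u) + card (nb v)"
      by (intro card_Un_disjoint) auto
    moreover have "card (nb u \<union> nb v) \<le> card V"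
      using nb_V finV by (intro card_mono) auto
    ultimately show False using heavy_sum[OF assms] by simp
  qed
  then show ?thesis using that by blast
qed

text \<open>Both neighbourhoods avoid \<open>u\<close> and \<open>v\<close>, so their union has at
  most n - 2 elements, while the degrees sum to at least n + 1.\<close>

lemma common_if_nonadjacent:
  assumes "u \<in> H" "v \<in> H" "\<not> E u v" "u \<noteq> v"
  shows "3 \<le> card (nb u \<inter> nb v)"
proof -
  have "nb u \<union> nb v \<subseteq> V - {u, v}"
    using assms EV2 Eirr Ecomm by auto
  then have "card (nb u \<union> nb v) \<le> card (V - {u, v})"
    using finV by (intro card_mono) auto
  moreover have "card (V - {u, v}) = card V - 2" "2 \<le> card V"
  proof -
    have "{u, v} \<subseteq> V" using assms H_V by auto
    then show "card (V - {u, v}) = card V - 2" "2 \<le> card V"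
      using card_Diff_subset[of "{u, v}" V] card_mono[OF finV, of "{u, v}"] assms by simp_all
  qed
  moreover have "card (nb u \<union> nb v) + card (nb u \<inter> nb v) = card (nb u) + card (nb v)"
    using card_Un_Int[of "nb u" "nb v"] by simp
  ultimately show ?thesis using heavy_sum[OF assms(1,2)] by linarith
qed

text \<open>\<open>cyc_all_if_nonadjacent_ends\<close> with \<open>k = length p\<close>: a cycle on
  the path with that many vertices uses all of them.\<close>

lemma cyc_close_path:
  assumes p: "path p" "set p \<subseteq> V" "4 \<le> length p" "\<not> E (hd p) (last p)"
    and sum: "length p \<le> card (nb (hd p) \<inter> set p) + card (nb (last p) \<inter> set p)"
  obtains xs where "cyc E xs" "set xs = set p" "length xs = length p"
proof -
  obtain xs where xs: "cyc E xs" "set xs \<subseteq> set p" "length xs = length p"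
    using cyc_all_if_nonadjacent_ends[OF p(1,3) _ p(4) sum] by auto
  moreover have "card (set xs) = card (set p)"
    using xs p by (metis cyc_def distinct_card path_def)
  ultimately have "set xs = set p" by (simp add: card_subset_eq)
  then show ?thesis using that xs by blast
qed

text \<open>A common neighbour off the path closes it at the price of one more vertex, hence only
  the inclusion. If there is none, the degree sum inside the path is large enough to close it
  without further vertices.\<close>

lemma cyc_close_heavy_path:
  assumes p: "path p" "set p \<subseteq> V" "hd p \<in> H" "last p \<in> H" "hd p \<noteq> last p" "3 \<le> length p"
  obtains xs where "cyc E xs" "set p \<subseteq> set xs"
proof (cases "E (hd p) (last p)")
  case True
  then show ?thesis using that[of p] p Ecomm by (auto simp: cyc_def path_def)
next
  case False
  show ?thesis
  proof (cases "\<exists>y\<in>V - set p. E (hd p) y \<and> E (last p) y")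
    case True
    then obtain y where y: "y \<notin> set p" "E (hd p) y" "E (last p) y" by auto
    then have "cyc E (y # p)"
      using p Ecomm[of _ y] by (auto simp: cyc_def path_def successively_Cons)
    then show ?thesis using that[of "y # p"] by auto
  next
    case no: False
    have ins: "card (set p) + 1 \<le> card (nb (hd p) \<inter> set p) + card (nb (last p) \<inter> set p)"
      using heavy_inside[of "hd p" "last p" "set p" "{}"] p no by auto
    have ne: "p \<noteq> []" using p by (auto simp: path_def)
    have "nb (hd p) \<inter> set p \<subseteq> set p - {hd p, last p}" "nb (last p) \<inter> set p \<subseteq> set p - {hd p, last p}"
      using False Eirr Ecomm by auto
    then have "card (nb (hd p) \<inter> set p) \<le> card (set p - {hd p, last p})"
      "card (nb (last p) \<inter> set p) \<le> card (set p - {hd p, last p})"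
      by (auto intro!: card_mono)
    moreover have "card (set p - {hd p, last p}) = length p - 2"
      using p ne by (subst card_Diff_subset) (auto simp: path_def distinct_card)
    ultimately have "4 \<le> length p" using ins p by (auto simp: path_def distinct_card)
    moreover have "length p \<le> card (nb (hd p) \<inter> set p) + card (nb (last p) \<inter> set p)"
      using ins p by (simp add: path_def distinct_card)
    ultimately obtain xs where "cyc E xs" "set xs = set p"
      using cyc_close_path[OF p(1,2) _ False] by metis
    then show ?thesis using that by auto
  qed
qed

end

section \<open>Replacing virtual edges between heavy vertices\<close>

lemma cyc_rotate_to_gap:
  assumes "cyc E' xs" "\<not> cyc E xs"
  obtains ys where "cyc E' ys" "set ys = set xs" "\<not> E (last ys) (hd ys)"
proof (cases "E (last xs) (hd xs)")
  case False
  then show ?thesis using assms that by blast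
next
  case True
  then have "\<not> successively E xs" using assms by (auto simp: cyc_def)
  then obtain i where i: "Suc i < length xs" "\<not> E (xs ! i) (xs ! Suc i)"
    by (auto simp: successively_conv_nth)
  define ys where "ys = drop (Suc i) xs @ take (Suc i) xs"
  have "cyc E' ys"
    using cyc_rotate_append[of E' "take (Suc i) xs" "drop (Suc i) xs"] assms by (simp add: ys_def)
  moreover have "set ys = set xs"
    using set_append[of "take (Suc i) xs" "drop (Suc i) xs"] by (auto simp: ys_def)
  moreover have "last ys = xs ! i" "hd ys = xs ! Suc i"
    using i by (auto simp: ys_def hd_drop_conv_nth last_conv_nth hd_append last_append)
  ultimately show ?thesis using that i by auto
qed

context finite_graph
begin

text \<open>The virtual edge is used at most once. Rotated to the closing position, it leaves a path
  of genuine edges with heavy ends, which \<open>cyc_close_heavy_path\<close> closes.\<close>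

lemma cyc_remove_heavy_pair:
  assumes ab: "a \<in> H" "b \<in> H" "a \<noteq> b"
    and xs: "cyc (\<lambda>x y. E x y \<or> {x, y} = {a, b}) xs" "set xs \<subseteq> V"
  obtains ys where "cyc E ys" "set xs \<subseteq> set ys"
proof (cases "cyc E xs")
  case True
  then show ?thesis using that by blast
next
  case False
  obtain ys
    where ys: "cyc (\<lambda>x y. E x y \<or> {x, y} = {a, b}) ys" "set ys = set xs" "\<not> E (last ys) (hd ys)"
    by (rule cyc_rotate_to_gap[OF xs(1) False])
  then have ends: "{last ys, hd ys} = {a, b}" and len: "3 \<le> length ys" and dist: "distinct ys"
    unfolding cyc_def by blast+
  have "successively E ys"
    unfolding successively_conv_nth
  proof (intro allI impI)
    fix i assume i: "Suc i < length ys"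
    have "ys ! 0 = hd ys" "ys ! (length ys - 1) = last ys"
      using hd_conv_nth[of ys] last_conv_nth[of ys] len by fastforce+
    moreover have "{ys ! i, ys ! Suc i} \<noteq> {ys ! (length ys - 1), ys ! 0}"
    proof
      assume "{ys ! i, ys ! Suc i} = {ys ! (length ys - 1), ys ! 0}"
      then consider "ys ! Suc i = ys ! 0" | "ys ! i = ys ! 0" "ys ! Suc i = ys ! (length ys - 1)"
        by (auto simp only: doubleton_eq_iff)
      moreover have "0 < length ys" "length ys - 1 < length ys" using len by linarith+
      ultimately have "Suc i = 0 \<or> i = 0 \<and> Suc i = length ys - 1"
        using i nth_eq_iff_index_eq[OF dist] by (metis Suc_lessD)
      then show False using len by linarith
    qed
    moreover have "E (ys ! i) (ys ! Suc i) \<or> {ys ! i, ys ! Suc i} = {a, b}"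
      using ys(1) i unfolding cyc_def successively_conv_nth by blast
    ultimately show "E (ys ! i) (ys ! Suc i)" using ends by metis
  qed
  then have "path ys" using len dist by (auto simp: path_def)
  moreover have "hd ys \<in> H" "last ys \<in> H" "hd ys \<noteq> last ys"
    using ends ab by (auto simp: doubleton_eq_iff)
  ultimately show ?thesis
    using cyc_close_heavy_path[of ys] that xs ys len by metis
qed

end

text \<open>One virtual edge is put into the graph, the induction hypothesis removes the others
  there, and then this edge is removed. The graph changes, so the lemma stands outside the locale;
  more edges only enlarge the set of heavy vertices, and the pairs in \<open>F\<close> stay
  heavy.\<close>

lemma cyc_remove_heavy_pairs:
  assumes "finite F" "finite_graph V E" "\<And>x y. (x, y) \<in> F \<Longrightarrow> x \<in> finite_graph.H V E \<and> y \<in> finite_graph.H V E \<and> x \<noteq> y"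
    and "cyc (\<lambda>x y. E x y \<or> (x, y) \<in> F \<or> (y, x) \<in> F) xs" "set xs \<subseteq> V"
  shows "\<exists>ys. cyc E ys \<and> set xs \<subseteq> set ys"
  using assms
proof (induction F arbitrary: E rule: finite_induct)
  case empty
  then show ?case by auto
next
  case (insert e F)
  obtain a b where e: "e = (a, b)" by (cases e)
  interpret finite_graph V E by (rule insert.prems)
  define E1 where "E1 = (\<lambda>x y. E x y \<or> {x, y} = {a, b})"
  have ab: "a \<in> H" "b \<in> H" "a \<noteq> b" using insert.prems(2)[of a b] by (auto simp: e)
  interpret one: finite_graph V E1
    by unfold_locales
      (use finV EV Esym Eirr ab H_V in \<open>auto simp: E1_def doubleton_eq_iff\<close>)
  have "nb x \<subseteq> one.nb x" for x unfolding nb_def one.nb_def by (auto simp: E1_def)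
  then have "card (nb x) \<le> card (one.nb x)" for x by (simp add: card_mono)
  then have H1: "H \<subseteq> one.H"
    unfolding H_def one.H_def by (auto intro: order_trans mult_le_mono2)
  have "(\<lambda>x y. E x y \<or> (x, y) \<in> insert e F \<or> (y, x) \<in> insert e F) =
      (\<lambda>x y. E1 x y \<or> (x, y) \<in> F \<or> (y, x) \<in> F)"
    by (auto simp: E1_def e doubleton_eq_iff fun_eq_iff)
  then have "\<exists>ys. cyc E1 ys \<and> set xs \<subseteq> set ys"
    using insert.IH[of E1] insert.prems H1 one.finite_graph_axioms by (metis insertCI subsetD)
  then obtain ys where ys: "cyc E1 ys" "set xs \<subseteq> set ys" by auto
  have "set ys \<subseteq> V" using one.cyc_subset_V ys by auto
  then obtain zs where "cyc E zs" "set ys \<subseteq> set zs"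
    by (rule cyc_remove_heavy_pair[OF ab ys(1)[unfolded E1_def]])
  with ys(2) show ?case by blast
qed

context finite_graph
begin

text \<open>Any listing of \<open>H\<close> is a cycle once all heavy pairs count as edges.\<close>

lemma cyc_containing_heavy:
  assumes "3 \<le> card H"
  obtains ys where "cyc E ys" "H \<subseteq> set ys"
proof -
  obtain hs where hs: "set hs = H" "distinct hs"
    using finite_distinct_list[OF finH] by auto
  then have len: "3 \<le> length hs" using assms by (metis distinct_card)
  let ?F = "{(x, y). x \<in> H \<and> y \<in> H \<and> x \<noteq> y}"
  have fin: "finite ?F" by (rule finite_subset[of _ "H \<times> H"]) auto
  have "cyc (\<lambda>x y. E x y \<or> (x, y) \<in> ?F \<or> (y, x) \<in> ?F) hs"
  proof -
    have "hs ! i \<noteq> hs ! Suc i" if "Suc i < length hs" for i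
      using hs that by (simp add: nth_eq_iff_index_eq)
    moreover have "hs \<noteq> []" using len by auto
    then have "last hs \<in> H" "hd hs \<in> H" using last_in_set hd_in_set hs(1) by blast+
    moreover have "last hs \<noteq> hd hs"
      using hs len \<open>hs \<noteq> []\<close> nth_eq_iff_index_eq[OF hs(2), of "length hs - 1" 0]
      by (simp add: last_conv_nth hd_conv_nth)
    moreover have "hs ! i \<in> H" if "i < length hs" for i using that hs nth_mem by blast
    ultimately show ?thesis
      using hs len by (simp add: cyc_def successively_conv_nth)
  qed
  then have "\<exists>ys. cyc E ys \<and> set hs \<subseteq> set ys"
    by (rule cyc_remove_heavy_pairs[OF fin finite_graph_axioms, rotated]) (use hs H_V in auto)
  then show ?thesis using that hs by blast
qed

end

section \<open>Cycles that cannot be enlarged by one vertex\<close>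

text \<open>\<open>no_path0\<close> is phrased for a path with adjacent ends, because the later
  proofs build rerouted vertex lists, and the closing pair needs an argument of its own.\<close>

locale nonextendable_cycle = claw_Z2_heavy_graph +
  fixes C :: "'a list"
  assumes cycC: "cyc E C" and HC: "H \<subseteq> set C"
    and no_path0: "\<And>p x. path p \<Longrightarrow> x \<in> V - set C \<Longrightarrow> set p = insert x (set C) \<Longrightarrow>
      E (hd p) (last p) \<Longrightarrow> False"
begin

lemma outside_light: "x \<in> V - set C \<Longrightarrow> x \<notin> H"
  using HC by auto

text \<open>The cycle cut at \<open>c\<close> and \<open>d\<close> into the arcs \<open>W\<close>
  and \<open>U\<close>. Exchange and reversal carry a fact about one arc end to the other
  three.\<close>

definition conf :: "'a \<Rightarrow> 'a \<Rightarrow> 'a list \<Rightarrow> 'a list \<Rightarrow> bool" where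
  "conf c d W U \<longleftrightarrow> cyc E (c # W @ d # U) \<and> set (c # W @ d # U) = set C"

lemma conf_swap: "conf c d W U \<Longrightarrow> conf d c U W"
  using cyc_rotate_append[of E "c # W" "d # U"] by (auto simp: conf_def)

lemma conf_rev: "conf c d W U \<Longrightarrow> conf c d (rev U) (rev W)"
  using cyc_rotate_append[of E "rev U @ d # rev W" "[c]"] cyc_rev'[of "c # W @ d # U"]
  by (auto simp: conf_def)

lemma conf_exists:
  assumes "c \<in> set C" "d \<in> set C" "c \<noteq> d"
  obtains W U where "conf c d W U" "length W + length U + 2 = length C"
proof -
  obtain W U where "cyc E (c # W @ d # U)" "set (c # W @ d # U) = set C"
    "length (c # W @ d # U) = length C"
    using cyc_at2[OF cycC assms] by metis
  then show ?thesis using that by (auto simp: conf_def)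
qed

text \<open>Otherwise \<open>x\<close> could be inserted between \<open>c\<close> and that neighbour
  on the cycle.\<close>

lemma not_adjacent_outside:
  assumes "cyc E (c # Z)" "set (c # Z) = set C" "x \<in> V - set C" "E c x"
  shows "\<not> E x (hd Z)" "\<not> E x (last Z)"
proof -
  have Z: "Z \<noteq> []" "E c (hd Z)" "E (last Z) c" "successively E Z" "distinct (c # Z)"
    using assms(1) by (auto simp: cyc_def successively_Cons split: if_splits)
  have x: "x \<notin> set (c # Z)" using assms(2,3) by auto
  show "\<not> E x (hd Z)"
  proof
    assume "E x (hd Z)"
    then have "path (x # Z @ [c])"
      using Z x by (auto simp: path_def successively_Cons successively_append_iff)
    then show False using no_path0[of "x # Z @ [c]" x] assms Ecomm by auto
  qed
  show "\<not> E x (last Z)"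
  proof
    assume "E x (last Z)"
    then have "path (c # Z @ [x])"
      using Z x Ecomm by (auto simp: path_def successively_Cons successively_append_iff)
    then show False using no_path0[of "c # Z @ [x]" x] assms Ecomm by auto
  qed
qed

text \<open>The claw at \<open>c\<close> on \<open>x\<close> and the two cycle neighbours: since
  \<open>x\<close> is light, the other two are heavy unless they are adjacent.\<close>

lemma adjacent_or_heavy:
  assumes "cyc E (c # Z)" "set (c # Z) = set C" "x \<in> V - set C" "E c x"
  shows "E (last Z) (hd Z) \<or> last Z \<in> H \<and> hd Z \<in> H"
proof -
  have Z: "Z \<noteq> []" "E c (hd Z)" "E c (last Z)" "2 \<le> length Z" "distinct Z"
    using assms(1) Esym by (auto simp: cyc_def successively_Cons split: if_splits)
  then have "hd Z \<noteq> last Z"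
    by (cases Z) (auto split: if_splits)
  moreover have "hd Z \<in> set C" "last Z \<in> set C"
    using assms(2) Z(1) hd_in_set[of Z] last_in_set[of Z] by (metis list.set_intros(2))+
  then have "x \<noteq> hd Z" "x \<noteq> last Z" using assms(3) by blast+
  ultimately show ?thesis
    using claw[of c "last Z" x "hd Z"] claw[of c "hd Z" x "last Z"] not_adjacent_outside[OF assms]
      Z assms(3,4) Ecomm outside_light by metis
qed

section \<open>Shortest ears on the cycle\<close>

definition ear :: "'a list \<Rightarrow> 'a \<Rightarrow> 'a \<Rightarrow> bool" where
  "ear P c d \<longleftrightarrow> path P \<and> set P \<subseteq> V - set C \<and> c \<in> set C \<and> d \<in> set C \<and> c \<noteq> d \<and>
     E c (hd P) \<and> E d (last P)"

lemma ear_rev: "ear P c d \<Longrightarrow> ear (rev P) d c"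
  by (auto simp: ear_def path_rev hd_rev last_rev)

text \<open>Shortest among the ears with arbitrary ends on the cycle; this restricts the cycle
  neighbours of all outside vertices, not only of those on \<open>P\<close>.\<close>

definition min_ear :: "'a list \<Rightarrow> 'a \<Rightarrow> 'a \<Rightarrow> bool" where
  "min_ear P c d \<longleftrightarrow> ear P c d \<and> (\<forall>P' c' d'. ear P' c' d' \<longrightarrow> length P \<le> length P')"

lemma min_ear_rev: "min_ear P c d \<Longrightarrow> min_ear (rev P) d c"
  by (auto simp: min_ear_def ear_rev)

lemma ear_single: "x \<in> V - set C \<Longrightarrow> c \<in> set C \<Longrightarrow> d \<in> set C \<Longrightarrow> c \<noteq> d \<Longrightarrow> E x c \<Longrightarrow> E x d \<Longrightarrow> ear [x] c d"
  using Ecomm by (auto simp: ear_def path_def)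

text \<open>By connectedness some outside vertex \<open>x\<close> sees a vertex \<open>c\<close> of
  the cycle. In the connected graph on \<open>V - {c}\<close> a path from \<open>x\<close>, cut
  where it first meets the cycle, is an ear with a second end.\<close>

lemma exists_min_ear:
  assumes "two_connected V E" "V - set C \<noteq> {}"
  obtains P c d where "min_ear P c d"
proof -
  have Cne: "C \<noteq> []" "2 \<le> length C" "distinct C" using cycC by (auto simp: cyc_def)
  have CV: "set C \<subseteq> V" using cyc_subset_V[OF cycC] .
  have first: "\<exists>q c. path q \<and> set q \<subseteq> V - set C \<and> set q \<subseteq> S \<and> hd q = x \<and> c \<in> set C \<inter> S \<and> E (last q) c"
    if S: "connected_on S E" "x \<in> S" "S \<subseteq> V" "x \<notin> set C" "set C \<inter> S \<noteq> {}" for S x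
  proof -
    obtain y where y: "y \<in> set C" "y \<in> S" using S(5) by blast
    obtain p where p: "path_between S E x y p" using S(1,2) y(2) by (auto simp: connected_on_def)
    then have p': "p \<noteq> []" "distinct p" "set p \<subseteq> S" "successively E p" "hd p = x" "last p = y"
      by (auto simp: path_between_def is_path_iff)
    define q where "q = takeWhile (\<lambda>z. z \<notin> set C) p"
    define r where "r = dropWhile (\<lambda>z. z \<notin> set C) p"
    have pq: "p = q @ r" by (simp add: q_def r_def)
    have "y \<in> set p" using p' by (metis last_in_set)
    then have r: "r \<noteq> []" "hd r \<in> set C"
      using y hd_dropWhile[of "\<lambda>z. z \<notin> set C" p] by (auto simp: r_def)
    have "q \<noteq> []" "hd q = x" using p' S by (cases p; auto simp: q_def)+
    moreover have "set q \<subseteq> V - set C" "set q \<subseteq> S"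
      using p' S by (auto simp: q_def dest: set_takeWhileD)
    moreover have "path q" "E (last q) (hd r)" "hd r \<in> S"
      using p' r pq \<open>q \<noteq> []\<close> by (auto simp: path_def successively_append_iff)
    ultimately show ?thesis using r by blast
  qed
  obtain x0 where "x0 \<in> V" "x0 \<notin> set C" using assms by auto
  moreover have "connected_on V E" using assms(1) by (simp add: two_connected_def)
  moreover have "set C \<inter> V \<noteq> {}" using CV hd_in_set[OF Cne(1)] by blast
  ultimately obtain q c where q: "path q" "set q \<subseteq> V - set C" "c \<in> set C" "E (last q) c"
    using first[of V x0] by blast
  define x where "x = last q"
  have "last q \<in> set q" using q(1) by (simp add: path_def)
  then have x: "x \<in> V - set C" "E x c" using q by (auto simp: x_def)
  have "set C - {c} \<noteq> {}"
  proof
    assume "set C - {c} = {}"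
    then have "card (set C) \<le> card {c}" by (intro card_mono) auto
    then show False using Cne by (simp add: distinct_card)
  qed
  then have "set C \<inter> (V - {c}) \<noteq> {}" using CV by blast
  moreover have "connected_on (V - {c}) E"
    using assms(1) q(3) CV by (auto simp: two_connected_def)
  ultimately obtain P d where "path P" "set P \<subseteq> V - set C" "hd P = x" "d \<in> set C \<inter> (V - {c})" "E (last P) d"
    using first[of "V - {c}" x] x q by blast
  then have "ear P c d" using x q Ecomm by (auto simp: ear_def)
  then have ex: "\<exists>P. \<exists>c d. ear P c d" by blast
  obtain P where "\<exists>c d. ear P c d" "\<forall>P'. (\<exists>c d. ear P' c d) \<longrightarrow> length P \<le> length P'"
    using exists_least_iff[of "\<lambda>n. \<exists>P. (\<exists>c d. ear P c d) \<and> length P = n"] ex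
    by (metis linorder_not_less)
  then show ?thesis using that unfolding min_ear_def by blast
qed

text \<open>With two neighbours on the cycle, \<open>y\<close> alone would be a shorter ear.\<close>

lemma min_ear_one_neighbour:
  assumes "min_ear P c d" "2 \<le> length P" "y \<in> V - set C" "c' \<in> set C" "d' \<in> set C" "E y c'" "E y d'"
  shows "c' = d'"
proof (rule ccontr)
  assume "c' \<noteq> d'"
  then have "ear [y] c' d'" using assms ear_single by blast
  then show False using assms unfolding min_ear_def by fastforce
qed

text \<open>A cycle neighbour of \<open>x2\<close> allows an ear to start at \<open>x2\<close> if it
  is \<open>c\<close>, and to stop at \<open>x2\<close> if it is not. The first is shorter than
  \<open>P\<close>; the second must be \<open>P\<close> itself, with the neighbour
  \<open>d\<close>.\<close>

lemma min_ear_second: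
  assumes m: "min_ear P c d" and len: "2 \<le> length P"
  obtains x1 x2 P' where "P = x1 # x2 # P'" "x1 \<in> V - set C" "x2 \<in> V - set C" "E c x1" "E x1 x2"
    "\<And>c'. c' \<in> set C \<Longrightarrow> E x1 c' \<Longrightarrow> c' = c"
    "\<And>c'. c' \<in> set C \<Longrightarrow> E x2 c' \<Longrightarrow> c' = d \<and> P' = []"
proof -
  obtain x1 x2 P' where P: "P = x1 # x2 # P'"
    using len by (cases P; cases "tl P") auto
  have e: "ear P c d" using m by (simp add: min_ear_def)
  have x: "x1 \<in> V - set C" "x2 \<in> V - set C" "E c x1" "E x1 x2" "path [x1, x2]" "path (x2 # P')"
    using e P by (auto simp: ear_def path_def successively_Cons)
  note one = min_ear_one_neighbour[OF m len]
  have cd: "c \<in> set C" "d \<in> set C" "c \<noteq> d" using e by (auto simp: ear_def)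
  have "c' = d \<and> P' = []" if c': "c' \<in> set C" "E x2 c'" for c'
  proof (cases "c' = c")
    case True
    then have "ear (x2 # P') c d"
      using e P c' x Ecomm by (auto simp: ear_def)
    then show ?thesis using m P unfolding min_ear_def by fastforce
  next
    case False
    then have "ear [x1, x2] c c'"
      using x c' cd Ecomm by (auto simp: ear_def)
    then have "P' = []" using m P unfolding min_ear_def by fastforce
    then have "E x2 d" using e P Ecomm by (auto simp: ear_def)
    then show ?thesis using one[OF x(2) c'(1) cd(2) c'(2)] \<open>P' = []\<close> by auto
  qed
  then show ?thesis
    using that[OF P x(1-4)] one[OF x(1) _ cd(1)] x Ecomm by metis
qed

end

text \<open>\<open>J\<close> holds for the edges and for those pairs of heavy vertices that may be treated as edges,
  because a degree count closes a path between them to a cycle.\<close>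

locale joined_nonextendable_cycle = nonextendable_cycle +
  fixes J :: "'a \<Rightarrow> 'a \<Rightarrow> bool"
  assumes EJ: "E a b \<Longrightarrow> J a b" and Jsym: "J a b \<Longrightarrow> J b a"
    and JH: "J a b \<Longrightarrow> E a b \<or> a \<in> H \<and> b \<in> H"
    and no_path: "\<And>p x. path p \<Longrightarrow> x \<in> V - set C \<Longrightarrow> set p = insert x (set C) \<Longrightarrow> J (hd p) (last p) \<Longrightarrow> False"
    and J_attach: "\<And>c Z x. cyc E (c # Z) \<Longrightarrow> set (c # Z) = set C \<Longrightarrow> x \<in> V - set C \<Longrightarrow> E c x \<Longrightarrow>
      J (last Z) (hd Z)"
begin

text \<open>If the cycle neighbours of \<open>c\<close> are adjacent, then \<open>c\<close> can be moved behind such a prefix of the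
  arc \<open>W\<close>.\<close>

definition good_prefix :: "'a \<Rightarrow> 'a list \<Rightarrow> 'a list \<Rightarrow> 'a list \<Rightarrow> bool" where
  "good_prefix c W U W1 \<longleftrightarrow> W1 = [] \<or> E (last U) (hd W) \<and> E c (last W1)"

context
  fixes c d x W U
  assumes cf: "conf c d W U" and x: "x \<in> V - set C" "E c x" "E d x"
begin

lemma conf_facts:
  shows "W \<noteq> []" "U \<noteq> []" "J (last U) (hd W)" "J (last W) (hd U)" "E c (hd W)" "E (last W) d" "E d (hd U)"
    "E (last U) c" "successively E W" "successively E U" "distinct (c # W @ d # U)" "x \<notin> set (c # W @ d # U)"
    "set (c # W @ d # U) = set C" "\<not> E x (hd W)" "\<not> E x (last U)"
proof -
  have cd: "cyc E (c # W @ d # U)" "set (c # W @ d # U) = set C"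
    "cyc E (d # U @ c # W)" "set (d # U @ c # W) = set C"
    using cf conf_swap[OF cf] by (auto simp: conf_def)
  note n = not_adjacent_outside[OF cd(1,2) x(1,2)]
  show ne: "W \<noteq> []" "U \<noteq> []" using n x Ecomm by (auto split: if_splits)
  show "J (last U) (hd W)" using J_attach[OF cd(1,2) x(1,2)] ne by auto
  show "J (last W) (hd U)" using J_attach[OF cd(3,4) x(1,3)] ne by auto
  show "E c (hd W)" "E (last W) d" "E d (hd U)"
    "E (last U) c" "successively E W" "successively E U" "distinct (c # W @ d # U)"
    "set (c # W @ d # U) = set C" "\<not> E x (hd W)" "\<not> E x (last U)"
    using cd ne n by (auto simp: cyc_def successively_Cons successively_append_iff)
  show "x \<notin> set (c # W @ d # U)" using cd x by auto
qed

text \<open>Otherwise \<open>U @ W1 @ [c, x, d] @ W2\<close> contains \<open>x\<close>, and its ends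
  are the cycle neighbours of \<open>d\<close>, which are joined by \<open>J\<close>.\<close>

lemma not_d_after_prefix:
  assumes "W = W1 @ W2" "W2 \<noteq> []" "good_prefix c W U W1"
  shows "\<not> E d (hd W2)"
proof
  assume "E d (hd W2)"
  then have "path (U @ W1 @ [c, x, d] @ W2)"
    using conf_facts assms x Ecomm
    by (cases "W1 = []") (auto simp: path_def good_prefix_def successively_Cons successively_append_iff)
  moreover have "set (U @ W1 @ [c, x, d] @ W2) = insert x (set C)"
    using conf_facts(13) assms by auto
  moreover have "J (hd (U @ W1 @ [c, x, d] @ W2)) (last (U @ W1 @ [c, x, d] @ W2))"
    using conf_facts assms Jsym by auto
  ultimately show False using no_path x by blast
qed

text \<open>Here the rerouted path ends in \<open>d\<close>, which is adjacent to its start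
  \<open>hd U\<close>.\<close>

lemma not_x_after_prefix:
  assumes "W = W1 @ W2" "W2 \<noteq> []" "good_prefix c W U W1"
  shows "\<not> E x (hd W2)"
proof
  assume "E x (hd W2)"
  then have "path (U @ W1 @ [c, x] @ W2 @ [d])"
    using conf_facts assms x Ecomm
    by (cases "W1 = []") (auto simp: path_def good_prefix_def successively_Cons successively_append_iff)
  moreover have "set (U @ W1 @ [c, x] @ W2 @ [d]) = insert x (set C)"
    using conf_facts(13) assms by auto
  moreover have "J (hd (U @ W1 @ [c, x] @ W2 @ [d])) (last (U @ W1 @ [c, x] @ W2 @ [d]))"
    using conf_facts EJ Esym by auto
  ultimately show False using no_path x by blast
qed

text \<open>Without such a \<open>z\<close>, the vertex \<open>c\<close> sees all of
  \<open>W\<close>: at the first failure \<open>w\<close>, with predecessor \<open>z\<close>, the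
  triangle \<open>x\<close>, \<open>d\<close>, \<open>c\<close> and the path \<open>c\<close>,
  \<open>z\<close>, \<open>w\<close> form an induced \<open>Z\<^sub>2\<close> in which
  \<open>x\<close> is light, so \<open>z\<close> is heavy. But then all of \<open>W\<close> can
  precede \<open>c\<close>, and \<open>U @ W @ [c, x, d]\<close> is closed by an edge.\<close>

lemma heavy_in_arc:
  assumes adj: "E (last U) (hd W)" and cd: "E c d"
  obtains W1 z W3 where "W = W1 @ z # W3" "z \<in> H" "E c z" "\<not> E d z" "good_prefix c W U W1"
proof (rule ccontr)
  note obt = that
  assume "\<not> thesis"
  then have none: "z \<notin> H" if "W = W1 @ z # W3" "E c z" "\<not> E d z" "good_prefix c W U W1" for W1 z W3
    using that obt by metis
  have all: "E c w" if "W = W1 @ w # W2" for W1 w W2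
    using that
  proof (induction "length W1" arbitrary: W1 w W2 rule: less_induct)
    case less
    show ?case
    proof (cases W1 rule: rev_cases)
      case Nil
      then show ?thesis using conf_facts less.prems by auto
    next
      case W1: (snoc W0 z)
      have g: "good_prefix c W U (W0 @ [z])" "good_prefix c W U W0" "E c z"
      proof -
        show z: "E c z" using less.hyps[of W0 z "w # W2"] less.prems W1 by simp
        then show "good_prefix c W U (W0 @ [z])" using adj by (simp add: good_prefix_def)
        show "good_prefix c W U W0"
        proof (cases W0 rule: rev_cases)
          case Nil
          then show ?thesis by (simp add: good_prefix_def)
        next
          case (snoc W0' y)
          then have "E c y"
            using less.hyps[of W0' y "z # w # W2"] less.prems W1 by simp
          then show ?thesis using adj snoc by (simp add: good_prefix_def)
        qed
      qed
      show ?thesis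
      proof (rule ccontr)
        assume w: "\<not> E c w"
        have W: "W = W0 @ (z # w # W2)" "W = (W0 @ [z]) @ (w # W2)" using less.prems W1 by auto
        have n: "\<not> E d z" "\<not> E d w" "\<not> E x z" "\<not> E x w"
          using not_d_after_prefix[OF W(1) _ g(2)] not_d_after_prefix[OF W(2) _ g(1)]
            not_x_after_prefix[OF W(1) _ g(2)] not_x_after_prefix[OF W(2) _ g(1)] by auto
        have "E z w" using conf_facts(9) W by (auto simp: successively_append_iff)
        then have "x \<in> H \<or> z \<in> H"
          using Z2[of x d c z w] x cd g n w Ecomm by metis
        then have "z \<in> H" using outside_light x by blast
        then show False using none[OF W(1) g(3) n(1) g(2)] by simp
      qed
    qed
  qed
  have "good_prefix c W U W"
  proof (cases W rule: rev_cases)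
    case (snoc W0 z)
    then have "E c z" using all[of W0 z "[]"] by simp
    then show ?thesis using adj snoc by (simp add: good_prefix_def)
  qed (simp add: good_prefix_def)
  then have "path (U @ W @ [c, x, d])"
    using conf_facts x Ecomm
    by (auto simp: path_def good_prefix_def successively_Cons successively_append_iff)
  moreover have "set (U @ W @ [c, x, d]) = insert x (set C)"
    using conf_facts(13) by auto
  moreover have "J (hd (U @ W @ [c, x, d])) (last (U @ W @ [c, x, d]))"
    using conf_facts EJ Esym by auto
  ultimately show False using no_path x by blast
qed

end

text \<open>The \<open>J\<close>-pair beside \<open>c\<close> must be an edge. If \<open>c\<close>
  and \<open>d\<close> were nonadjacent, this edge would form an induced \<open>Z\<^sub>2\<close>
  with \<open>c\<close>, \<open>x\<close>, \<open>d\<close>; as \<open>x\<close> is light, both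
  vertices of the pair would be heavy.\<close>

lemma ear_ends_adjacent:
  assumes cf: "conf c d W U" and x: "x \<in> V - set C" "E c x" "E d x"
    and "\<not> (last U \<in> H \<and> hd W \<in> H)"
  shows "E (last U) (hd W)" "E c d"
proof -
  note f = conf_facts[OF cf x]
  show adj: "E (last U) (hd W)" using JH[OF f(3)] assms by auto
  have d: "\<not> E d (hd W)"
    using not_d_after_prefix[OF cf x, of "[]" W] f(1) by (auto simp: good_prefix_def)
  note cf' = conf_rev[OF cf]
  have d': "\<not> E d (last U)"
    using not_d_after_prefix[OF cf' x, of "[]" "rev U"] f(2)
    by (auto simp: good_prefix_def hd_rev)
  show "E c d"
  proof (rule ccontr)
    assume "\<not> E c d"
    then have "(last U \<in> H \<or> x \<in> H) \<and> (hd W \<in> H \<or> x \<in> H)"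
      using Z2[of "last U" "hd W" c x d] f adj d d' x Ecomm by metis
    then show False using assms outside_light by blast
  qed
qed

end

section \<open>Few heavy vertices\<close>

lemma four_elements:
  assumes "finite A" "card A \<le> 3" "a \<in> A" "b \<in> A" "c \<in> A" "d \<in> A" "distinct [a, b, c, d]"
  shows False
proof -
  have "card {a, b, c, d} \<le> card A" using assms by (intro card_mono) auto
  then show False using assms by auto
qed

lemma four_elements_in_disjoint_sets:
  assumes "finite A" "card A \<le> 3" "X \<inter> Y = {}"
    "a \<in> A" "a \<in> X" "b \<in> A" "b \<in> X" "a \<noteq> b" "c \<in> A" "c \<in> Y" "d \<in> A" "d \<in> Y" "c \<noteq> d"
  shows False
proof (rule four_elements[OF assms(1,2,4,6,9,11)])
  have "a \<noteq> c" "a \<noteq> d" "b \<noteq> c" "b \<noteq> d" using assms by blast+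
  then show "distinct [a, b, c, d]" using assms by simp
qed

context nonextendable_cycle
begin

text \<open>If \<open>p\<close> and \<open>q\<close> are adjacent, they form an induced
  \<open>Z\<^sub>2\<close> with \<open>c\<close>, \<open>x1\<close>, \<open>x2\<close>; if not, a
  claw with \<open>c\<close> and \<open>x1\<close>. The outside vertices are light.\<close>

lemma two_neighbours_heavy:
  assumes "x1 \<in> V - set C" "x2 \<in> V - set C" "E c x1" "E x1 x2" "\<not> E c x2" "E c p" "E c q" "p \<noteq> q"
    "\<not> E x1 p" "\<not> E x1 q" "\<not> E x2 p" "\<not> E x2 q"
  shows "p \<in> H" "E p q \<Longrightarrow> c \<in> H"
proof -
  have light: "x1 \<notin> H" "x2 \<notin> H" using assms outside_light by auto
  show "p \<in> H"
  proof (cases "E p q")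
    case True
    then show ?thesis using Z2(1)[of p q c x1 x2] assms light Ecomm by metis
  next
    case False
    moreover have "x1 \<noteq> p" "x1 \<noteq> q" using assms Esym by blast+
    ultimately show ?thesis using claw[of c p x1 q] assms light Ecomm by metis
  qed
  show "c \<in> H" if "E p q"
    using Z2(3)[of p q c x1 x2] that assms light Ecomm by metis
qed

text \<open>Since no outside vertex sees two vertices of the cycle, \<open>a\<close> and \<open>b\<close> have many neighbours on
  the cycle; but the claw and \<open>Z\<^sub>2\<close> conditions at \<open>a\<close>, \<open>b\<close> and \<open>c\<close> leave room for at most four each.\<close>

lemma heavy_pair_at_light:
  assumes single: "\<forall>y\<in>V - set C. \<forall>c'\<in>set C. \<forall>d'\<in>set C. E y c' \<longrightarrow> E y d' \<longrightarrow> c' = d'"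
    and c: "c \<in> set C" "c \<notin> H" and x: "x1 \<in> V - set C" "x2 \<in> V - set C" "E c x1" "E x1 x2" "\<not> E c x2"
    and ab: "a \<in> H" "b \<in> H" "a \<noteq> b" "\<not> E a b" "E c a" "E c b" "\<not> E x2 a" "\<not> E x2 b"
    and H3: "card H \<le> 3"
  shows False
proof -
  note one = single[rule_format]
  define N where "N = (\<lambda>z. nb z \<inter> set C)"
  have abC: "a \<in> set C" "b \<in> set C" using ab HC by auto
  have x1: "c' = c" if "c' \<in> set C" "E x1 c'" for c'
    using one[OF x(1) that(1) c(1) that(2)] x(3) Esym by blast
  have ca: "a \<noteq> c" "b \<noteq> c" using ab(5,6) Eirr by auto
  \<comment> \<open>The surplus 3 is one from the two heavy degrees and two from \<open>x1\<close>
    and \<open>x2\<close>, which see neither \<open>a\<close> nor \<open>b\<close>.\<close>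
  have sum: "card (set C) + 3 \<le> card (N a) + card (N b)"
  proof -
    have "x1 \<noteq> x2" using x Eneq by blast
    then have "card {x1, x2} = 2" by simp
    moreover have "\<not> E a z \<and> \<not> E b z" if "z \<in> {x1, x2}" for z
      using that x1 abC ab ca Ecomm by (metis insertE singletonD)
    moreover have "\<not> (E a y \<and> E b y)" if "y \<in> V - set C" for y
      using one[OF that abC] ab(3) Esym by blast
    ultimately show ?thesis
      using heavy_inside[of a b "set C" "{x1, x2}"] ab x cyc_subset_V[OF cycC] by (simp add: N_def)
  qed
  have Nc: "p \<in> H" if "p \<in> N c" "\<not> E x2 p" for p
  proof (cases "p = a")
    case False
    have "\<not> E x1 p" "\<not> E x1 a" using x1 that ca abC Eirr by (auto simp: N_def)
    then show ?thesis
      using two_neighbours_heavy(1)[OF x, of p a] that ab False by (auto simp: N_def)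
  qed (use ab in simp)
  have "card (N x2) \<le> 1"
    using one[OF x(2)] by (auto simp: N_def card_le_Suc0_iff_eq)
  \<comment> \<open>The 4 allows one each for \<open>c\<close>, a vertex that does not see
    \<open>c\<close>, a third heavy vertex and a cycle neighbour of \<open>x2\<close>.\<close>
  have bound: "card (N z) \<le> 4 \<and> card (N z) + 2 \<le> card (set C)"
    if z: "z \<in> {a, b}" for z
  proof
    define M where "M = N z - nb c - {c}"
    have zH: "z \<in> H" "E c z" "z \<in> set C" using z ab abC by auto
    have "card (H - {a, b}) \<le> 1"
      using H3 ab by (simp add: card_Diff_subset)
    \<comment> \<open>Two vertices of \<open>M\<close> are leaves, together with the light
      \<open>c\<close>, of a claw at \<open>z\<close>, or, if adjacent, form an induced
      \<open>Z\<^sub>2\<close> with \<open>z\<close>, \<open>c\<close>, \<open>x1\<close>. Both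
      would be heavy, and besides \<open>a\<close> and \<open>b\<close> there is at most one heavy
      vertex.\<close>
    have MH: "p \<in> H" if "p \<in> M" "q \<in> M" "p \<noteq> q" for p q
    proof -
      have *: "E z p" "E z q" "\<not> E c p" "\<not> E c q" "p \<noteq> c" "q \<noteq> c" "p \<in> set C" "q \<in> set C"
        using that by (auto simp: M_def N_def)
      have "\<not> E x1 p" "\<not> E x1 q" "\<not> E x1 z" using * x1 zH Eirr by auto
      then show ?thesis
        using claw[of z p c q] Z2(1)[of p q z c x1] * that zH x c(2) Ecomm by metis
    qed
    have "card M \<le> 1"
    proof (rule ccontr)
      assume "\<not> card M \<le> 1"
      moreover have fM: "finite M" by (simp add: M_def N_def)
      ultimately obtain p q where pq: "p \<in> M" "q \<in> M" "p \<noteq> q"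
        by (auto simp: card_le_Suc0_iff_eq)
      have "p \<in> H - {a, b}" "q \<in> H - {a, b}"
        using MH[OF pq] MH[OF pq(2,1)] pq z ab Eirr Ecomm by (auto simp: M_def N_def)
      then have "card {p, q} \<le> card (H - {a, b})" by (intro card_mono) auto
      then show False using pq \<open>card (H - {a, b}) \<le> 1\<close> by simp
    qed
    have "N z \<subseteq> {c} \<union> M \<union> (H - {a, b}) \<union> N x2"
    proof
      fix p assume p: "p \<in> N z"
      have "p \<noteq> a" "p \<noteq> b" using p z ab Eirr Ecomm by (auto simp: N_def)
      then show "p \<in> {c} \<union> M \<union> (H - {a, b}) \<union> N x2"
        using p Nc[of p] by (auto simp: M_def N_def)
    qed
    then have "card (N z) \<le> card ({c} \<union> M \<union> (H - {a, b}) \<union> N x2)"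
      by (intro card_mono) (auto simp: M_def N_def)
    also have "\<dots> \<le> card {c} + card M + card (H - {a, b}) + card (N x2)"
      by (meson add_mono card_Un_le le_refl order_trans)
    finally show "card (N z) \<le> 4"
      using \<open>card M \<le> 1\<close> \<open>card (H - {a, b}) \<le> 1\<close> \<open>card (N x2) \<le> 1\<close> by simp
    have "N z \<subseteq> set C - {a, b}" using z ab Eirr Ecomm by (auto simp: N_def)
    then have "card (N z) \<le> card (set C - {a, b})" by (intro card_mono) auto
    also have "\<dots> = card (set C) - 2" using abC ab by (simp add: card_Diff_subset)
    finally show "card (N z) + 2 \<le> card (set C)"
      using card_mono[of "set C" "{a, b}"] abC ab by simp
  qed
  \<comment> \<open>The bounds by 4 give \<open>card (set C) \<le> 5\<close>, the others
    \<open>card (set C) \<ge> 7\<close>.\<close>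
  show False using sum bound[of a] bound[of b] by simp
qed

end

context joined_nonextendable_cycle
begin

lemma single_ear_cases:
  assumes cf: "conf c d W U" and x: "x \<in> V - set C" "E c x" "E d x"
    and no: "\<not> (last U \<in> H \<and> hd W \<in> H)"
  obtains W1 z W3 z' where "E (last U) (hd W)" "W = W1 @ z # W3" "z \<in> H" "E c z" "\<not> E d z"
    "good_prefix c W U W1" "z' \<in> set U" "z' \<in> H" "E c z'" "\<not> E d z'"
proof -
  note e = ear_ends_adjacent[OF cf x no]
  note f = conf_facts[OF cf x]
  obtain W1 z W3 where 1: "W = W1 @ z # W3" "z \<in> H" "E c z" "\<not> E d z" "good_prefix c W U W1"
    by (rule heavy_in_arc[OF cf x e])
  have "E (last (rev W)) (hd (rev U))" using e f by (simp add: hd_rev last_rev Ecomm)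
  then obtain U1 z' U3 where 2: "rev U = U1 @ z' # U3" "z' \<in> H" "E c z'" "\<not> E d z'"
    by (rule heavy_in_arc[OF conf_rev[OF cf] x _ e(2)])
  have "z' \<in> set U" using 2(1) by (metis in_set_conv_decomp set_rev)
  then show ?thesis using that[OF e(1) 1] 2 by blast
qed

text \<open>As both arcs are nonempty, the cycle neighbours of \<open>c\<close> differ from
  \<open>d\<close>. So neither of the first two ear vertices sees them, and
  \<open>two_neighbours_heavy\<close> applies.\<close>

lemma min_ear_heavy_ends:
  assumes cf: "conf c d W U" and m: "min_ear P c d" "2 \<le> length P" and ne: "W \<noteq> []" "U \<noteq> []"
  shows "last U \<in> H" "hd W \<in> H" "E (last U) (hd W) \<Longrightarrow> c \<in> H"
proof -
  obtain x1 x2 P' where x: "P = x1 # x2 # P'" "x1 \<in> V - set C" "x2 \<in> V - set C" "E c x1" "E x1 x2"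
    "\<And>c'. c' \<in> set C \<Longrightarrow> E x1 c' \<Longrightarrow> c' = c"
    "\<And>c'. c' \<in> set C \<Longrightarrow> E x2 c' \<Longrightarrow> c' = d \<and> P' = []"
    using min_ear_second[OF m] by metis
  have cyc: "cyc E (c # W @ d # U)" and C: "set (c # W @ d # U) = set C"
    using cf by (auto simp: conf_def)
  have d: "distinct (c # W @ d # U)" using cyc by (simp add: cyc_def)
  have mem: "last U \<in> set C" "hd W \<in> set C" "c \<in> set C"
    unfolding C[symmetric] using ne by auto
  have neq: "last U \<noteq> c" "hd W \<noteq> c" "last U \<noteq> d" "hd W \<noteq> d" "c \<noteq> d"
    "last U \<noteq> hd W"
  proof -
    have "last U \<in> set U" "hd W \<in> set W" using ne by auto
    then show "last U \<noteq> c" "hd W \<noteq> c" "last U \<noteq> d" "hd W \<noteq> d" "c \<noteq> d" "last U \<noteq> hd W"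
      using d by (metis IntI Un_iff distinct.simps(2) distinct_append empty_iff list.set_intros set_append)+
  qed
  have E: "E c (hd W)" "E c (last U)"
    using cyc ne Ecomm by (auto simp: cyc_def successively_Cons)
  have n: "\<not> E x1 (hd W)" "\<not> E x1 (last U)" "\<not> E x2 (hd W)" "\<not> E x2 (last U)" "\<not> E c x2"
    using x(6,7) mem neq Ecomm by metis+
  note t = two_neighbours_heavy[OF x(2-5) n(5)]
  show "last U \<in> H" "hd W \<in> H" using t(1) E n neq by metis+
  show "c \<in> H" if "E (last U) (hd W)" using t(2)[OF E(2,1)] n neq that by metis
qed

lemma min_ear_single:
  assumes "min_ear P c d" "\<not> 2 \<le> length P"
  obtains x where "x \<in> V - set C" "E c x" "E d x"
proof -
  have "ear P c d" using assms by (simp add: min_ear_def)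
  moreover from this have "P \<noteq> []" by (simp add: ear_def path_def)
  moreover from this assms(2) obtain x where "P = [x]" by (cases P; cases "tl P") auto
  ultimately show ?thesis using that[of x] by (auto simp: ear_def)
qed

text \<open>The exceptional outcome is a triangle with an ear of two inner vertices across one edge.\<close>

lemma few_heavy_nonextendable:
  assumes conn: "two_connected V E" and R: "V - set C \<noteq> {}" and H3: "card H \<le> 3"
  obtains c d x1 x2 w where "set C = {c, d, w}" "length C = 3" "cyc E [c, x1, x2, d]" "cyc E [c, x1, x2, d, w]"
proof -
  note outer = that
  obtain P c d where m: "min_ear P c d" using exists_min_ear[OF conn R] .
  then have e: "ear P c d" by (simp add: min_ear_def)
  then obtain W U where cf: "conf c d W U" and len: "length W + length U + 2 = length C"
    using conf_exists[of c d] by (auto simp: ear_def)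
  note four = four_elements[OF finH H3]
  have dist: "distinct (c # W @ d # U)" and setC: "set (c # W @ d # U) = set C"
    using cf by (auto simp: conf_def cyc_def)
  show ?thesis
  proof (cases "2 \<le> length P")
    case False
    then obtain x where x: "x \<in> V - set C" "E c x" "E d x" by (rule min_ear_single[OF m])
    \<comment> \<open>The heavy \<open>z\<close> and \<open>z'\<close> do not see \<open>d\<close>.
      Each arc has another heavy vertex that does see \<open>d\<close>: its end beside
      \<open>d\<close>, or one found by exchanging \<open>c\<close> and \<open>d\<close>. Together
      these are four.\<close>
    have one_good: False
      if cf: "conf c d W U" and x: "E c x" "E d x" and no: "\<not> (last U \<in> H \<and> hd W \<in> H)" for c d W U
    proof -
      note f = conf_facts[OF cf \<open>x \<in> V - set C\<close> x]
      obtain W1 z W3 z' where z: "W = W1 @ z # W3" "z \<in> H" "E c z" "\<not> E d z"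
        "z' \<in> set U" "z' \<in> H" "E c z'" "\<not> E d z'"
        by (rule single_ear_cases[OF cf \<open>x \<in> V - set C\<close> x no])
      have zW: "z \<in> set W" using z(1) by simp
      have dis: "set W \<inter> set U = {}" using f(11) by auto
      note four2 = four_elements_in_disjoint_sets[OF finH H3 dis]
      show False
      proof (cases "last W \<in> H \<and> hd U \<in> H")
        case True
        have "z \<noteq> last W" "z' \<noteq> hd U" using z f Ecomm by metis+
        moreover have "last W \<in> set W" "hd U \<in> set U" using f by auto
        ultimately show False
          using four2[OF z(2) zW _ _ _ z(6,5)] True by blast
      next
        case False
        obtain U1 y U3 y' where y: "U = U1 @ y # U3" "y \<in> H" "E d y" "\<not> E c y"
          "y' \<in> set W" "y' \<in> H" "E d y'" "\<not> E c y'"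
          by (rule single_ear_cases[OF conf_swap[OF cf] \<open>x \<in> V - set C\<close> x(2,1) False])
        have "y \<in> set U" using y(1) by simp
        moreover have "z \<noteq> y'" "z' \<noteq> y" using z y by metis+
        ultimately show False
          using four2[OF z(2) zW y(6,5) _ z(6,5) y(2)] by blast
      qed
    qed
    note f = conf_facts[OF cf x]
    have "last U \<in> H" "hd W \<in> H" "last W \<in> H" "hd U \<in> H"
      using one_good[OF cf x(2,3)] one_good[OF conf_swap[OF cf] x(3,2)] by blast+
    moreover have "hd W \<in> set W" "last W \<in> set W" "hd U \<in> set U" "last U \<in> set U" using f by auto
    moreover have "set W \<inter> set U = {}" using f(11) by auto
    \<comment> \<open>All four arc ends are heavy, so one arc is a single vertex. Then the
      \<open>J\<close>-pair at \<open>c\<close> or at \<open>d\<close> consists of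
      \<open>hd W\<close> and \<open>hd U\<close>.\<close>
    ultimately have "hd W = last W \<or> hd U = last U"
      using four_elements_in_disjoint_sets[OF finH H3] by blast
    then have "J (hd W) (hd U)" using f Jsym by metis
    moreover have "path (W @ [d, x, c] @ rev U)"
      using f x Ecomm by (auto simp: path_def successively_Cons successively_append_iff hd_rev last_rev)
    moreover have "set (W @ [d, x, c] @ rev U) = insert x (set C)" using setC by auto
    ultimately have False
      using no_path[of "W @ [d, x, c] @ rev U" x] x f by (auto simp: last_rev)
    then show ?thesis ..
  next
    case P2: True
    have one: "c' = d'" if "y \<in> V - set C" "c' \<in> set C" "d' \<in> set C" "E y c'" "E y d'" for y c' d'
      using min_ear_one_neighbour[OF m P2 that] .
    then have single: "\<forall>y\<in>V - set C. \<forall>c'\<in>set C. \<forall>d'\<in>set C. E y c' \<longrightarrow> E y d' \<longrightarrow> c' = d'"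
      by blast
    show ?thesis
    proof (cases "W \<noteq> [] \<and> U \<noteq> []")
      case True
      \<comment> \<open>The cycle neighbours of a light \<open>c\<close> are heavy, and nonadjacent
        since adjacency would make \<open>c\<close> heavy.\<close>
      have light_end: False
        if cf: "conf c d W U" and m: "min_ear P c d" and P2: "2 \<le> length P" and ne: "W \<noteq> []" "U \<noteq> []" and c: "c \<notin> H"
        for c d W U P
      proof -
        note h = min_ear_heavy_ends[OF cf m P2 ne]
        obtain x1 x2 P' where x: "P = x1 # x2 # P'" "x1 \<in> V - set C" "x2 \<in> V - set C" "E c x1" "E x1 x2"
          "\<And>c'. c' \<in> set C \<Longrightarrow> E x2 c' \<Longrightarrow> c' = d \<and> P' = []"
          using min_ear_second[OF m P2] by metis
        have cyc: "cyc E (c # W @ d # U)" and C: "set (c # W @ d # U) = set C"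
          using cf by (auto simp: conf_def)
        have d: "distinct (c # W @ d # U)" using cyc by (simp add: cyc_def)
        have mem: "last U \<in> set C" "hd W \<in> set C" "c \<in> set C"
          unfolding C[symmetric] using ne by auto
        have neq: "last U \<noteq> d" "hd W \<noteq> d" "c \<noteq> d" "last U \<noteq> hd W"
        proof -
          have "last U \<in> set U" "hd W \<in> set W" using ne by auto
          then show "last U \<noteq> d" "hd W \<noteq> d" "c \<noteq> d" "last U \<noteq> hd W"
            using d by (metis IntI Un_iff distinct.simps(2) distinct_append empty_iff list.set_intros set_append)+
        qed
        have E: "E c (hd W)" "E c (last U)"
          using cyc ne Ecomm by (auto simp: cyc_def successively_Cons)
        have n: "\<not> E x2 (hd W)" "\<not> E x2 (last U)" "\<not> E c x2"
          using x(6) mem neq Ecomm by metis+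
        show False
          by (rule heavy_pair_at_light[OF single mem(3) c x(2-5) n(3) h(1,2) neq(4) _ E(2,1) n(2,1) H3])
            (use h(3) c in auto)
      qed
      note h1 = min_ear_heavy_ends[OF cf m P2]
      have "c \<in> H" using light_end[OF cf m P2] True by blast
      moreover have "d \<in> H"
        using light_end[OF conf_swap[OF cf] min_ear_rev[OF m]] True P2 by auto
      moreover have mem: "hd W \<in> set W" "last U \<in> set U" using True by auto
      moreover have disj: "set W \<inter> set U = {}" "{c, d} \<inter> (set W \<union> set U) = {}" "c \<noteq> d"
        using dist by auto
      moreover have "hd W \<noteq> last U" using mem disj(1) by (metis IntI empty_iff)
      ultimately have False
        using four_elements_in_disjoint_sets[OF finH H3 disj(2), of c d "hd W" "last U"] h1 True
        by blast
      then show ?thesis ..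
    next
      case False
      have C3: "3 \<le> length C" using cycC by (simp add: cyc_def)
      \<comment> \<open>One arc is empty, so \<open>c\<close> and \<open>d\<close> are consecutive;
        by reversal it may be taken to be \<open>W\<close>.\<close>
      have consecutive: thesis
        if cf: "conf c d [] U" and m: "min_ear P c d" and U: "length U + 2 = length C" for U
      proof -
        have cyc: "cyc E (c # d # U)" and C: "set (c # d # U) = set C" using cf by (auto simp: conf_def)
        have Une: "U \<noteq> []" using U C3 by auto
        have d: "distinct (c # d # U)" using cyc by (simp add: cyc_def)
        have E: "E c d" "E d (hd U)" "E c (last U)" "successively E U"
          using cyc Une Ecomm by (auto simp: cyc_def successively_Cons)
        have cyc': "cyc E (d # U @ [c])" "set (d # U @ [c]) = set C"
          using cyc_rotate_append[of E "[c]" "d # U"] cyc C by auto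
        obtain x1 x2 P' where x: "P = x1 # x2 # P'" "x1 \<in> V - set C" "x2 \<in> V - set C" "E c x1" "E x1 x2"
          "\<And>c'. c' \<in> set C \<Longrightarrow> E x1 c' \<Longrightarrow> c' = c"
          "\<And>c'. c' \<in> set C \<Longrightarrow> E x2 c' \<Longrightarrow> c' = d \<and> P' = []"
          using min_ear_second[OF m P2] by metis
        define y1 where "y1 = last P"
        have y1: "y1 \<in> V - set C" "E d y1"
        proof -
          have "ear P c d" using m by (simp add: min_ear_def)
          then have "set P \<subseteq> V - set C" "E d (last P)" "P \<noteq> []" by (auto simp: ear_def path_def)
          then show "y1 \<in> V - set C" "E d y1"
            unfolding y1_def using last_in_set by blast+
        qed
        have J: "J (last U) d" "J c (hd U)"
          using J_attach[OF cyc C x(2,4)] J_attach[OF cyc'(1,2) y1] Une by auto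
        have mem: "last U \<in> set C" "hd U \<in> set C" "c \<in> set C" "d \<in> set C"
          unfolding C[symmetric] using Une by auto
        have neq: "last U \<noteq> c" "last U \<noteq> d" "hd U \<noteq> c" "hd U \<noteq> d" "c \<noteq> d"
          using d Une last_in_set[of U] hd_in_set[of U] by auto
        show thesis
        proof (cases "P' = []")
          case False
          obtain y2 P'' where y: "y2 \<in> V - set C" "E y1 y2"
            "\<And>c'. c' \<in> set C \<Longrightarrow> E y1 c' \<Longrightarrow> c' = d"
            "\<And>c'. c' \<in> set C \<Longrightarrow> E y2 c' \<Longrightarrow> c' = c \<and> P'' = []" "rev P = y1 # y2 # P''"
          proof -
            from min_ear_second[OF min_ear_rev[OF m]] P2 obtain z1 z2 Q where
              z: "rev P = z1 # z2 # Q" "z2 \<in> V - set C" "E z1 z2" "\<And>c'. c' \<in> set C \<Longrightarrow> E z1 c' \<Longrightarrow> c' = d"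
              "\<And>c'. c' \<in> set C \<Longrightarrow> E z2 c' \<Longrightarrow> c' = c \<and> Q = []"
              by (metis length_rev)
            have "P \<noteq> []" using x(1) by simp
            then have "z1 = y1" using z(1) by (metis hd_rev list.sel(1) y1_def)
            then show thesis using that[of z2 Q] z by auto
          qed
          have "P'' \<noteq> []"
          proof
            assume "P'' = []"
            then have "length (rev P) = 2" using y(5) by simp
            then show False using x(1) False by simp
          qed
          \<comment> \<open>An ear of three or more vertices leaves \<open>x2\<close> and
            \<open>y2\<close> without neighbours on the cycle. So \<open>d\<close> may be used as a
            neighbour of \<open>c\<close> in \<open>two_neighbours_heavy\<close>, and vice versa,
            and \<open>c\<close>, \<open>d\<close> and both ends of \<open>U\<close> become
            heavy.\<close>
          have none: "\<not> E x2 c'" "\<not> E y2 c'" if "c' \<in> set C" for c'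
            using x(7) y(4) that False \<open>P'' \<noteq> []\<close> by blast+
          have ad: "last U \<in> H" "d \<in> H" "E (last U) d \<Longrightarrow> c \<in> H"
          proof -
            have n: "\<not> E x1 (last U)" "\<not> E x1 d" "\<not> E c x2"
              using x(6) mem neq none Ecomm by metis+
            note t = two_neighbours_heavy[OF x(2-5) n(3)]
            show "last U \<in> H" "d \<in> H" using t(1) E n none mem neq by metis+
            show "c \<in> H" if "E (last U) d" using t(2)[OF E(3,1)] n none mem neq that by metis
          qed
          have cb: "c \<in> H" "hd U \<in> H"
          proof -
            have n: "\<not> E y1 c" "\<not> E y1 (hd U)" "\<not> E d y2" "E d c"
              using y(3) mem neq none E Ecomm by metis+
            note t = two_neighbours_heavy[OF y1(1) y(1) y1(2) y(2) n(3)]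
            show "c \<in> H" "hd U \<in> H" using t(1) E n none mem neq by metis+
          qed
          have "last U = hd U"
            using four[of "last U" "hd U" c d] ad cb neq by auto
          then have "length U = 1"
            using d Une by (cases U) (auto split: if_splits)
          then have "card (set C) = 3" using U cycC by (simp add: cyc_def distinct_card)
          have "set C \<subseteq> V" using cyc_subset_V[OF cycC] .
          \<comment> \<open>On a triangle this reads \<open>5 \<le> 2 + 2\<close>.\<close>
          have "card (set C) + card {x2} + 1 \<le> card (nb c \<inter> set C) + card (nb d \<inter> set C)"
          proof (rule heavy_inside)
            show "\<not> (E c y \<and> E d y)" if "y \<in> V - set C" for y
              using one[OF that mem(3,4)] neq Esym by blast
            show "\<not> E c y \<and> \<not> E d y" if "y \<in> {x2}" for y
              using none mem that Esym by blast
          qed (use cb ad x \<open>set C \<subseteq> V\<close> in auto)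
          moreover have le2: "card (nb z \<inter> set C) \<le> 2" if "z \<in> set C" for z
          proof -
            have "nb z \<inter> set C \<subseteq> set C - {z}" using Eirr by auto
            then have "card (nb z \<inter> set C) \<le> card (set C - {z})" by (intro card_mono) auto
            then show ?thesis using that \<open>card (set C) = 3\<close> by simp
          qed
          ultimately have False
            using \<open>card (set C) = 3\<close> le2[OF mem(3)] le2[OF mem(4)] by simp
          then show ?thesis ..
        next
          case True
          have y1x: "y1 = x2" using x(1) True by (simp add: y1_def)
          have dx: "E d x2" using y1 y1x by simp
          have x2d: "c' = d" if "c' \<in> set C" "E x2 c'" for c' using x(7) that by blast
          have x12: "x1 \<noteq> x2" using x(5) Eneq by blast
          show ?thesis
          proof (cases "last U = hd U")
            case True
            then obtain w where w: "U = [w]"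
              using d Une by (cases U) (auto split: if_splits)
            have "x1 \<notin> set (c # d # U)" "x2 \<notin> set (c # d # U)" using x(2,3) unfolding C by blast+
            then have "cyc E [c, x1, x2, d]" "cyc E [c, x1, x2, d, w]"
              using x12 x dx E d w Ecomm neq by (auto simp: cyc_def)
            moreover have "set C = {c, d, w}" using C w by auto
            ultimately show ?thesis using outer[of c d w x1 x2] U w by simp
          next
            case ab: False
            have n: "\<not> E x1 (last U)" "\<not> E x1 (hd U)" "\<not> E x2 (last U)" "\<not> E x2 (hd U)" "\<not> E c x2"
              "\<not> E d x1"
              using x(6) x2d mem neq Ecomm by metis+
            note tc = two_neighbours_heavy[OF x(2-5) n(5)]
            note td = two_neighbours_heavy[OF x(3,2) dx Esym[OF x(5)] n(6)]
            \<comment> \<open>If neither \<open>J\<close>-pair is an edge, both consist of heavy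
              vertices. If one is, then \<open>c\<close> or \<open>d\<close> sees both ends of
              \<open>U\<close>, and \<open>two_neighbours_heavy\<close> applies there.\<close>
            have abH: "last U \<in> H" "hd U \<in> H"
              using JH[OF J(1)] JH[OF J(2)] tc(1) td(1) E ab n Ecomm by metis+
            have "c \<notin> H \<or> d \<notin> H" using four[of c d "last U" "hd U"] abH ab neq by auto
            then have False
            proof
              assume c: "c \<notin> H"
              then have cb: "E c (hd U)" using JH[OF J(2)] by blast
              then have "\<not> E (last U) (hd U)" using tc(2)[OF E(3) cb ab] n c by blast
              then show False
                using heavy_pair_at_light[OF single mem(3) c x(2-5) n(5) abH ab _ E(3) cb n(3,4) H3] by blast
            next
              assume d: "d \<notin> H"
              then have ad: "E d (last U)" using JH[OF J(1)] Esym by blast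
              then have "\<not> E (last U) (hd U)" using td(2)[OF ad E(2) ab] n d by blast
              then show False
                using heavy_pair_at_light[OF single mem(4) d x(3,2) dx Esym[OF x(5)] n(6) abH ab _ ad E(2) n(1,2) H3]
                by blast
            qed
            then show ?thesis ..
          qed
        qed
      qed
      show ?thesis
      proof (cases "W = []")
        case True
        then show ?thesis using consecutive[of U] cf m len by simp
      next
        case W: False
        then have "U = []" using False by simp
        then show ?thesis using consecutive[of "rev W"] conf_rev[OF cf] m len by simp
      qed
    qed
  qed
qed

end

section \<open>Enlarging cycles\<close>

context claw_Z2_heavy_graph
begin

lemma nonextendable_cycleI:
  assumes C: "cyc E C" "H \<subseteq> set C"
    and no: "\<And>D. cyc E D \<Longrightarrow> set C \<subset> set D \<Longrightarrow> length D = length C + 1 \<Longrightarrow> False"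
  shows "nonextendable_cycle V E C"
proof unfold_locales
  fix p x assume p: "path p" "x \<in> V - set C" "set p = insert x (set C)" "E (hd p) (last p)"
  have "card (set p) = length C + 1"
    using p C by (simp add: cyc_def distinct_card)
  then have len: "length p = length C + 1"
    using p(1) by (metis distinct_card path_def)
  moreover have "3 \<le> length p" using len C by (simp add: cyc_def)
  then have "cyc E p" using p Ecomm by (auto simp: cyc_def path_def)
  ultimately show False using no[of p] p by blast
qed (use C in auto)

text \<open>The second alternative comes from the triangle with an ear: the cycle with one more
  vertex may miss a heavy vertex and only supplies its length, while the one with two more vertices
  can be enlarged further.\<close>

lemma extend_cycle:
  assumes conn: "two_connected V E" and H3: "card H \<le> 3"
    and C: "cyc E C" "H \<subseteq> set C" "V - set C \<noteq> {}"
  shows "(\<exists>D. cyc E D \<and> H \<subseteq> set D \<and> length D = length C + 1) \<or>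
    (\<exists>D. cyc E D \<and> length D = length C + 1) \<and> (\<exists>D. cyc E D \<and> H \<subseteq> set D \<and> length D = length C + 2)"
proof (rule ccontr)
  assume no: "\<not> ?thesis"
  have no1: False if "cyc E D" "set C \<subset> set D" "length D = length C + 1" for D
    using no that C by blast
  have CV: "set C \<subseteq> V" using cyc_subset_V[OF C(1)] .
  interpret s0: nonextendable_cycle V E C by (rule nonextendable_cycleI[OF C(1,2) no1])
  define J where "J = (\<lambda>a b. E a b \<or> a \<in> H \<and> b \<in> H \<and> a \<noteq> b \<and> (\<forall>y\<in>V - set C. \<not> (E a y \<and> E b y)))"
  interpret s: joined_nonextendable_cycle V E C J
  proof unfold_locales
    fix a b assume "E a b" then show "J a b" by (simp add: J_def)
  next
    fix a b assume "J a b" then show "J b a" using Ecomm by (auto simp: J_def)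
  next
    fix a b assume "J a b" then show "E a b \<or> a \<in> H \<and> b \<in> H" by (auto simp: J_def)
  next
    fix p x assume p: "path p" "x \<in> V - set C" "set p = insert x (set C)" "J (hd p) (last p)"
    show False
    proof (cases "E (hd p) (last p)")
      case True
      then show False using s0.no_path0 p by blast
    next
      case False
      have "card (set p) = length C + 1"
        using p C by (simp add: cyc_def distinct_card)
      then have len: "length p = length C + 1"
        using p(1) by (metis distinct_card path_def)
      have "card (set p) + card ({} :: 'a set) + 1 \<le> card (nb (hd p) \<inter> set p) + card (nb (last p) \<inter> set p)"
        by (rule heavy_inside) (use p False CV in \<open>auto simp: J_def\<close>)
      moreover have "4 \<le> length p" using len C by (simp add: cyc_def)
      moreover have "set p \<subseteq> V" using p(2,3) CV by auto
      ultimately obtain D where "cyc E D" "set D = set p" "length D = length p"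
        using cyc_close_path[OF p(1) _ _ False] len \<open>card (set p) = length C + 1\<close> by auto
      then show False using no1[of D] len p(2,3) by auto
    qed
  next
    fix c Z x assume c: "cyc E (c # Z)" "set (c # Z) = set C" "x \<in> V - set C" "E c x"
    show "J (last Z) (hd Z)"
    proof (rule ccontr)
      assume nJ: "\<not> J (last Z) (hd Z)"
      define a b where "a = last Z" and "b = hd Z"
      have Z: "distinct (c # Z)" "2 \<le> length Z" "successively E (c # Z)" "E (last (c # Z)) c"
        using c(1) by (auto simp: cyc_def)
      have ab: "a \<in> H" "b \<in> H" "\<not> E a b"
        using s0.adjacent_or_heavy[OF c] nJ by (auto simp: J_def a_def b_def)
      have "a \<noteq> b" using Z(1,2) by (cases Z) (auto simp: a_def b_def split: if_splits)
      then obtain y where y: "y \<in> V - set C" "E a y" "E b y"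
        using nJ ab by (auto simp: J_def a_def b_def)
      obtain Z' where Z': "Z = b # Z' @ [a]"
      proof -
        have "Z = b # tl Z" using Z(2) by (cases Z) (auto simp: b_def)
        moreover have "tl Z = butlast (tl Z) @ [a]"
          using Z(2) by (cases Z) (auto simp: a_def)
        ultimately show ?thesis using that by metis
      qed
      have Z'ne: "Z' \<noteq> []" using Z Z' ab Ecomm by (auto simp: successively_Cons)
      \<comment> \<open>\<open>e\<close> is the other cycle neighbour of \<open>a\<close>. If it
        sees \<open>c\<close>, then \<open>y\<close> can be inserted between \<open>a\<close> and
        \<open>b\<close>; if not, the claw at \<open>a\<close> on \<open>c\<close>,
        \<open>y\<close>, \<open>e\<close> makes \<open>c\<close> and \<open>e\<close> heavy in
        addition to \<open>a\<close> and \<open>b\<close>.\<close>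
      define e where "e = last Z'"
      have cyca: "cyc E (a # c # b # Z')" "set (a # c # b # Z') = set C"
        using cyc_rotate_append[of E "c # b # Z'" "[a]"] c(1,2) Z' by auto
      have ynot: "\<not> E y c" "\<not> E y e"
        using s0.not_adjacent_outside[OF cyca y(1,2)] Z'ne by (auto simp: e_def)
      have fa: "E a c" "E c b" "E b (hd Z')" "E e a" "successively E Z'" "distinct (a # c # b # Z')"
        using cyca(1) Z'ne by (auto simp: cyc_def successively_Cons e_def)
      have eZ: "e \<in> set Z'" using Z'ne by (simp add: e_def)
      have yC: "y \<notin> set (a # c # b # Z')" using y(1) unfolding cyca(2) by blast
      show False
      proof (cases "E c e")
        case True
        have "path (Z' @ [c, a, y, b])"
          using True fa y yC Z'ne Ecomm
          by (auto simp: path_def successively_Cons successively_append_iff e_def)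
        moreover have "set (Z' @ [c, a, y, b]) = insert y (set C)"
          unfolding cyca(2)[symmetric] by auto
        moreover have "E (hd (Z' @ [c, a, y, b])) (last (Z' @ [c, a, y, b]))"
          using fa Z'ne Esym by auto
        ultimately show False using s0.no_path0 y(1) by blast
      next
        case False
        have ne: "c \<noteq> e" "y \<noteq> c" "y \<noteq> e" using fa(6) eZ yC by auto
        have "y \<notin> H" using s0.outside_light y(1) by blast
        then have "c \<in> H" "e \<in> H"
          using claw[of a c y e] claw[of a e y c] False ne ynot fa y Ecomm by metis+
        then show False
          using four_elements[OF finH H3 ab(1,2), of c e] fa(6) eZ by auto
      qed
    qed
  qed
  obtain c d x1 x2 w where *: "set C = {c, d, w}" "length C = 3" "cyc E [c, x1, x2, d]"
    "cyc E [c, x1, x2, d, w]"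
    by (rule s.few_heavy_nonextendable[OF conn C(3) H3])
  moreover have "H \<subseteq> set [c, x1, x2, d, w]" using C(2) *(1) by auto
  moreover have "length [c, x1, x2, d] = length C + 1" "length [c, x1, x2, d, w] = length C + 2"
    using *(2) by auto
  ultimately show False using no by blast
qed

text \<open>Among the cycles through \<open>H\<close> a longest one is taken, so that any larger
  cycle is a contradiction. It is therefore enough to find a path between two heavy vertices that
  covers the cycle and some outside vertex.\<close>

lemma hamiltonian:
  assumes conn: "two_connected V E" and H3: "3 \<le> card H"
  obtains C where "cyc E C" "set C = V"
proof -
  define P where "P = (\<lambda>C. cyc E C \<and> H \<subseteq> set C)"
  have bound: "length C \<le> card V" if "P C" for C
    using that cyc_subset_V[of C] card_mono[OF finV, of "set C"]
    by (auto simp: P_def cyc_def distinct_card)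
  obtain C0 where "P C0" using cyc_containing_heavy[OF H3] by (auto simp: P_def)
  then have "\<exists>C. P C \<and> (\<forall>D. P D \<longrightarrow> length D \<le> length C)"
    by (rule ex_has_greatest_nat[where b = "Suc (card V)"]) (use bound in \<open>simp add: less_Suc_eq_le\<close>)
  then obtain C where C: "P C" "\<And>D. P D \<Longrightarrow> length D \<le> length C"
    by blast
  have cyC: "cyc E C" "H \<subseteq> set C" and CV: "set C \<subseteq> V"
    using C(1) cyc_subset_V by (auto simp: P_def)
  have longest: False if "cyc E D" "set C \<subset> set D" for D
  proof -
    have "card (set C) < card (set D)" using that by (intro psubset_card_mono) auto
    then have "length C < length D" using that cyC by (simp add: cyc_def distinct_card)
    then show False using C(2)[of D] that cyC by (auto simp: P_def)
  qed
  define J where "J = (\<lambda>a b. E a b \<or> a \<in> H \<and> b \<in> H \<and> a \<noteq> b)"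
  have big: False if p: "path p" "set p \<subseteq> V" "set C \<subset> set p" "J (hd p) (last p)" for p
  proof -
    have "card (set C) < card (set p)" using p by (intro psubset_card_mono) auto
    then have len: "3 \<le> length p" using p(1) cyC by (simp add: cyc_def path_def distinct_card)
    show False
    proof (cases "E (hd p) (last p)")
      case True
      then have "cyc E p" using p(1) len Ecomm by (auto simp: cyc_def path_def)
      then show False using longest p(3) by blast
    next
      case False
      then have "hd p \<in> H" "last p \<in> H" "hd p \<noteq> last p" using p(4) by (auto simp: J_def)
      then obtain D where "cyc E D" "set p \<subseteq> set D"
        using cyc_close_heavy_path[OF p(1,2)] len by metis
      then show False using longest p(3) by blast
    qed
  qed
  have "V - set C = {}"
  proof (rule ccontr)
    assume R: "V - set C \<noteq> {}"
    interpret s0: nonextendable_cycle V E C by (rule nonextendable_cycleI[OF cyC]) (use longest in blast)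
    interpret s: joined_nonextendable_cycle V E C J
    proof unfold_locales
      fix a b assume "E a b" then show "J a b" by (simp add: J_def)
    next
      fix a b assume "J a b" then show "J b a" using Ecomm by (auto simp: J_def)
    next
      fix a b assume "J a b" then show "E a b \<or> a \<in> H \<and> b \<in> H" by (auto simp: J_def)
    next
      fix p x assume "path p" "x \<in> V - set C" "set p = insert x (set C)" "J (hd p) (last p)"
      moreover from this have "set p \<subseteq> V" "set C \<subset> set p" using CV by auto
      ultimately show False using big by blast
    next
      fix c Z x assume c: "cyc E (c # Z)" "set (c # Z) = set C" "x \<in> V - set C" "E c x"
      have "distinct Z" "2 \<le> length Z" using c(1) by (auto simp: cyc_def)
      then have "last Z \<noteq> hd Z" by (cases Z) (auto split: if_splits)
      then show "J (last Z) (hd Z)" using s0.adjacent_or_heavy[OF c] by (auto simp: J_def)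
    qed
    have heavy_ends: False
      if "path (z # p @ [z'])" "z \<in> H" "z' \<in> H" "set (z # p @ [z']) \<subseteq> V" "set C \<subset> set (z # p @ [z'])" for z p z'
      using big[of "z # p @ [z']"] that by (auto simp: J_def path_def)
    obtain P c d where m: "s0.min_ear P c d" using s0.exists_min_ear[OF conn R] .
    then have e: "s0.ear P c d" by (simp add: s0.min_ear_def)
    then have "c \<in> set C" "d \<in> set C" "c \<noteq> d" by (auto simp: s0.ear_def)
    then obtain W U where cf: "s0.conf c d W U" by (rule s0.conf_exists)
    show False
    proof (cases "2 \<le> length P")
      case False
      then obtain x where x: "x \<in> V - set C" "E c x" "E d x" by (rule s.min_ear_single[OF m])
      \<comment> \<open>The path starts at \<open>z\<close>, follows the rest of \<open>W\<close>,
        then \<open>d\<close>, \<open>x\<close>, \<open>c\<close>, and returns through the prefix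
        \<open>W1\<close> and \<open>U\<close> reversed. It ends in \<open>hd U\<close> if this is
        heavy; otherwise a heavy \<open>y\<close> cuts \<open>U\<close> likewise, the prefix
        \<open>U1\<close> is moved before \<open>d\<close>, and the path ends in
        \<open>y\<close>.\<close>
      have one_good: False
        if cf: "s0.conf c d W U" and x': "E c x" "E d x" and no: "\<not> (last U \<in> H \<and> hd W \<in> H)" for c d W U
      proof -
        note f = s.conf_facts[OF cf x(1) x']
        obtain W1 z W3 z' where z: "E (last U) (hd W)" "W = W1 @ z # W3" "z \<in> H" "s.good_prefix c W U W1"
          by (rule s.single_ear_cases[OF cf x(1) x' no])
        have W: "successively E W1" "successively E (z # W3)" "last (z # W3) = last W" "W1 \<noteq> [] \<Longrightarrow> hd W1 = hd W"
          "W1 \<noteq> [] \<Longrightarrow> E c (last W1)"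
          using f(9) z(2,4) by (auto simp: successively_append_iff s.good_prefix_def)
        have S: "set (c # (W1 @ z # W3) @ d # U) = set C" "distinct (c # (W1 @ z # W3) @ d # U)"
          "x \<notin> set (c # (W1 @ z # W3) @ d # U)"
          using f(11-13) unfolding z(2) by blast+
        have to_x: "successively E (S @ [d, x, c])" if "successively E S" "S \<noteq> []" "E (last S) d" for S
          using that x' Ecomm by (auto simp: successively_append_iff)
        have from_c: "successively E (c # rev W1 @ rev S)" if "successively E S" "S \<noteq> []" "last S = last U" for S
          using that W z(1) f(8) Ecomm
          by (cases "W1 = []") (auto simp: successively_append_iff successively_Cons hd_rev last_rev)
        have join: "successively E (A @ c # B)" if "successively E (A @ [c])" "successively E (c # B)" for A B
          using that by (cases B) (auto simp: successively_append_iff)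
        show False
        proof (cases "hd U \<in> H")
          case True
          obtain b U' where U: "U = b # U'" using f(2) by (cases U) auto
          have "successively E ((z # W3) @ [d, x, c])"
            by (rule to_x) (use W(2,3) f(6) in simp_all)
          then have "successively E (((z # W3) @ [d, x]) @ c # rev W1 @ rev U)"
            using join[of "(z # W3) @ [d, x]" "rev W1 @ rev U"] from_c[of U] f(2,10) by simp
          then have "path ((z # W3) @ [d, x, c] @ rev W1 @ rev U)"
            using S(2,3) by (auto simp: path_def)
          then have "path (z # (W3 @ [d, x, c] @ rev W1 @ rev U') @ [b])"
            by (simp add: U)
          moreover have "set (z # (W3 @ [d, x, c] @ rev W1 @ rev U') @ [b]) = insert x (set C)"
            unfolding S(1)[symmetric] U by auto
          ultimately show False
            using heavy_ends[of z _ b] z(3) True U x(1) CV by fastforce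
        next
          case False
          obtain U1 y U3 z' where y: "E (last W) (hd U)" "U = U1 @ y # U3" "y \<in> H" "s.good_prefix d U W U1"
            by (rule s.single_ear_cases[OF s0.conf_swap[OF cf] x(1) x'(2,1)]) (use False in auto)
          have U: "successively E U1" "successively E (y # U3)" "last (y # U3) = last U" "U1 \<noteq> [] \<Longrightarrow> hd U1 = hd U"
            "U1 \<noteq> [] \<Longrightarrow> E d (last U1)"
            using f(10) y(2,4) by (auto simp: successively_append_iff s.good_prefix_def)
          have S': "set (c # (W1 @ z # W3) @ d # U1 @ y # U3) = set C"
            "distinct (c # (W1 @ z # W3) @ d # U1 @ y # U3)" "x \<notin> set (c # (W1 @ z # W3) @ d # U1 @ y # U3)"
            using S unfolding y(2) by blast+
          have "path ((z # W3) @ U1 @ [d, x, c] @ rev W1 @ rev (y # U3))"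
          proof -
            have "successively E (((z # W3) @ U1) @ [d, x, c])"
            proof (rule to_x)
              show "successively E ((z # W3) @ U1)"
                using W(2,3) U(1,4) y(1) successively_append_iff[of E "z # W3" U1] by metis
              show "E (last ((z # W3) @ U1)) d"
                using W(3) U(5) f(6) Ecomm by (cases "U1 = []") simp_all
            qed simp
            then have "successively E ((((z # W3) @ U1) @ [d, x]) @ c # rev W1 @ rev (y # U3))"
              using join[of "((z # W3) @ U1) @ [d, x]" "rev W1 @ rev (y # U3)"] from_c[of "y # U3"] U(2,3)
              by (simp del: rev.simps)
            then have "successively E ((z # W3) @ U1 @ [d, x, c] @ rev W1 @ rev (y # U3))" by simp
            then show ?thesis using S' by (auto simp: path_def)
          qed
          then have "path (z # (W3 @ U1 @ [d, x, c] @ rev W1 @ rev U3) @ [y])" by simp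
          moreover have "set (z # (W3 @ U1 @ [d, x, c] @ rev W1 @ rev U3) @ [y]) = insert x (set C)"
            unfolding S'(1)[symmetric] by auto
          ultimately show False
            using heavy_ends[of z _ y] z(3) y(3) x(1) CV by fastforce
        qed
      qed
      note f = s.conf_facts[OF cf x]
      have h: "hd W \<in> H" "hd U \<in> H"
        using one_good[OF cf x(2,3)] one_good[OF s0.conf_swap[OF cf] x(3,2)] by blast+
      have "path (W @ [d, x, c] @ rev U)"
        using f x Ecomm by (auto simp: path_def successively_Cons successively_append_iff hd_rev last_rev)
      moreover have "set (W @ [d, x, c] @ rev U) = insert x (set C)"
        unfolding f(13)[symmetric] by auto
      moreover have "hd W \<noteq> hd U"
        using f(1,2,11) by (cases W; cases U) auto
      then have "J (hd (W @ [d, x, c] @ rev U)) (last (W @ [d, x, c] @ rev U))"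
        using h f(1,2) by (auto simp: J_def last_rev)
      ultimately show False using s.no_path x(1) by blast
    next
      case P2: True
      have eP: "path P" "set P \<subseteq> V - set C" "E c (hd P)" "E d (last P)" "P \<noteq> []"
        using e by (auto simp: s0.ear_def path_def)
      have C3: "3 \<le> length C" using cyC by (simp add: cyc_def)
      have consecutive: False if cf: "s0.conf c d [] U" for U
      proof -
        have cyc: "cyc E (c # d # U)" and S: "set (c # d # U) = set C" using cf by (auto simp: s0.conf_def)
        have U: "U \<noteq> []" "E d (hd U)" "E (last U) c" "successively E U" "distinct (c # d # U)"
          using cyc by (auto simp: cyc_def successively_Cons split: if_splits)
        have dis: "set P \<inter> set (c # d # U) = {}" using eP(2) S by blast
        have "path (P @ (d # U) @ [c])"
          using eP U dis Ecomm by (auto simp: path_def successively_Cons successively_append_iff)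
        moreover have setp: "set (P @ (d # U) @ [c]) = set P \<union> set C" unfolding S[symmetric] by auto
        moreover have "set P \<union> set C \<subseteq> V" "set C \<subset> set P \<union> set C"
          using eP(2) hd_in_set[OF eP(5)] CV by blast+
        moreover have "J (hd (P @ (d # U) @ [c])) (last (P @ (d # U) @ [c]))"
          using eP(3,5) Esym by (auto simp: J_def)
        ultimately show False using big[of "P @ (d # U) @ [c]"] by simp
      qed
      have ne: "W \<noteq> []" "U \<noteq> []"
        using consecutive[of U] consecutive[of "rev W"] cf s0.conf_rev[OF cf] by auto
      have h: "hd W \<in> H" "hd U \<in> H"
        using s.min_ear_heavy_ends(2)[OF cf m P2 ne]
          s.min_ear_heavy_ends(2)[OF s0.conf_swap[OF cf] s0.min_ear_rev[OF m]] P2 ne by auto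
      have cyc: "cyc E (c # W @ d # U)" and S: "set (c # W @ d # U) = set C" using cf by (auto simp: s0.conf_def)
      have U: "successively E W" "successively E U" "E (last W) d" "E (last U) c" "distinct (c # W @ d # U)"
        using cyc ne by (auto simp: cyc_def successively_Cons successively_append_iff)
      have dis: "set P \<inter> set (c # W @ d # U) = {}" using eP(2) S by blast
      let ?p = "W @ [d] @ rev P @ [c] @ rev U"
      have "path ?p"
        using eP U ne dis Ecomm
        by (auto simp: path_def successively_Cons successively_append_iff hd_rev last_rev)
      moreover have "set ?p = set P \<union> set C" unfolding S[symmetric] by auto
      moreover have "set P \<union> set C \<subseteq> V" "set C \<subset> set P \<union> set C"
        using eP(2) hd_in_set[OF eP(5)] CV by blast+
      moreover have "hd W \<noteq> hd U" using ne U(5) by (cases W; cases U) auto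
      then have "J (hd ?p) (last ?p)" using h ne by (auto simp: J_def last_rev)
      ultimately show False using big[of ?p] by simp
    qed
  qed
  then show ?thesis using that cyC CV by blast
qed

end

section \<open>Many heavy vertices\<close>

context claw_Z2_heavy_graph
begin

text \<open>Adjacent heavy vertices have a common neighbour. Nonadjacent ones have three: two of
  these are adjacent, or the claw at \<open>u\<close> makes one of them heavy, and it is adjacent to
  the heavy \<open>u\<close>.\<close>

lemma triangle_if_two_heavy:
  assumes "u \<in> H" "v \<in> H" "u \<noteq> v"
  shows "has_cycle V E 3"
proof -
  have tri: "has_cycle V E 3" if "E a b" "E b c" "E a c" for a b c
  proof -
    have "cyc E [a, b, c]" using that Esym Eneq by (auto simp: cyc_def)
    then show ?thesis using has_cycle_if_cyc cyc_subset_V by (metis length_Cons list.size(3) numeral_3_eq_3)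
  qed
  have adj: "has_cycle V E 3" if ab: "a \<in> H" "b \<in> H" "E a b" for a b
  proof -
    obtain w where "E a w" "E b w" using common_neighbour[OF ab(1,2)] .
    then show ?thesis using tri[of a b w] ab by blast
  qed
  show ?thesis
  proof (cases "E u v")
    case False
    then obtain ys where ys: "ys \<subseteq> nb u \<inter> nb v" "card ys = 3"
      using common_if_nonadjacent[OF assms(1,2) False assms(3)] by (metis obtain_subset_with_card_n)
    then obtain y1 y2 y3 where y: "ys = {y1, y2, y3}" "y1 \<noteq> y2" "y1 \<noteq> y3" "y2 \<noteq> y3"
      by (auto simp: card_3_iff)
    then have "E u y1" "E u y2" "E u y3" using ys by auto
    then show ?thesis
      using claw[of u y1 y2 y3] tri[of u y1 y2] tri[of u y1 y3] tri[of u y2 y3] adj[OF assms(1)] y by blast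
  qed (use adj assms in blast)
qed

text \<open>Length three is left to \<open>triangle_if_two_heavy\<close>, since nonadjacent ends
  give lengths only from four on.\<close>

lemma cycles_from_heavy_path:
  assumes p: "path p" "set p \<subseteq> V"
    and sum: "length p + 1 \<le> card (nb (hd p) \<inter> set p) + card (nb (last p) \<inter> set p)"
    and k: "4 \<le> k" "k \<le> length p"
  shows "has_cycle V E k"
proof -
  have "\<exists>xs. cyc E xs \<and> set xs \<subseteq> set p \<and> length xs = k"
  proof (cases "E (hd p) (last p)")
    case True
    then show ?thesis using cyc_all_if_adjacent_ends[OF p(1) refl, of k] k sum by simp
  next
    case False
    then show ?thesis using cyc_all_if_nonadjacent_ends[OF p(1) k False] sum by simp
  qed
  then show ?thesis using has_cycle_if_cyc p(2) by blast
qed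

end

section \<open>Heavy vertices and their successors on a Hamiltonian cycle\<close>

definition next_in :: "'a list \<Rightarrow> 'a \<Rightarrow> 'a" where
  "next_in C u = hd (tl (dropWhile (\<lambda>z. z \<noteq> u) C @ takeWhile (\<lambda>z. z \<noteq> u) C))"

lemma next_in_append:
  assumes "distinct (as @ u # bs)"
  shows "next_in (as @ u # bs) u = hd (bs @ as)"
proof -
  have "\<forall>z\<in>set as. z \<noteq> u" using assms by auto
  then have "takeWhile (\<lambda>z. z \<noteq> u) (as @ u # bs) = as" "dropWhile (\<lambda>z. z \<noteq> u) (as @ u # bs) = u # bs"
    by (simp_all add: takeWhile_append2 dropWhile_append2)
  then show ?thesis by (simp add: next_in_def)
qed

locale many_heavy = claw_Z2_heavy_graph +
  assumes conn: "two_connected V E" and not_pan: "\<not> pancyclic V E" and H4: "4 \<le> card H"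
begin

lemma cards: "4 \<le> card V"
  using H4 card_mono[OF finV H_V] by simp

lemma triangle: "has_cycle V E 3"
proof -
  obtain T where "T \<subseteq> H" "card T = 2" using H4 obtain_subset_with_card_n[of 2 H] by auto
  then obtain u v where "u \<in> H" "v \<in> H" "u \<noteq> v" by (auto simp: card_2_iff)
  then show ?thesis by (rule triangle_if_two_heavy)
qed

lemma no_heavy_ham_path:
  assumes p: "path p" "set p = V" and h: "hd p \<in> H" "last p \<in> H"
  shows False
proof -
  have len: "length p = card V" using p by (metis distinct_card path_def)
  have "nb x \<inter> set p = nb x" for x using nb_V p by auto
  then have "length p + 1 \<le> card (nb (hd p) \<inter> set p) + card (nb (last p) \<inter> set p)"
    using heavy_sum[OF h] len by simp
  then have "has_cycle V E k" if "4 \<le> k" "k \<le> card V" for k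
    using cycles_from_heavy_path[OF p(1)] that p len by simp
  moreover have "k = 3 \<or> 4 \<le> k" if "3 \<le> k" for k :: nat using that by auto
  ultimately have "pancyclic V E" using triangle unfolding pancyclic_def by blast
  then show False using not_pan by simp
qed

text \<open>Only the last end can see \<open>t\<close>, so the degree sum inside the path is at
  least n, still one more than the length of the path. Length n itself comes from
  \<open>C\<close>.\<close>

lemma no_heavy_near_ham_path:
  assumes C: "cyc E C" "set C = V" and p: "path p" "set p = V - {t}" "t \<in> V"
    and h: "hd p \<in> H" "last p \<in> H" "\<not> E (hd p) t"
  shows False
proof -
  have len: "length p = card V - 1"
    using p finV distinct_card[of p] by (simp add: path_def)
  have "nb (hd p) \<inter> set p = nb (hd p)" using nb_V p h by auto
  moreover have "nb (last p) \<subseteq> insert t (nb (last p) \<inter> set p)" using nb_V p by auto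
  then have "card (nb (last p)) \<le> card (insert t (nb (last p) \<inter> set p))" by (intro card_mono) auto
  then have "card (nb (last p)) \<le> card (nb (last p) \<inter> set p) + 1"
    by (simp add: card_insert_if split: if_splits)
  ultimately have "length p + 1 \<le> card (nb (hd p) \<inter> set p) + card (nb (last p) \<inter> set p)"
    using heavy_sum[OF h(1,2)] len cards by simp
  then have "has_cycle V E k" if "4 \<le> k" "k \<le> card V - 1" for k
    using cycles_from_heavy_path[OF p(1)] that p len by auto
  moreover have "length C = card V" using C by (metis cyc_def distinct_card)
  then have "has_cycle V E (card V)" using has_cycle_if_cyc[OF C(1)] C(2) by simp
  moreover have "k = 3 \<or> 4 \<le> k \<and> k \<le> card V - 1 \<or> k = card V" if "3 \<le> k" "k \<le> card V" for k
    using that by auto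
  ultimately have "pancyclic V E" using triangle unfolding pancyclic_def by blast
  then show False using not_pan by simp
qed

text \<open>If the cycle neighbours of \<open>u\<close> were adjacent, the rest would be a cycle of
  length n - 1 of which \<open>u\<close> sees more than half. If one were heavy, a Hamiltonian path
  would join it to \<open>u\<close>.\<close>

lemma heavy_neighbours_on_cycle:
  assumes C: "cyc E (u # Z)" "set (u # Z) = V" and u: "u \<in> H"
  shows "\<not> E (hd Z) (last Z)" "hd Z \<notin> H" "last Z \<notin> H"
proof -
  have f: "E u (hd Z)" "E (last Z) u" "successively E Z" "Z \<noteq> []" "u \<notin> set Z" "distinct Z"
    using C(1) by (auto simp: cyc_def successively_Cons split: if_splits)
  have "card (set (u # Z)) = card V" using C(2) by simp
  then have len: "length Z = card V - 1" using f by (simp add: distinct_card)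
  show "\<not> E (hd Z) (last Z)"
  proof
    assume a: "E (hd Z) (last Z)"
    then have "cyc E Z" using f len cards Esym by (auto simp: cyc_def)
    moreover have "nb u \<inter> set Z = nb u" using nb_V Eirr C(2) by fastforce
    then have "length Z < 2 * card (nb u \<inter> set Z)" using u len cards by (simp add: H_def)
    ultimately have "\<exists>ys. cyc E ys \<and> set ys \<subseteq> insert u (set Z) \<and> length ys = k"
      if "3 \<le> k" "k \<le> card V" for k
      using cyc_all_if_many_neighbours[of Z u "length Z" k] f len cards that by simp
    then have "pancyclic V E"
      unfolding pancyclic_def using has_cycle_if_cyc C(2) by (metis list.simps(15))
    then show False using not_pan by simp
  qed
  have "path (Z @ [u])" "path (u # Z)"
    using f by (auto simp: path_def successively_Cons successively_append_iff)
  then show "hd Z \<notin> H" "last Z \<notin> H"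
    using no_heavy_ham_path[of "Z @ [u]"] no_heavy_ham_path[of "u # Z"] C(2) u f by auto
qed

text \<open>The cycle neighbours of \<open>u\<close> are light and nonadjacent, so \<open>y\<close>
  cannot complete them to an induced claw at \<open>u\<close>.\<close>

lemma beside_heavy:
  assumes C: "cyc E (u # Z)" "set (u # Z) = V" and u: "u \<in> H" and y: "E u y"
  shows "y = hd Z \<or> y = last Z \<or> E y (hd Z) \<or> E y (last Z)"
proof (rule ccontr)
  assume n: "\<not> ?thesis"
  have f: "E u (hd Z)" "E u (last Z)" "2 \<le> length Z" "distinct Z"
    using C(1) Esym by (auto simp: cyc_def successively_Cons split: if_splits)
  then have "hd Z \<noteq> last Z" by (cases Z) (auto split: if_splits)
  then show False
    using claw[of u "hd Z" "last Z" y] heavy_neighbours_on_cycle[OF C u] f y n Ecomm by metis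
qed

text \<open>The chord between the successors would give the Hamiltonian path
  \<open>u # rev Q @ P @ [g]\<close> with heavy ends.\<close>

lemma successors_nonadjacent:
  assumes C: "cyc E (u # P @ g # Q)" "set (u # P @ g # Q) = V" and h: "u \<in> H" "g \<in> H"
  shows "P \<noteq> []" "Q \<noteq> []" "\<not> E (hd P) (hd Q)"
proof -
  have C': "cyc E (g # Q @ u # P)" "set (g # Q @ u # P) = V"
    using cyc_rotate_append[of E "u # P" "g # Q"] C by auto
  show ne: "P \<noteq> []" "Q \<noteq> []"
    using heavy_neighbours_on_cycle(2)[OF C h(1)] heavy_neighbours_on_cycle(2)[OF C' h(2)] h by auto
  have f: "E (last Q) u" "E (last P) g" "successively E P" "successively E Q" "distinct (u # P @ g # Q)"
    using C(1) ne by (auto simp: cyc_def successively_Cons successively_append_iff)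
  show "\<not> E (hd P) (hd Q)"
  proof
    assume "E (hd P) (hd Q)"
    then have "path (u # rev Q @ P @ [g])"
      using f ne Ecomm by (auto simp: path_def successively_Cons successively_append_iff hd_rev last_rev)
    moreover have "set (u # rev Q @ P @ [g]) = V" unfolding C(2)[symmetric] by auto
    ultimately show False using no_heavy_ham_path[of "u # rev Q @ P @ [g]"] h by simp
  qed
qed

text \<open>If \<open>S2\<close> has two vertices or more, then its ends and \<open>y\<close> form a triangle, and \<open>Z\<^sub>2\<close>-heaviness
  makes \<open>y\<close> adjacent to each vertex of \<open>S1\<close> in turn; otherwise omit the only vertex of \<open>S2\<close>.\<close>

lemma not_both_successors:
  assumes C: "cyc E (u # S1 @ h # S2 @ y # S3)" "set (u # S1 @ h # S2 @ y # S3) = V"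
    and uh: "u \<in> H" "h \<in> H" and S2: "S2 \<noteq> []"
    and y: "E y u" "E y (hd S1)" "E y h" "E y (hd S2)"
  shows False
proof -
  note hp = no_heavy_ham_path
  have rot: "cyc E (h # S2 @ y # S3 @ u # S1)" "set (h # S2 @ y # S3 @ u # S1) = V"
    using cyc_rotate_append[of E "u # S1" "h # S2 @ y # S3"] C by auto
  have S1: "S1 \<noteq> []" using successors_nonadjacent(1)[OF C uh] .
  have S3: "S3 \<noteq> []"
    using heavy_neighbours_on_cycle(1)[OF C uh(1)] S1 y(2) Ecomm by auto
  have s: "successively E S1" "successively E S2" "successively E S3" "distinct (u # S1 @ h # S2 @ y # S3)"
    "E u (hd S1)" "E (last S1) h" "E h (hd S2)" "E (last S2) y" "E y (hd S3)" "E (last S3) u"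
    using C(1) S1 S2 S3 by (auto simp: cyc_def successively_Cons successively_append_iff)
  \<comment> \<open>The letters follow the cycle: \<open>a\<close>, \<open>b\<close> are the ends of
    \<open>S1\<close>, \<open>c\<close>, \<open>d\<close> those of \<open>S2\<close> and
    \<open>e\<close>, \<open>f\<close> those of \<open>S3\<close>.\<close>
  define a b c d e f where "a = hd S1" and "b = last S1" and "c = hd S2" and "d = last S2"
    and "e = hd S3" and "f = last S3"
  note defs = a_def b_def c_def d_def e_def f_def
  have mem: "a \<in> set S1" "b \<in> set S1" "c \<in> set S2" "d \<in> set S2" "e \<in> set S3" "f \<in> set S3"
    using S1 S2 S3 by (auto simp: defs)
  note edges = s(5-10)[folded defs] y[folded defs]
  have path_from_edges: "path q \<Longrightarrow> hd q \<in> H \<Longrightarrow> last q \<in> H \<Longrightarrow> set q = set (u # S1 @ h # S2 @ y # S3) \<Longrightarrow> False" for q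
    using hp[of q] C(2) by simp
  have light: "a \<notin> H" "c \<notin> H"
    using heavy_neighbours_on_cycle(2)[OF C uh(1)] heavy_neighbours_on_cycle(2)[OF rot uh(2)] S1 S2
    by (auto simp: defs)
  have ac: "\<not> E a c" using successors_nonadjacent(3)[OF C uh] S1 S2 by (simp add: defs)
  have de: "\<not> E d e"
  proof
    assume "E d e"
    then have "path (u # rev S3 @ rev S2 @ y # S1 @ [h])"
      using s S1 S2 S3 y Ecomm
      by (auto simp: path_def successively_Cons successively_append_iff hd_rev last_rev defs)
    then show False by (rule path_from_edges) (use uh in auto)
  qed
  have ad: "\<not> E a d"
  proof
    assume "E a d"
    then have "path (u # rev S3 @ y # S2 @ S1 @ [h])"
      using s S1 S2 S3 y Ecomm
      by (auto simp: path_def successively_Cons successively_append_iff hd_rev last_rev defs)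
    then show False by (rule path_from_edges) (use uh in auto)
  qed
  have ce: "\<not> E c e"
  proof
    assume "E c e"
    then have "path (u # rev S3 @ S2 @ y # S1 @ [h])"
      using s S1 S2 S3 y Ecomm
      by (auto simp: path_def successively_Cons successively_append_iff hd_rev last_rev defs)
    then show False by (rule path_from_edges) (use uh in auto)
  qed
  \<comment> \<open>A heavy \<open>d\<close> would have the successor \<open>y\<close>, which sees
    the successor \<open>a\<close> of \<open>u\<close>.\<close>
  have d: "d \<notin> H"
  proof
    assume dH: "d \<in> H"
    have "S2 = butlast S2 @ [d]" using S2 by (simp add: d_def)
    then have eq: "u # S1 @ h # S2 @ y # S3 = u # (S1 @ h # butlast S2) @ d # y # S3"
      by (metis append.assoc append_Cons append_Nil)
    have "\<not> E (hd (S1 @ h # butlast S2)) (hd (y # S3))"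
      by (rule successors_nonadjacent(3)[OF C[unfolded eq] uh(1) dH])
    then show False using S1 y(2) Ecomm by auto
  qed
  have neq: "a \<noteq> d" "a \<noteq> e" "d \<noteq> e" "c \<noteq> e" "a \<noteq> c"
    using s(4) mem by auto
  have yd: "E y d" using edges Ecomm by blast
  \<comment> \<open>Otherwise \<open>a\<close>, \<open>d\<close>, \<open>e\<close> are the leaves of
    an induced claw at \<open>y\<close> with \<open>a\<close> and \<open>d\<close> light.\<close>
  have ae: "E a e"
    using claw[of y d a e] claw[of y a d e] light d ad de neq edges yd Ecomm by metis
  show False
  proof (cases "c = d")
    case True
    then have S2c: "S2 = [c]"
      using s(4) S2 by (cases S2) (auto simp: defs split: if_splits)
    \<comment> \<open>The path that omits \<open>c\<close> needs an end that does not see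
      \<open>c\<close>.\<close>
    have "\<not> E u c"
    proof
      assume "E u c"
      then have "c = a \<or> c = f \<or> E c a \<or> E c f"
        using beside_heavy[OF C uh(1), of c] S1 S3 by (simp add: defs)
      then have "E c f" using ac neq mem s(4) Ecomm by auto
      then have "path (h # rev S1 @ S3 @ [c, y, u])"
        using s S1 S2c S3 y ae Ecomm
        by (auto simp: path_def successively_Cons successively_append_iff hd_rev last_rev a_def e_def f_def)
      then show False by (rule path_from_edges) (use uh S2c in auto)
    qed
    moreover have "path (u # rev S3 @ y # S1 @ [h])"
      using s S1 S3 y Ecomm
      by (auto simp: path_def successively_Cons successively_append_iff hd_rev last_rev)
    moreover have "set (u # rev S3 @ y # S1 @ [h]) = V - {c}"
      using s(4) unfolding C(2)[symmetric] S2c by auto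
    moreover have "c \<in> V" unfolding C(2)[symmetric] using mem by auto
    ultimately show False
      using no_heavy_near_ham_path[OF C, of "u # rev S3 @ y # S1 @ [h]" c] uh by simp
  next
    case cd: False
    have "E c d" using claw[of y c d e] light d cd ce de neq edges yd by metis
    \<comment> \<open>Since \<open>a\<close> sees \<open>e\<close> and \<open>y\<close> sees the
      last vertex of \<open>A\<close>, the part \<open>A\<close> can be moved, reversed, between
      \<open>y\<close> and \<open>S3\<close>. This makes \<open>w\<close> available as the start of
      the remaining part of \<open>S1\<close>.\<close>
    have run: "\<not> E w c \<and> \<not> E w d \<and> (B \<noteq> [] \<longrightarrow> w \<notin> H)"
      if S1': "S1 = A @ w # B" and A: "A = [] \<or> E y (last A)" for A w B
    proof -
      have t: "successively E (rev A @ S3)" "E y (hd (rev A @ S3))" "successively E (w # B)"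
        "last (w # B) = b"
        using s S3 A S1' ae Ecomm
        by (cases "A = []"; auto simp: successively_append_iff hd_rev last_rev defs)+
      have start: "successively E (h # rev B @ [w])"
        using t(3,4) edges(2) Ecomm by (cases "B = []") (auto simp: successively_Cons successively_append_iff hd_rev last_rev)
      have S1s: "set S1 = set A \<union> {w} \<union> set B" using S1' by auto
      have dis: "distinct (u # (A @ w # B) @ h # S2 @ y # S3)" using s(4) S1' by simp
      define X Q where "X = h # rev B @ [w]" and "Q = rev A @ S3"
      have X: "successively E X" "X \<noteq> []" "hd X = h" "last X = w"
        using start by (simp_all add: X_def)
      have Q: "successively E Q" "Q \<noteq> []" "E y (hd Q)" "E (last Q) u"
        using t(1,2) S3 s(10) by (simp_all add: Q_def)
      have "\<not> E w c"
      proof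
        assume "E w c"
        then have "successively E (X @ S2 @ y # Q @ [u])"
          using X Q s(2,8) S2 by (simp add: successively_append_iff successively_Cons c_def)
        moreover have "distinct (X @ S2 @ y # Q @ [u])" using dis unfolding X_def Q_def by auto
        ultimately have "path (X @ S2 @ y # Q @ [u])" by (simp add: path_def)
        then show False
          by (rule path_from_edges) (use uh S1s X in \<open>auto simp: X_def Q_def\<close>)
      qed
      moreover have "\<not> E w d"
      proof
        assume "E w d"
        then have "successively E (X @ rev S2 @ y # Q @ [u])"
          using X Q s(2) Esym[OF y(4)] S2
          by (simp add: successively_append_iff successively_Cons d_def hd_rev last_rev)
        moreover have "distinct (X @ rev S2 @ y # Q @ [u])" using dis unfolding X_def Q_def by auto
        ultimately have "path (X @ rev S2 @ y # Q @ [u])" by (simp add: path_def)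
        then show False
          by (rule path_from_edges) (use uh S1s X in \<open>auto simp: X_def Q_def\<close>)
      qed
      moreover have "w \<notin> H" if "B \<noteq> []"
      proof
        assume "w \<in> H"
        define Y where "Y = w # B"
        have Y: "successively E Y" "Y \<noteq> []" "hd Y = w" "E (last Y) h"
          using t(3,4) edges(2) by (simp_all only: Y_def list.sel) simp_all
        have "successively E (Y @ h # S2 @ y # Q @ [u])"
          using Y Q s(2,7,8) S2 by (simp add: successively_append_iff successively_Cons)
        moreover have "distinct (Y @ h # S2 @ y # Q @ [u])" using dis unfolding Y_def Q_def by auto
        ultimately have "path (Y @ h # S2 @ y # Q @ [u])" by (simp add: path_def)
        then show False
          by (rule path_from_edges) (use uh S1s Y \<open>w \<in> H\<close> in \<open>auto simp: Y_def Q_def\<close>)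
      qed
      ultimately show ?thesis by blast
    qed
    \<comment> \<open>If \<open>y\<close> saw \<open>z\<close> but not its successor
      \<open>w\<close>, the triangle \<open>c\<close>, \<open>d\<close>, \<open>y\<close> and the
      path \<open>y\<close>, \<open>z\<close>, \<open>w\<close> would be an induced
      \<open>Z\<^sub>2\<close> with \<open>c\<close> and \<open>z\<close> both light.\<close>
    have all: "E y w" if "S1 = A @ w # B" for A w B
      using that
    proof (induction "length A" arbitrary: A w B rule: less_induct)
      case less
      show ?case
      proof (cases A rule: rev_cases)
        case Nil
        then show ?thesis using less.prems edges by (simp add: a_def)
      next
        case A: (snoc A0 z)
        have yz: "E y z" using less.hyps[of A0 z "w # B"] less.prems A by simp
        have A0: "A0 = [] \<or> E y (last A0)"
        proof (cases A0 rule: rev_cases)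
          case (snoc A1 v)
          then show ?thesis using less.hyps[of A1 v "z # w # B"] less.prems A by simp
        qed simp
        have "S1 = A0 @ z # w # B" using less.prems A by simp
        from run[OF this A0] have z: "\<not> E z c" "\<not> E z d" "z \<notin> H" by auto
        have w: "\<not> E w c" "\<not> E w d" using run[OF less.prems] yz A by auto
        have "E z w" using s(1) less.prems A by (auto simp: successively_append_iff)
        then show ?thesis
          using Z2(1)[of c d y z w] \<open>E c d\<close> edges z w yz light Ecomm by metis
      qed
    qed
    have "S1 = butlast S1 @ [b]" using S1 by (simp add: b_def)
    then have "E y b" using all by metis
    then have "path (u # rev S3 @ S1 @ y # rev S2 @ [h])"
      using s S1 S2 S3 y ae Ecomm
      by (auto simp: path_def successively_Cons successively_append_iff hd_rev last_rev defs)
    then show False by (rule path_from_edges) (use uh in auto)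
  qed
qed

text \<open>The two successors are distinct and nonadjacent, so \<open>y\<close> is neither of them
  and sees both. It lies on one of the two arcs, and \<open>u\<close> and \<open>h\<close> are
  exchanged accordingly.\<close>

lemma not_both_next:
  assumes C: "cyc E C" "set C = V" and uh: "u \<in> H" "h \<in> H" "u \<noteq> h" and y: "E y u" "E y h"
    and n: "y = next_in C u \<or> E y (next_in C u)" "y = next_in C h \<or> E y (next_in C h)"
  shows False
proof -
  have dC: "distinct C" using C by (simp add: cyc_def)
  have ordered: False
    if split: "C = A @ u # B @ h # D" and uh: "u \<in> H" "h \<in> H" and y: "E y u" "E y h"
      and n: "y = next_in C u \<or> E y (next_in C u)" "y = next_in C h \<or> E y (next_in C h)" for u h A B D
  proof -
    define T where "T = D @ A"
    have cy: "cyc E (u # B @ h # T)" "set (u # B @ h # T) = V"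
      using cyc_rotate_append[of E A "u # B @ h # D"] C split by (auto simp: T_def)
    have cy': "cyc E (h # T @ u # B)" "set (h # T @ u # B) = V"
      using cyc_rotate_append[of E "u # B" "h # T"] cy by auto
    note sn = successors_nonadjacent[OF cy uh]
    have "next_in C u = hd B" "next_in C h = hd T"
      using next_in_append[of A u "B @ h # D"] next_in_append[of "A @ u # B" h D] dC split sn
      by (auto simp: T_def hd_append)
    then have n': "y = hd B \<or> E y (hd B)" "y = hd T \<or> E y (hd T)" using n by simp_all
    have d: "distinct (u # B @ h # T)" using cy by (simp add: cyc_def)
    have "hd B \<noteq> hd T" using d sn by (cases B; cases T) auto
    then have yE: "E y (hd B)" "E y (hd T)" using n' sn(3) Ecomm by metis+
    then have yn: "y \<noteq> hd B" "y \<noteq> hd T" "y \<noteq> u" "y \<noteq> h" using y Eirr by metis+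
    have "y \<in> set (u # B @ h # T)" unfolding cy(2) using y EV by blast
    then consider "y \<in> set B" | "y \<in> set T" using yn by auto
    then show False
    proof cases
      case 1
      then obtain S2 S3 where S: "B = S2 @ y # S3" by (meson split_list)
      then have "S2 \<noteq> []" using yn by auto
      then show False
        using not_both_successors[of h T u S2 y S3] cy' uh y yE S by simp
    next
      case 2
      then obtain S2 S3 where S: "T = S2 @ y # S3" by (meson split_list)
      then have "S2 \<noteq> []" using yn by auto
      then show False
        using not_both_successors[of u B h S2 y S3] cy uh y yE S by simp
    qed
  qed
  have "u \<in> set C" "h \<in> set C" using uh H_V C(2) by auto
  then obtain as bs where 1: "C = as @ u # bs" by (meson split_list)
  with \<open>h \<in> set C\<close> uh(3) consider "h \<in> set as" | "h \<in> set bs" by auto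
  then show False
  proof cases
    case 1
    then obtain xs ys where "as = xs @ h # ys" by (meson split_list)
    then have "C = xs @ h # ys @ u # bs" using \<open>C = as @ u # bs\<close> by simp
    from ordered[OF this uh(2,1) y(2,1) n(2,1)] show False .
  next
    case 2
    then obtain xs ys where "bs = xs @ h # ys" by (meson split_list)
    then have "C = as @ u # xs @ h # ys" using 1 by simp
    from ordered[OF this uh(1,2) y n] show False .
  qed
qed

text \<open>By \<open>beside_heavy\<close> each heavy neighbour of \<open>y\<close> has a cycle
  neighbour that \<open>y\<close> equals or sees. Among three heavy neighbours this happens twice on
  the successor side or twice on the predecessor side, which is the successor side of
  \<open>rev C\<close>.\<close>

lemma at_most_two_heavy_neighbours:
  assumes C: "cyc E C" "set C = V"
  shows "card (nb y \<inter> H) \<le> 2"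
proof (rule ccontr)
  assume "\<not> ?thesis"
  then obtain T where "T \<subseteq> nb y \<inter> H" "card T = 3"
    by (metis not_less_eq_eq numeral_2_eq_2 numeral_3_eq_3 obtain_subset_with_card_n)
  then obtain u1 u2 u3 where u: "u1 \<in> H" "u2 \<in> H" "u3 \<in> H" "E y u1" "E y u2" "E y u3"
    "u1 \<noteq> u2" "u1 \<noteq> u3" "u2 \<noteq> u3"
    by (auto simp: card_3_iff)
  have R: "cyc E (rev C)" "set (rev C) = V" using C cyc_rev' by auto
  have side: "(y = next_in C u \<or> E y (next_in C u)) \<or> (y = next_in (rev C) u \<or> E y (next_in (rev C) u))"
    if "u \<in> H" "E y u" for u
  proof -
    have "u \<in> set C" using that H_V C by auto
    then obtain as bs where s: "C = as @ u # bs" by (meson split_list)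
    have d: "distinct C" using C by (simp add: cyc_def)
    have cy: "cyc E (u # bs @ as)" "set (u # bs @ as) = V"
      using cyc_rotate_append[of E as "u # bs"] C s by auto
    have ne: "bs @ as \<noteq> []" using cy by (auto simp: cyc_def)
    have "next_in C u = hd (bs @ as)" using next_in_append[of as u bs] d s by simp
    moreover have "next_in (rev C) u = last (bs @ as)"
    proof -
      have "distinct (rev bs @ u # rev as)" using d s by auto
      from next_in_append[OF this] show ?thesis using s hd_rev[of "bs @ as"] by simp
    qed
    ultimately show ?thesis using beside_heavy[OF cy that(1)] that(2) Esym by metis
  qed
  note n = not_both_next[OF C] not_both_next[OF R]
  show False
    using side[OF u(1,4)] side[OF u(2,5)] side[OF u(3,6)]
      n(1)[OF u(1,2,7,4,5)] n(1)[OF u(1,3,8,4,6)] n(1)[OF u(2,3,9,5,6)]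
      n(2)[OF u(1,2,7,4,5)] n(2)[OF u(1,3,8,4,6)] n(2)[OF u(2,3,9,5,6)] by argo
qed

lemma contradiction: False
proof -
  obtain C where C: "cyc E C" "set C = V" using hamiltonian[OF conn] H4 by auto
  have "(\<Sum>u\<in>H. card (nb u)) = (\<Sum>u\<in>H. \<Sum>y\<in>V. if E u y then 1 else 0)"
  proof (rule sum.cong)
    fix u
    have "(\<Sum>y\<in>V. if E u y then 1 else 0 :: nat) = card (V \<inter> {y. E u y})"
      using finV by (simp add: sum.If_cases)
    also have "V \<inter> {y. E u y} = nb u" using EV2 by auto
    finally show "card (nb u) = (\<Sum>y\<in>V. if E u y then 1 else 0)" by simp
  qed simp
  also have "\<dots> = (\<Sum>y\<in>V. \<Sum>u\<in>H. if E u y then 1 else 0)" by (rule sum.swap)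
  also have "\<dots> = (\<Sum>y\<in>V. card (nb y \<inter> H))"
  proof (rule sum.cong)
    fix y
    have "(\<Sum>u\<in>H. if E u y then 1 else 0 :: nat) = card (H \<inter> {u. E u y})"
      by (simp add: sum.If_cases)
    also have "H \<inter> {u. E u y} = nb y \<inter> H" using Ecomm by auto
    finally show "(\<Sum>u\<in>H. if E u y then 1 else 0) = card (nb y \<inter> H)" .
  qed simp
  also have "\<dots> \<le> (\<Sum>y\<in>V. 2)"
    by (rule sum_mono) (use at_most_two_heavy_neighbours[OF C] in simp)
  finally have le: "(\<Sum>u\<in>H. card (nb u)) \<le> 2 * card V" by simp
  have "card H * (card V + 1) \<le> (\<Sum>u\<in>H. 2 * card (nb u))"
    using sum_bounded_below[of H "card V + 1" "\<lambda>u. 2 * card (nb u)"] by (simp add: H_def)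
  also have "\<dots> = 2 * (\<Sum>u\<in>H. card (nb u))" by (simp add: sum_distrib_left)
  finally have "card H * (card V + 1) \<le> 4 * card V" using le by simp
  moreover have "4 * (card V + 1) \<le> card H * (card V + 1)" using H4 by (rule mult_le_mono1)
  ultimately show False by simp
qed

end

section \<open>Initial cycles\<close>

context finite_graph
begin

lemma neighbour_if_connected:
  assumes "connected_on S E" "x \<in> S" "w \<in> S" "x \<noteq> w"
  obtains y where "y \<in> S" "E x y"
proof -
  obtain p where "path_between S E x w p" using assms by (auto simp: connected_on_def)
  then have p: "p \<noteq> []" "set p \<subseteq> S" "successively E p" "hd p = x" "last p = w"
    by (auto simp: path_between_def is_path_iff)
  then obtain y p' where "p = x # y # p'"
    using assms(4) by (cases p; cases "tl p") auto
  then show ?thesis using that[of y] p by auto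
qed

text \<open>Removing the first neighbour leaves the graph connected, so \<open>x\<close> has another
  one.\<close>

lemma two_neighbours:
  assumes "two_connected V E" "x \<in> V"
  obtains y z where "E x y" "E x z" "y \<noteq> z"
proof -
  have pick: "\<exists>w\<in>V. w \<notin> A" if "finite A" "card A \<le> 2" for A
  proof (rule ccontr)
    assume "\<not> ?thesis"
    then have "card V \<le> card A" using that by (intro card_mono) auto
    then show False using assms that by (simp add: two_connected_def)
  qed
  obtain w where w: "w \<in> V" "w \<noteq> x" using pick[of "{x}"] by auto
  obtain y where y: "E x y"
    using neighbour_if_connected[of V x w] assms w by (auto simp: two_connected_def)
  have "card {x, y} \<le> 2" by (simp add: card_insert_if)
  then obtain v where v: "v \<in> V" "v \<noteq> x" "v \<noteq> y" using pick[of "{x, y}"] by auto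
  have "connected_on (V - {y}) E" using assms y EV2 by (auto simp: two_connected_def)
  then obtain z where "z \<in> V - {y}" "E x z"
    using neighbour_if_connected[of "V - {y}" x v] assms v y Eneq by blast
  then show ?thesis using that[of y z] y by auto
qed

lemma cycle_if_two_connected:
  assumes "two_connected V E"
  obtains C where "cyc E C"
proof -
  have "V \<noteq> {}" using assms by (auto simp: two_connected_def)
  then obtain x where x: "x \<in> V" by auto
  obtain y z where yz: "E x y" "E x z" "y \<noteq> z" using two_neighbours[OF assms x] .
  have "connected_on (V - {x}) E" "y \<in> V - {x}" "z \<in> V - {x}"
    using assms x yz EV2 Eneq by (auto simp: two_connected_def)
  then obtain p where "path_between (V - {x}) E y z p" by (auto simp: connected_on_def)
  then have p: "p \<noteq> []" "distinct p" "set p \<subseteq> V - {x}" "successively E p" "hd p = y" "last p = z"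
    by (auto simp: path_between_def is_path_iff)
  then have "2 \<le> length p" using yz by (cases p; cases "tl p") auto
  then have "cyc E (x # p)" using p yz Esym by (auto simp: cyc_def successively_Cons)
  then show ?thesis using that by blast
qed

lemma successively_in_closed_set:
  "successively E xs \<Longrightarrow> xs \<noteq> [] \<Longrightarrow> hd xs \<in> S \<Longrightarrow> (\<And>c. c \<in> S \<Longrightarrow> nb c \<subseteq> S) \<Longrightarrow> set xs \<subseteq> S"
proof (induction xs rule: induct_list012)
  case (3 x y zs)
  then have x: "x \<in> S" "E x y" "successively E (y # zs)" by simp_all
  then have "y \<in> S" using 3(6)[OF x(1)] in_nb[of y x] by blast
  then have "set (y # zs) \<subseteq> S" using 3(2)[OF x(3)] 3(6) by simp
  then show ?case using x(1) by simp
qed auto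

text \<open>The edges of a cycle use up the degrees of its vertices, so its vertex set is closed
  under neighbours and, by connectedness, is all of \<open>V\<close>.\<close>

lemma cycle_graph_if_degree_2:
  assumes conn: "two_connected V E" and deg2: "\<And>x. card (nb x) \<le> 2"
  shows "is_cycle_graph V E"
proof -
  obtain C where C: "cyc E C" using cycle_if_two_connected[OF conn] .
  define n where "n = length C"
  have n: "3 \<le> n" "distinct C" using C by (auto simp: cyc_def n_def)
  have CV: "set C \<subseteq> V" using cyc_subset_V[OF C] .
  \<comment> \<open>\<open>(i + n - 1) mod n\<close> is the cyclic predecessor, written so that
    nothing is subtracted from zero.\<close>
  have nbs: "nb (C ! i) = {C ! ((i + 1) mod n), C ! ((i + n - 1) mod n)}" if "i < n" for i
  proof -
    have lt: "(i + 1) mod n < n" "(i + n - 1) mod n < n" using n by auto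
    have eq: "((i + n - 1) mod n + 1) mod n = i"
      using that n by (simp add: mod_Suc_eq)
    have "(i + 1) mod n \<noteq> (i + n - 1) mod n"
    proof
      assume "(i + 1) mod n = (i + n - 1) mod n"
      then have "((i + 1) mod n + 1) mod n = i" using eq by simp
      then have "(i + 2) mod n = i" by (simp add: mod_Suc_eq)
      then show False using that n by (cases "i + 2 < n") (auto simp: mod_if split: if_splits)
    qed
    then have "C ! ((i + 1) mod n) \<noteq> C ! ((i + n - 1) mod n)"
      using nth_eq_iff_index_eq[OF n(2)] lt by (simp add: n_def)
    moreover have "{C ! ((i + 1) mod n), C ! ((i + n - 1) mod n)} \<subseteq> nb (C ! i)"
      using cyc_nth[OF C, of i] cyc_nth[OF C, of "(i + n - 1) mod n"] that lt eq Esym by (auto simp: n_def)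
    ultimately show ?thesis
      using deg2[of "C ! i"] card_seteq[OF fin_nb, of "{C ! ((i + 1) mod n), C ! ((i + n - 1) mod n)}" "C ! i"]
      by simp
  qed
  have nbC: "nb c \<subseteq> set C" if c: "c \<in> set C" for c
  proof -
    obtain i where "i < n" "c = C ! i" using c by (auto simp: n_def in_set_conv_nth)
    moreover have "C ! (j mod n) \<in> set C" for j using n by (simp add: n_def flip: length_greater_0_conv)
    ultimately show ?thesis using nbs[of i] by simp
  qed
  have "V \<subseteq> set C"
  proof
    fix x assume x: "x \<in> V"
    have "C ! 0 \<in> set C" by (rule nth_mem) (use n(1) n_def in linarith)
    then have "\<exists>p. path_between V E (C ! 0) x p"
      using x conn CV unfolding two_connected_def connected_on_def by blast
    then obtain p where p: "p \<noteq> []" "successively E p" "hd p = C ! 0" "last p = x"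
      by (auto simp: path_between_def is_path_iff)
    have "set p \<subseteq> set C"
      by (rule successively_in_closed_set[OF p(2,1) _ nbC]) (simp_all add: p(3) \<open>C ! 0 \<in> set C\<close>)
    then show "x \<in> set C" using last_in_set[OF p(1)] p(4) by blast
  qed
  have "E u v \<longleftrightarrow> (\<exists>i<length C. {u, v} = {C ! i, C ! ((i + 1) mod length C)})" for u v
  proof
    assume uv: "E u v"
    then have "u \<in> set C" using \<open>V \<subseteq> set C\<close> EV by blast
    then obtain i where i: "i < n" "u = C ! i"
      by (auto simp: n_def in_set_conv_nth)
    then have "v = C ! ((i + 1) mod n) \<or> v = C ! ((i + n - 1) mod n)"
      using nbs[of i] uv in_nb[of v u] by auto
    then show "\<exists>i<length C. {u, v} = {C ! i, C ! ((i + 1) mod length C)}"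
    proof
      assume "v = C ! ((i + 1) mod n)"
      then show ?thesis using i by (auto simp: n_def)
    next
      assume v: "v = C ! ((i + n - 1) mod n)"
      have "((i + n - 1) mod n + 1) mod n = i" using i n by (simp add: mod_Suc_eq)
      then have "{u, v} = {C ! ((i + n - 1) mod n), C ! (((i + n - 1) mod n + 1) mod n)}"
        using i v by auto
      moreover have "(i + n - 1) mod n < n" using n by simp
      ultimately show ?thesis unfolding n_def by blast
    qed
  next
    assume "\<exists>i<length C. {u, v} = {C ! i, C ! ((i + 1) mod length C)}"
    then show "E u v" using cyc_nth[OF C] Esym by (auto simp: doubleton_eq_iff)
  qed
  then show ?thesis
    unfolding is_cycle_graph_def using n CV \<open>V \<subseteq> set C\<close> by (intro exI[of _ C]) (auto simp: n_def)
qed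

section \<open>Short cycles through all heavy vertices\<close>

lemma cyc_has_cycle: "cyc E xs \<Longrightarrow> has_cycle V E (length xs)"
  using has_cycle_if_cyc cyc_subset_V by blast

lemma distinct_common_neighbours:
  assumes "u \<in> H" "v \<in> H" "\<not> E u v" "u \<noteq> v"
  obtains y1 y2 y3 where "E u y1" "E v y1" "E u y2" "E v y2" "E u y3" "E v y3"
    "y1 \<noteq> y2" "y1 \<noteq> y3" "y2 \<noteq> y3"
proof -
  obtain ys where "ys \<subseteq> nb u \<inter> nb v" "card ys = 3"
    using common_if_nonadjacent[OF assms] by (metis obtain_subset_with_card_n)
  then show ?thesis using that by (auto simp: card_3_iff)
qed

lemma cyc4_if_nonadjacent:
  assumes "u \<in> H" "v \<in> H" "\<not> E u v" "u \<noteq> v"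
  shows "\<exists>y z. cyc E [u, y, v, z]"
proof -
  obtain y1 y2 where "E u y1" "E v y1" "E u y2" "E v y2" "y1 \<noteq> y2"
    using distinct_common_neighbours[OF assms] .
  then have "cyc E [u, y1, v, y2]" using assms Eirr Ecomm by (auto simp: cyc_def)
  then show ?thesis by blast
qed

end

context claw_Z2_heavy_graph
begin

text \<open>Since the graph is not a cycle, some vertex has three neighbours, and without heavy
  vertices two of them must be adjacent.\<close>

lemma triangle_if_no_heavy:
  assumes "two_connected V E" "\<not> is_cycle_graph V E" "H = {}"
  obtains C where "cyc E C" "length C = 3"
proof -
  obtain c where "\<not> card (nb c) \<le> 2" using cycle_graph_if_degree_2 assms by blast
  then obtain T where "T \<subseteq> nb c" "card T = 3"
    by (metis not_less_eq_eq numeral_2_eq_2 numeral_3_eq_3 obtain_subset_with_card_n)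
  then obtain x y z where "E c x" "E c y" "E c z" "x \<noteq> y" "x \<noteq> z" "y \<noteq> z"
    by (auto simp: card_3_iff)
  then obtain a b where "E c a" "E c b" "E a b" using claw[of c x y z] assms by blast
  then have "cyc E [c, a, b]" using Esym Eneq by (auto simp: cyc_def)
  then show ?thesis using that by fastforce
qed

text \<open>The neighbours of \<open>u\<close> are light, so among three of them two are adjacent.
  If \<open>u\<close> has only two neighbours, heaviness forces \<open>card V = 3\<close>, and
  deleting \<open>u\<close> leaves a connected pair.\<close>

lemma triangle_at_single_heavy:
  assumes "two_connected V E" "H = {u}"
  obtains C where "cyc E C" "length C = 3" "u \<in> set C"
proof -
  have u: "u \<in> H" "u \<in> V" using assms H_V by auto
  have "\<exists>a b. E u a \<and> E u b \<and> E a b"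
  proof (cases "3 \<le> card (nb u)")
    case True
    then obtain T where "T \<subseteq> nb u" "card T = 3" by (metis obtain_subset_with_card_n)
    then obtain x y z where xyz: "E u x" "E u y" "E u z" "x \<noteq> y" "x \<noteq> z" "y \<noteq> z"
      by (auto simp: card_3_iff)
    then have "x \<notin> H" "y \<notin> H" using assms(2) Eneq[of u x] Eneq[of u y] by simp_all
    then show ?thesis using claw[of u x y z] xyz by blast
  next
    case False
    obtain x y where xy: "E u x" "E u y" "x \<noteq> y" using two_neighbours[OF assms(1) u(2)] .
    have "card V = 3" using False u(1) assms(1) by (simp add: H_def two_connected_def)
    moreover have "{u, x, y} \<subseteq> V" "card {u, x, y} = 3" using xy u EV2 Eneq by auto
    ultimately have V: "V = {u, x, y}" using finV by (metis card_subset_eq)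
    have "connected_on (V - {u}) E" using assms u by (auto simp: two_connected_def)
    moreover have "x \<in> V - {u}" "y \<in> V - {u}"
      using xy EV2 Eneq[of u x] Eneq[of u y] by auto
    ultimately obtain w where "w \<in> V - {u}" "E x w"
      using xy(3) by (rule neighbour_if_connected)
    then show ?thesis using V xy Eirr by auto
  qed
  then obtain a b where "E u a" "E u b" "E a b" by blast
  then have "cyc E [u, a, b]" using Esym Eneq by (auto simp: cyc_def)
  then show ?thesis using that by fastforce
qed

lemma initial_cycle_two_heavy:
  assumes uv: "H = {u, v}" "u \<noteq> v"
  shows "\<exists>C. cyc E C \<and> H \<subseteq> set C \<and> (\<forall>k. 3 \<le> k \<and> k \<le> length C \<longrightarrow> has_cycle V E k)"
proof -
  have h: "u \<in> H" "v \<in> H" using uv by auto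
  note t = triangle_if_two_heavy[OF h uv(2)]
  show ?thesis
  proof (cases "E u v")
    case True
    obtain w where "E u w" "E v w" using common_neighbour[OF h] .
    then have "cyc E [u, v, w]" using True Esym Eneq by (auto simp: cyc_def)
    then show ?thesis using t uv by (intro exI[of _ "[u, v, w]"]) (auto simp: numeral_3_eq_3 le_antisym)
  next
    case False
    obtain y z where C: "cyc E [u, y, v, z]" using cyc4_if_nonadjacent[OF h False uv(2)] by blast
    have "k = 3 \<or> k = 4" if "3 \<le> k" "k \<le> 4" for k :: nat using that by auto
    then show ?thesis
      using t C cyc_has_cycle[OF C] uv by (intro exI[of _ "[u, y, v, z]"]) (auto simp: numeral_eq_Suc)
  qed
qed

text \<open>With three, two, one or no edges inside \<open>H\<close> the cycle has length 3, 4, 5 or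
  6; common neighbours link the nonadjacent pairs. A nonadjacent pair also gives length 4.\<close>

lemma initial_cycle_three_heavy:
  assumes H: "card H = 3"
  shows "\<exists>C. cyc E C \<and> H \<subseteq> set C \<and> (\<forall>k. 3 \<le> k \<and> k \<le> length C \<longrightarrow> has_cycle V E k)"
proof -
  obtain u v w where uvw: "H = {u, v, w}" "u \<noteq> v" "u \<noteq> w" "v \<noteq> w"
    using H by (auto simp: card_3_iff)
  have t: "has_cycle V E 3" by (rule triangle_if_two_heavy[of u v]) (use uvw in auto)
  have c4: "has_cycle V E 4" if nonadj: "a \<in> H" "b \<in> H" "\<not> E a b" "a \<noteq> b" for a b
  proof -
    obtain y z where "cyc E [a, y, b, z]" using cyc4_if_nonadjacent[OF nonadj] by blast
    from cyc_has_cycle[OF this] show ?thesis by (simp add: numeral_eq_Suc)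
  qed
  have path: ?thesis
    if abc: "H = {a, b, c}" "a \<noteq> b" "a \<noteq> c" "b \<noteq> c" "E a b" "E b c" "\<not> E a c" for a b c
  proof -
    have h: "a \<in> H" "c \<in> H" using abc by auto
    obtain y where y: "E a y" "E c y" "y \<noteq> b"
      using distinct_common_neighbours[OF h abc(7,3)] by metis
    then have "cyc E [a, b, c, y]" using abc Esym Eneq by (auto simp: cyc_def)
    moreover have "k = 3 \<or> k = 4" if "3 \<le> k" "k \<le> 4" for k :: nat using that by auto
    ultimately show ?thesis
      using t c4[OF h abc(7,3)] abc(1) by (intro exI[of _ "[a, b, c, y]"]) (auto simp: numeral_eq_Suc)
  qed
  have edge: ?thesis
    if abc: "H = {a, b, c}" "a \<noteq> b" "a \<noteq> c" "b \<noteq> c" "E a b" "\<not> E b c" "\<not> E a c" for a b c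
  proof -
    have h: "a \<in> H" "b \<in> H" "c \<in> H" using abc by auto
    obtain y where y: "E a y" "E c y"
      using distinct_common_neighbours[OF h(1,3) abc(7,3)] by metis
    obtain z where z: "E b z" "E c z" "z \<noteq> y"
      using distinct_common_neighbours[OF h(2,3) abc(6,4)] by metis
    have "distinct [a, b, z, c, y]" using abc y z Eirr Ecomm by auto
    then have C: "cyc E [a, b, z, c, y]" using abc y z Esym by (auto simp: cyc_def)
    have "k = 3 \<or> k = 4 \<or> k = 5" if "3 \<le> k" "k \<le> 5" for k :: nat using that by auto
    then show ?thesis
      using t c4[OF h(1,3) abc(7,3)] cyc_has_cycle[OF C] C abc(1)
      by (intro exI[of _ "[a, b, z, c, y]"]) (auto simp: numeral_eq_Suc)
  qed
  have independent: ?thesis if ind: "\<not> E u v" "\<not> E u w" "\<not> E v w"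
  proof -
    have h: "u \<in> H" "v \<in> H" "w \<in> H" using uvw by auto
    obtain y1 y2 y3 where y: "E u y1" "E v y1" "E u y2" "E v y2" "E u y3" "E v y3"
      "y1 \<noteq> y2" "y1 \<noteq> y3" "y2 \<noteq> y3"
      by (rule distinct_common_neighbours[OF h(1,2) ind(1) uvw(2)])
    have light: "x \<notin> H" if "E u x" for x
      using that ind Eirr unfolding uvw(1) by auto
    have c5: "has_cycle V E 5" if p: "E p q" "E u p" "E v q" "E u r" "E v r" "p \<noteq> r" "q \<noteq> r" for p q r
    proof -
      have "p \<noteq> v" "q \<noteq> u" "r \<noteq> u" "r \<noteq> v" "p \<noteq> u" "q \<noteq> v" "p \<noteq> q" using p ind Eirr Ecomm by auto
      then have "cyc E [u, p, q, v, r]" using p uvw Esym by (auto simp: cyc_def)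
      from cyc_has_cycle[OF this] show ?thesis by (simp add: numeral_eq_Suc)
    qed
    \<comment> \<open>Length 5 next to the 6-cycle: \<open>H\<close> is independent, so the
      neighbours of \<open>u\<close> are light and the claw forces an edge among the common
      neighbours. This edge and the third common neighbour join \<open>u\<close> and
      \<open>v\<close> to a 5-cycle.\<close>
    have "E y1 y2 \<or> E y1 y3 \<or> E y2 y3"
      using claw[of u y1 y2 y3] y light by blast
    then have five: "has_cycle V E 5"
      using c5[of y1 y2 y3] c5[of y1 y3 y2] c5[of y2 y3 y1] y by metis
    obtain z where z: "E v z" "E w z" "z \<noteq> y1"
      using distinct_common_neighbours[OF h(2,3) ind(3) uvw(4)] by metis
    \<comment> \<open>Of three common neighbours at least one avoids both \<open>y1\<close> and
      \<open>z\<close>.\<close>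
    obtain x where x: "E u x" "E w x" "x \<noteq> y1" "x \<noteq> z"
      using distinct_common_neighbours[OF h(1,3) ind(2) uvw(3)] by metis
    have "distinct [u, y1, v, z, w, x]" using uvw x y z ind Eirr Ecomm by auto
    then have C: "cyc E [u, y1, v, z, w, x]" using x y z Esym by (auto simp: cyc_def)
    have "k = 3 \<or> k = 4 \<or> k = 5 \<or> k = 6" if "3 \<le> k" "k \<le> 6" for k :: nat using that by auto
    then show ?thesis
      using t c4[OF h(1,2) ind(1) uvw(2)] five cyc_has_cycle[OF C] C uvw(1)
      by (intro exI[of _ "[u, y1, v, z, w, x]"]) (auto simp: numeral_eq_Suc)
  qed
  have full: ?thesis if "E u v" "E u w" "E v w"
  proof -
    have "cyc E [u, v, w]" using that uvw Esym by (auto simp: cyc_def)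
    then show ?thesis using t uvw(1)
      by (intro exI[of _ "[u, v, w]"]) (auto simp: numeral_3_eq_3 le_antisym)
  qed
  have sets: "H = {u, w, v}" "H = {v, u, w}" "H = {v, w, u}" "H = {w, u, v}" "H = {w, v, u}"
    using uvw by auto
  show ?thesis
  proof (cases "E u v"; cases "E u w"; cases "E v w")
  qed (use full independent path[of u v w] path[of v u w] path[of u w v]
      edge[of u v w] edge[of u w v] edge[of v w u] uvw sets Ecomm in \<open>metis+\<close>)
qed

lemma pancyclic_from_cycle:
  assumes conn: "two_connected V E" and H3: "card H \<le> 3"
    and C: "cyc E C" "H \<subseteq> set C" "\<And>k. 3 \<le> k \<Longrightarrow> k \<le> length C \<Longrightarrow> has_cycle V E k"
  shows "pancyclic V E"
  using C
proof (induction "card V - length C" arbitrary: C rule: less_induct)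
  case less
  have len: "card (set C) = length C" using less.prems(1) by (simp add: cyc_def distinct_card)
  have CV: "set C \<subseteq> V" using cyc_subset_V[OF less.prems(1)] .
  show ?case
  proof (cases "V - set C = {}")
    case True
    then have "length C = card V" using len CV by (metis Diff_eq_empty_iff subset_antisym)
    then show ?thesis using less.prems(3) by (auto simp: pancyclic_def)
  next
    case False
    then have "card (set C) < card V" using CV finV by (intro psubset_card_mono) auto
    then have lt: "length C < card V" using len by simp
    from extend_cycle[OF conn H3 less.prems(1,2) False] obtain D where
      D: "cyc E D" "H \<subseteq> set D" "length D = length C + 1 \<or> length D = length C + 2 \<and> has_cycle V E (length C + 1)"
      using cyc_has_cycle by metis
    have "has_cycle V E k" if "3 \<le> k" "k \<le> length D" for k
    proof (cases "k \<le> length C")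
      case False
      then have "k = length D \<or> k = length C + 1 \<and> length D = length C + 2" using that D(3) by auto
      then show ?thesis using D(3) cyc_has_cycle[OF D(1)] by auto
    qed (use that less.prems(3) in blast)
    moreover have "card V - length D < card V - length C" using D(3) lt by auto
    ultimately show ?thesis using less.hyps[of D] D(1,2) by blast
  qed
qed

end

theorem theorem6:
  fixes V :: "'a set" and E :: "'a \<Rightarrow> 'a \<Rightarrow> bool"
  assumes "simple_graph V E"
    and "two_connected V E"
    and "\<not> is_cycle_graph V E"
    and "R_f1_heavy V E claw_V claw_E"
    and "R_f1_heavy V E Z2_V Z2_E"
  shows "pancyclic V E"
proof -
  interpret claw_Z2_heavy_graph V E
    by unfold_locales (use assms in \<open>auto simp: simple_graph_def\<close>)
  show ?thesis
  proof (cases "card H \<le> 3")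
    case False
    show ?thesis
    proof (rule ccontr)
      assume "\<not> pancyclic V E"
      then interpret many_heavy V E
        by unfold_locales (use assms False in auto)
      show False by (rule contradiction)
    qed
  next
    case H3: True
    have small: "has_cycle V E k" if "cyc E C" "length C = 3" "3 \<le> k" "k \<le> length C" for k C
      using cyc_has_cycle[of C] that by (metis le_antisym)
    have "card H = 0 \<or> card H = 1 \<or> card H = 2 \<or> card H = 3" using H3 by linarith
    then consider "H = {}" | u where "H = {u}" | u v where "H = {u, v}" "u \<noteq> v" | "card H = 3"
      by (metis card_0_eq card_1_singletonE card_2_iff finH)
    then have "\<exists>C. cyc E C \<and> H \<subseteq> set C \<and> (\<forall>k. 3 \<le> k \<and> k \<le> length C \<longrightarrow> has_cycle V E k)"
    proof cases
      case 1
      obtain C where "cyc E C" "length C = 3" using triangle_if_no_heavy[OF assms(2,3) 1] .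
      then show ?thesis using small[of C] 1 by blast
    next
      case (2 u)
      obtain C where "cyc E C" "length C = 3" "u \<in> set C"
        using triangle_at_single_heavy[OF assms(2) 2] .
      moreover from this(3) have "H \<subseteq> set C" using 2 by simp
      ultimately show ?thesis using small[of C] by blast
    qed (use initial_cycle_two_heavy initial_cycle_three_heavy in blast)+
    then show ?thesis using pancyclic_from_cycle[OF assms(2) H3] by blast
  qed
qed

end
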